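(* Let $\omega = e^{\pi i/3} = \frac{1+i\sqrt3}{2}$. Let $L$ be an oriented link in $S^3$ that is the closure of a braid on $5$ strands. Then $$ADO_3(L;t) = LG(L;\, t^2,\, \omega^2 t^{-2}),$$ as Laurent polynomials in $t$ with coefficients in $\mathbb{Z}[\omega]$. Here $ADO_3(L;t)$ is the single-colored ADO invariant of order $3$ and $LG(L;t_0,t_1)$ is the (first) Links-Gould invariant, evaluated at $t_0=t^2$, $t_1=\omega^2t^{-2}$.
   Context: **Operator invariants.** Let $V$ be a finite-dimensional vector space (over a field containing all the parameters below), $R:V\otimes V\to V\otimes V$ an invertible linear map satisfying the braid relation, and $h:V\to V$ a linear map. Let $B_n$ be the braid group on $n$ strands with Artin generators $s_1,\dots,s_{n-1}$. Define a representation $\phi_R^n$ of $B_n$ on $V^{\otimes n}$ by $$\phi_R^n(s_i)=\mathrm{id}_V^{\otimes (i-1)}\otimes R\otimes \mathrm{id}_V^{\otimes (n-i-1)}.$$ For $\beta\in B_n$ define $$O_\beta=\mathrm{trace}_{2,\dots,n}\Big(\big(\mathrm{id}_V\otimes h^{\otimes (n-1)}\big)\circ\phi^n_R(\beta)\Big):V\to V ,$$ the partial trace over tensor factors $2,\dots,n$. For the two choices of $(V,R,h)$ below it is known that $O_\beta=c_\beta\,\mathrm{id}_V$ for a scalar $c_\beta$, and that $c_\beta$ depends only on the oriented link $L$ that is the closure of $\beta$ (it is unchanged by both Markov moves). The scalar $c_\beta$ is the value of the invariant on $L$. The same correspondence between braid words and links is used for both invariants. **The invariant $ADO_3(L;t)$**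 (all components colored by the same color $\lambda$; $t=q^\lambda$ with $q=\omega=e^{\pi i/3}$; normalized to be $1$ on the unknot and independent of framing). Take $V$ with basis $v_0,v_1,v_2$, $h(v_i)=t^2\omega^{2i}v_i$, and $R$ given by - $R(v_0\otimes v_0)=t^2\,v_0\otimes v_0$ - $R(v_0\otimes v_1)=(t^2-1)\,v_0\otimes v_1+t\,v_1\otimes v_0$ - $R(v_0\otimes v_2)=\frac{(t^2-1)(t^2-\omega^2)}{t^2}\,v_0\otimes v_2+(\omega t+t^{-1})\,v_1\otimes v_1+v_2\otimes v_0$ - $R(v_1\otimes v_0)=t\,v_0\otimes v_1$ - $R(v_1\otimes v_1)=(t-t^{-1})\,v_0\otimes v_2+\omega^2\,v_1\otimes v_1$ - $R(v_1\otimes v_2)=(\omega^2t^{-2}-1)\,v_1\otimes v_2-\omega t^{-1}\,v_2\otimes v_1$ - $R(v_2\otimes v_0)=v_0\otimes v_2$ - $R(v_2\otimes v_1)=-\omega t^{-1}\,v_1\otimes v_2$ - $R(v_2\otimes v_2)=\omega^2t^{-2}\,v_2\otimes v_2$ Then $ADO_3(L;t):=c_\beta\in\mathbb{Z}[\omega,t^{\pm1}]$. **The invariant $LG(L;t_0,t_1)$.** Take $V=W$ with basis $e_0,e_1,e_2,e_3$, $h=\mathrm{diag}(t_0^{-1},-t_1,-t_0^{-1},t_1)$ in this basis. Fix square roots $\sqrt{t_0},\sqrt{t_1}$, put $\sqrt{t_0t_1}=\sqrt{t_0}\sqrt{t_1}$ and $Y=\sqrt{(t_0-1)(1-t_1)}$.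 Let $R$ be given by - $R(e_0\otimes e_0)=t_0\,e_0\otimes e_0$ - $R(e_0\otimes e_1)=\sqrt{t_0}\,e_1\otimes e_0$ - $R(e_0\otimes e_2)=\sqrt{t_0}\,e_2\otimes e_0$ - $R(e_0\otimes e_3)=e_3\otimes e_0$ - $R(e_1\otimes e_0)=\sqrt{t_0}\,e_0\otimes e_1+(t_0-1)\,e_1\otimes e_0$ - $R(e_1\otimes e_1)=-e_1\otimes e_1$ - $R(e_1\otimes e_2)=(t_0t_1-1)\,e_1\otimes e_2-\sqrt{t_0t_1}\,e_2\otimes e_1-\sqrt{t_0t_1}\,Y\,e_3\otimes e_0$ - $R(e_1\otimes e_3)=\sqrt{t_1}\,e_3\otimes e_1$ - $R(e_2\otimes e_0)=\sqrt{t_0}\,e_0\otimes e_2+(t_0-1)\,e_2\otimes e_0$ - $R(e_2\otimes e_1)=-\sqrt{t_0t_1}\,e_1\otimes e_2+Y\,e_3\otimes e_0$ - $R(e_2\otimes e_2)=-e_2\otimes e_2$ - $R(e_2\otimes e_3)=\sqrt{t_1}\,e_3\otimes e_2$ - $R(e_3\otimes e_0)=e_0\otimes e_3-\sqrt{t_0t_1}\,Y\,e_1\otimes e_2+Y\,e_2\otimes e_1+Y^2\,e_3\otimes e_0$ - $R(e_3\otimes e_1)=\sqrt{t_1}\,e_1\otimes e_3+(t_1-1)\,e_3\otimes e_1$ - $R(e_3\otimes e_2)=\sqrt{t_1}\,e_2\otimes e_3+(t_1-1)\,e_3\otimes e_2$ - $R(e_3\otimes e_3)=t_1\,e_3\otimes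 e_3$ Then $LG(L;t_0,t_1):=c_\beta$, which is known to lie in $\mathbb{Z}[t_0^{\pm1},t_1^{\pm1}]$, so substituting $t_0=t^2$, $t_1=\omega^2t^{-2}$ is well defined. *)

theory Defs
  imports Complex_Main "HOL-Library.Poly_Mapping" "HOL-Library.Product_Plus"
begin

text \<open>
  A vector space with basis \<open>'b\<close> is given by coordinate functions \<open>'b \<Rightarrow> complex\<close>,
  its tensor square by \<open>'b \<times> 'b \<Rightarrow> complex\<close>, and its \<open>n\<close>-th tensor power by
  \<open>'b list \<Rightarrow> complex\<close>, of which only the values on lists of length \<open>n\<close> matter.
  The parameters of the invariants are nonzero complex numbers, and a Laurent polynomial is pinned
  down by its values at all of them.
\<close>

section \<open>Tensor powers and the operator invariant of a braid\<close>

definition ket :: "'b \<Rightarrow> 'b \<Rightarrow> complex" where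
  "ket b = (\<lambda>c. if c = b then 1 else 0)"

abbreviation scaled_tensor :: "complex \<Rightarrow> 'b \<Rightarrow> 'b \<Rightarrow> ('b \<times> 'b) \<Rightarrow>\<^sub>0 complex"
    ("_ \<cdot> _ \<otimes> _" [76, 76, 76] 75) where
  "c \<cdot> a \<otimes> b \<equiv> Poly_Mapping.single (a, b) c"

definition linear_ext ::
    "('b::finite \<Rightarrow> ('b \<Rightarrow>\<^sub>0 complex)) \<Rightarrow> ('b \<Rightarrow> complex) \<Rightarrow> ('b \<Rightarrow> complex)" where
  "linear_ext f x = (\<lambda>p. \<Sum>q\<in>UNIV. x q * Poly_Mapping.lookup (f q) p)"

text \<open>\<open>id\<^sup>\<otimes>\<^sup>(\<^sup>i\<^sup>-\<^sup>1\<^sup>) \<otimes> R \<otimes> id\<^sup>\<otimes>\<^sup>(\<^sup>n\<^sup>-\<^sup>i\<^sup>-\<^sup>1\<^sup>)\<close>: for fixed values of the other indices,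
  \<open>R\<close> is applied to the two-index array in tensor factors \<open>i\<close> and \<open>i + 1\<close>, which
  are the list positions \<open>i - 1\<close> and \<open>i\<close>.\<close>

definition act_at ::
    "(('b \<times> 'b \<Rightarrow> complex) \<Rightarrow> ('b \<times> 'b \<Rightarrow> complex)) \<Rightarrow> nat
      \<Rightarrow> ('b list \<Rightarrow> complex) \<Rightarrow> ('b list \<Rightarrow> complex)" where
  "act_at R i x = (\<lambda>I. R (\<lambda>(a, b). x (I[i - 1 := a, i := b])) (I ! (i - 1), I ! i))"

text \<open>Elements of the braid group on \<open>n\<close> strands are written as words in the Artin generators
  and their inverses; \<open>Gen i\<close> is \<open>s\<^sub>i\<close>.\<close>

datatype letter = Gen nat | GenInv nat

type_synonym braid_word = "letter list"

fun letter_index :: "letter \<Rightarrow> nat" where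
  "letter_index (Gen i) = i"
| "letter_index (GenInv i) = i"

definition braid_words :: "nat \<Rightarrow> braid_word set" where
  "braid_words n = {\<beta>. \<forall>l\<in>set \<beta>. 1 \<le> letter_index l \<and> letter_index l \<le> n - 1}"

fun letter_op ::
    "(('b \<times> 'b \<Rightarrow> complex) \<Rightarrow> ('b \<times> 'b \<Rightarrow> complex)) \<Rightarrow> letter
      \<Rightarrow> ('b list \<Rightarrow> complex) \<Rightarrow> ('b list \<Rightarrow> complex)" where
  "letter_op R (Gen i) = act_at R i"
| "letter_op R (GenInv i) = act_at (inv R) i"

fun braid_rep ::
    "(('b \<times> 'b \<Rightarrow> complex) \<Rightarrow> ('b \<times> 'b \<Rightarrow> complex)) \<Rightarrow> braid_word
      \<Rightarrow> ('b list \<Rightarrow> complex) \<Rightarrow> ('b list \<Rightarrow> complex)" where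
  "braid_rep R [] = id"
| "braid_rep R (l # \<beta>) = letter_op R l \<circ> braid_rep R \<beta>"

text \<open>\<open>id \<otimes> h\<^sup>\<otimes>\<^sup>(\<^sup>n\<^sup>-\<^sup>1\<^sup>)\<close> for a diagonal map with eigenvalues \<open>h\<close>.\<close>

definition tail_diag ::
    "('b \<Rightarrow> complex) \<Rightarrow> ('b list \<Rightarrow> complex) \<Rightarrow> ('b list \<Rightarrow> complex)" where
  "tail_diag h x = (\<lambda>I. (\<Prod>k\<leftarrow>tl I. h k) * x I)"

text \<open>The partial trace over the factors \<open>2, \<dots>, n\<close>, as a matrix with (row, column) arguments.\<close>

definition partial_trace ::
    "nat \<Rightarrow> (('b::finite list \<Rightarrow> complex) \<Rightarrow> ('b list \<Rightarrow> complex)) \<Rightarrow> 'b \<Rightarrow> 'b \<Rightarrow> complex" where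
  "partial_trace n T a b = (\<Sum>K\<in>{K. length K = n - 1}. T (ket (b # K)) (a # K))"

definition braid_operator ::
    "nat \<Rightarrow> ('b::finite \<times> 'b \<Rightarrow> ('b \<times> 'b \<Rightarrow>\<^sub>0 complex)) \<Rightarrow> ('b \<Rightarrow> complex) \<Rightarrow> braid_word
      \<Rightarrow> 'b \<Rightarrow> 'b \<Rightarrow> complex" where
  "braid_operator n R h \<beta> = partial_trace n (tail_diag h \<circ> braid_rep (linear_ext R) \<beta>)"

definition scalar_op :: "complex \<Rightarrow> 'b \<Rightarrow> 'b \<Rightarrow> complex" where
  "scalar_op c = (\<lambda>a b. if a = b then c else 0)"

section \<open>Laurent polynomials\<close>

text \<open>Laurent polynomials are finitely supported functions of the exponents, i.e. elements of
  the group algebra of \<open>\<int>\<close> resp. \<open>\<int> \<times> \<int>\<close>.\<close>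

type_synonym laurent = "int \<Rightarrow>\<^sub>0 complex"
type_synonym laurent2 = "(int \<times> int) \<Rightarrow>\<^sub>0 int"

definition laurent_eval :: "laurent \<Rightarrow> complex \<Rightarrow> complex" where
  "laurent_eval p t = (\<Sum>k\<in>Poly_Mapping.keys p. Poly_Mapping.lookup p k * t powi k)"

definition laurent2_eval :: "laurent2 \<Rightarrow> complex \<Rightarrow> complex \<Rightarrow> complex" where
  "laurent2_eval p t0 t1 =
     (\<Sum>(j, k)\<in>Poly_Mapping.keys p. of_int (Poly_Mapping.lookup p (j, k)) * t0 powi j * t1 powi k)"

definition omega :: complex where
  "omega = exp (\<i> * of_real pi / 3)"

definition Z_omega :: "complex set" where
  "Z_omega = {of_int a + of_int b * omega | a b. True}"

text \<open>The substitution \<open>t\<^sub>0 = t\<^sup>2\<close>, \<open>t\<^sub>1 = \<omega>\<^sup>2 t\<^sup>-\<^sup>2\<close>, under which \<open>t\<^sub>0\<^sup>j t\<^sub>1\<^sup>k\<close> becomes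
  \<open>\<omega>\<^sup>2\<^sup>k t\<^sup>2\<^sup>j\<^sup>-\<^sup>2\<^sup>k\<close>.\<close>

definition subst_t2_omega :: "laurent2 \<Rightarrow> laurent" where
  "subst_t2_omega p =
     (\<Sum>(j, k)\<in>Poly_Mapping.keys p.
        Poly_Mapping.single (2 * j - 2 * k)
          (of_int (Poly_Mapping.lookup p (j, k)) * (omega ^ 2) powi k))"

section \<open>The invariant \<open>ADO\<^sub>3\<close>\<close>

datatype ado_basis = v0 | v1 | v2

instance ado_basis :: finite
proof
  have "(UNIV :: ado_basis set) \<subseteq> {v0, v1, v2}"
    using ado_basis.exhaust by blast
  then show "finite (UNIV :: ado_basis set)"
    by (rule finite_subset) simp
qed

fun ado_R :: "complex \<Rightarrow> ado_basis \<times> ado_basis \<Rightarrow> (ado_basis \<times> ado_basis \<Rightarrow>\<^sub>0 complex)" where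
  "ado_R t (v0, v0) = t^2 \<cdot> v0 \<otimes> v0"
| "ado_R t (v0, v1) = (t^2 - 1) \<cdot> v0 \<otimes> v1 + t \<cdot> v1 \<otimes> v0"
| "ado_R t (v0, v2) = ((t^2 - 1) * (t^2 - omega^2) / t^2) \<cdot> v0 \<otimes> v2
                        + (omega * t + inverse t) \<cdot> v1 \<otimes> v1 + 1 \<cdot> v2 \<otimes> v0"
| "ado_R t (v1, v0) = t \<cdot> v0 \<otimes> v1"
| "ado_R t (v1, v1) = (t - inverse t) \<cdot> v0 \<otimes> v2 + omega^2 \<cdot> v1 \<otimes> v1"
| "ado_R t (v1, v2) = (omega^2 / t^2 - 1) \<cdot> v1 \<otimes> v2 + (- omega / t) \<cdot> v2 \<otimes> v1"
| "ado_R t (v2, v0) = 1 \<cdot> v0 \<otimes> v2"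
| "ado_R t (v2, v1) = (- omega / t) \<cdot> v1 \<otimes> v2"
| "ado_R t (v2, v2) = (omega^2 / t^2) \<cdot> v2 \<otimes> v2"

fun ado_h :: "complex \<Rightarrow> ado_basis \<Rightarrow> complex" where
  "ado_h t v0 = t^2"
| "ado_h t v1 = t^2 * omega^2"
| "ado_h t v2 = t^2 * omega^4"

definition ADO3 :: "nat \<Rightarrow> braid_word \<Rightarrow> laurent" where
  "ADO3 n \<beta> = (THE p. (\<forall>k. Poly_Mapping.lookup p k \<in> Z_omega) \<and>
     (\<forall>t. t \<noteq> 0 \<longrightarrow>
        braid_operator n (ado_R t) (ado_h t) \<beta> = scalar_op (laurent_eval p t)))"

section \<open>The Links-Gould invariant\<close>

datatype lg_basis = e0 | e1 | e2 | e3

instance lg_basis :: finite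
proof
  have "(UNIV :: lg_basis set) \<subseteq> {e0, e1, e2, e3}"
    using lg_basis.exhaust by blast
  then show "finite (UNIV :: lg_basis set)"
    by (rule finite_subset) simp
qed

text \<open>The parameters \<open>r0\<close>, \<open>r1\<close>, \<open>Y\<close> stand for the square roots of \<open>t\<^sub>0\<close>, \<open>t\<^sub>1\<close>
  and \<open>(t\<^sub>0 - 1) (1 - t\<^sub>1)\<close>.\<close>

fun lg_R :: "complex \<Rightarrow> complex \<Rightarrow> complex
    \<Rightarrow> lg_basis \<times> lg_basis \<Rightarrow> (lg_basis \<times> lg_basis \<Rightarrow>\<^sub>0 complex)" where
  "lg_R r0 r1 Y (e0, e0) = r0^2 \<cdot> e0 \<otimes> e0"
| "lg_R r0 r1 Y (e0, e1) = r0 \<cdot> e1 \<otimes> e0"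
| "lg_R r0 r1 Y (e0, e2) = r0 \<cdot> e2 \<otimes> e0"
| "lg_R r0 r1 Y (e0, e3) = 1 \<cdot> e3 \<otimes> e0"
| "lg_R r0 r1 Y (e1, e0) = r0 \<cdot> e0 \<otimes> e1 + (r0^2 - 1) \<cdot> e1 \<otimes> e0"
| "lg_R r0 r1 Y (e1, e1) = (- 1) \<cdot> e1 \<otimes> e1"
| "lg_R r0 r1 Y (e1, e2) = (r0^2 * r1^2 - 1) \<cdot> e1 \<otimes> e2 + (- (r0 * r1)) \<cdot> e2 \<otimes> e1
                              + (- (r0 * r1 * Y)) \<cdot> e3 \<otimes> e0"
| "lg_R r0 r1 Y (e1, e3) = r1 \<cdot> e3 \<otimes> e1"
| "lg_R r0 r1 Y (e2, e0) = r0 \<cdot> e0 \<otimes> e2 + (r0^2 - 1) \<cdot> e2 \<otimes> e0"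
| "lg_R r0 r1 Y (e2, e1) = (- (r0 * r1)) \<cdot> e1 \<otimes> e2 + Y \<cdot> e3 \<otimes> e0"
| "lg_R r0 r1 Y (e2, e2) = (- 1) \<cdot> e2 \<otimes> e2"
| "lg_R r0 r1 Y (e2, e3) = r1 \<cdot> e3 \<otimes> e2"
| "lg_R r0 r1 Y (e3, e0) = 1 \<cdot> e0 \<otimes> e3 + (- (r0 * r1 * Y)) \<cdot> e1 \<otimes> e2
                              + Y \<cdot> e2 \<otimes> e1 + Y^2 \<cdot> e3 \<otimes> e0"
| "lg_R r0 r1 Y (e3, e1) = r1 \<cdot> e1 \<otimes> e3 + (r1^2 - 1) \<cdot> e3 \<otimes> e1"
| "lg_R r0 r1 Y (e3, e2) = r1 \<cdot> e2 \<otimes> e3 + (r1^2 - 1) \<cdot> e3 \<otimes> e2"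
| "lg_R r0 r1 Y (e3, e3) = r1^2 \<cdot> e3 \<otimes> e3"

fun lg_h :: "complex \<Rightarrow> complex \<Rightarrow> lg_basis \<Rightarrow> complex" where
  "lg_h t0 t1 e0 = inverse t0"
| "lg_h t0 t1 e1 = - t1"
| "lg_h t0 t1 e2 = - inverse t0"
| "lg_h t0 t1 e3 = t1"

definition LG :: "nat \<Rightarrow> braid_word \<Rightarrow> laurent2" where
  "LG n \<beta> = (THE p. \<forall>t0 t1 r0 r1 Y.
     t0 \<noteq> 0 \<and> t1 \<noteq> 0 \<and> r0^2 = t0 \<and> r1^2 = t1 \<and> Y^2 = (t0 - 1) * (1 - t1) \<longrightarrow>
        braid_operator n (lg_R r0 r1 Y) (lg_h t0 t1) \<beta> = scalar_op (laurent2_eval p t0 t1))"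

end

theory Submission
  imports Defs
begin

text \<open>
  The Links--Gould module is an exterior algebra \<open>1 \<oplus> \<complex>\<^sup>2 \<oplus> 1\<close> over quantum \<open>sl\<^sub>2\<close>, and its \<open>R\<close>-matrix acts on
  the middle factors \<open>\<complex>\<^sup>2\<close> by Temperley--Lieb operators whose loop value is, up to sign, \<open>s + s\<^sup>-\<^sup>1\<close> with
  \<open>s\<^sup>2 = t\<^sub>0 t\<^sub>1\<close>. At \<open>t\<^sub>0 t\<^sub>1 = \<omega>\<^sup>2\<close> the loop value can be normalised to one, so that every Temperley--Lieb diagram
  may be replaced by the number one without changing traces. Then \<open>\<complex>\<^sup>2\<close> collapses to a line and
  the Links--Gould \<open>R\<close>-matrix becomes the \<open>ADO\<^sub>3\<close> matrix with its two strands interchanged. Closing the interchanged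
  strands computes \<open>ADO\<^sub>3\<close> from a partial trace over the first instead of the last strands; the two
  agree because operators on two strands commuting with quantum \<open>sl\<^sub>2\<close> have equal left and right
  partial traces, and because reversing the order of the strands is conjugation by the half twist.

  Closures are scalars since they commute with raising operators. The Links--Gould scalars
  are integral Laurent polynomials since the square roots in the matrix entries can be gauged away.
\<close>

section \<open>Matrices indexed by words\<close>

text \<open>Inverse letters are covered along with the generators: both matrices satisfy a cubic
  equation, so an inverse generator is a polynomial in the generator, and weight conservation,
  commutation with raising operators, collapse and integrality all pass to products and linear
  combinations.

  The square root \<open>Y\<close> is avoided by letting \<open>A\<close> and \<open>B\<close> with
  \<open>A * B = (t0 - 1) * (1 - t1)\<close> take its places, which amounts to rescaling
  \<open>e3\<close>. Closures depend on the product only, so three choices can be compared: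
  \<open>A = B = Y\<close> is the given matrix, \<open>A = t0 - 1\<close> and
  \<open>B = 1 - t1\<close> suits the odd raising operator, and \<open>lg_special\<close> matches
  ADO_3.

  The strands are interchanged because the entry \<open>t0 - 1\<close> sits at
  \<open>e1 \<otimes> e0\<close> on one side and at \<open>v0 \<otimes> v1\<close> on the other.
  Comparing left and right partial traces divides by \<open>t^2 - 1\<close> and by
  \<open>omega^4 - omega^2 * t^2\<close>; the excluded values of \<open>t\<close> are recovered by
  continuity. The number five enters through the half twist.\<close>

type_synonym 'b mat = "'b list \<Rightarrow> 'b list \<Rightarrow> complex"
type_synonym 'b kernel = "'b \<times> 'b \<Rightarrow> 'b \<times> 'b \<Rightarrow> complex"

abbreviation wprod :: "('b \<Rightarrow> complex) \<Rightarrow> 'b list \<Rightarrow> complex" where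
  "wprod w I \<equiv> prod_list (map w I)"

abbreviation wsum :: "('b \<Rightarrow> nat \<times> nat) \<Rightarrow> 'b list \<Rightarrow> nat \<times> nat" where
  "wsum w I \<equiv> sum_list (map w I)"

definition words :: "nat \<Rightarrow> 'b list set" where
  "words n = {I. length I = n}"

definition mm :: "nat \<Rightarrow> 'b mat \<Rightarrow> 'b mat \<Rightarrow> 'b mat" where
  "mm n A B = (\<lambda>I J. \<Sum>K\<in>words n. A I K * B K J)"

definition idm :: "nat \<Rightarrow> 'b mat" where
  "idm n I J = of_bool (I = J \<and> length I = n)"

definition madd :: "'b mat \<Rightarrow> 'b mat \<Rightarrow> 'b mat" where
  "madd A B = (\<lambda>I J. A I J + B I J)"

definition mscale :: "complex \<Rightarrow> 'b mat \<Rightarrow> 'b mat" where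
  "mscale c A = (\<lambda>I J. c * A I J)"

text \<open>Matrix indices range over lists of every length. Vanishing outside the intended lengths
  turns equality of operators into equality of functions, which can be rewritten with; two lengths
  are kept because cups and caps change the number of strands.\<close>

definition mat_supp :: "nat \<Rightarrow> nat \<Rightarrow> 'b mat \<Rightarrow> bool" where
  "mat_supp k m A \<longleftrightarrow> (\<forall>I J. A I J \<noteq> 0 \<longrightarrow> length I = k \<and> length J = m)"

text \<open>Tensoring with the identity on a new first strand. Being compatible with products, it
  reduces statements on a generator at any position to position zero.\<close>

fun sh :: "'b mat \<Rightarrow> 'b mat" where
  "sh A (a # I) (b # J) = (if a = b then A I J else 0)"
| "sh A I J = 0"

lemma words_0 [simp]: "words 0 = {[]}"
  by (auto simp: words_def)

lemma finite_words [simp, intro]: "finite (words n :: 'b::finite list set)"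
  using finite_lists_length_eq[of "UNIV :: 'b set" n] by (simp add: words_def)

lemma in_words [simp]: "I \<in> words n \<longleftrightarrow> length I = n"
  by (simp add: words_def)

lemma sum_words_Suc:
  "(\<Sum>I\<in>words (Suc n). f I) = (\<Sum>a\<in>(UNIV::'b::finite set). \<Sum>I\<in>words n. f (a # I))"
proof -
  have "(\<Sum>I\<in>words (Suc n). f I) = (\<Sum>(a, I)\<in>UNIV \<times> words n. f (a # I))"
    by (rule sum.reindex_bij_witness[where i = "\<lambda>(a, I). a # I" and j = "\<lambda>I. (hd I, tl I)"])
       (auto simp: length_Suc_conv)
  then show ?thesis by (simp add: sum.cartesian_product)
qed

lemma sum_words_snoc:
  "(\<Sum>I\<in>words (Suc n). f I) = (\<Sum>I\<in>words n. \<Sum>a\<in>(UNIV::'b::finite set). f (I @ [a]))"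
proof -
  have "(\<Sum>I\<in>words (Suc n). f I) = (\<Sum>(I, a)\<in>words n \<times> UNIV. f (I @ [a]))"
    by (rule sum.reindex_bij_witness[where i = "\<lambda>(I, a). I @ [a]" and j = "\<lambda>I. (butlast I, last I)"])
       (auto simp: append_butlast_last_id simp flip: length_greater_0_conv)
  then show ?thesis by (simp add: sum.cartesian_product)
qed

lemma sum_words_head:
  assumes "\<And>b I. b \<noteq> a \<Longrightarrow> length I = n \<Longrightarrow> f (b # I) = 0"
  shows "(\<Sum>I\<in>words (Suc n). f I) = (\<Sum>I\<in>words n. f ((a :: 'b::finite) # I))"
proof -
  have "(\<Sum>I\<in>words (Suc n). f I) = (\<Sum>b\<in>UNIV. if b = a then \<Sum>I\<in>words n. f (a # I) else 0)"
    unfolding sum_words_Suc using assms by (intro sum.cong) auto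
  then show ?thesis by simp
qed

lemma sum_words_last:
  assumes "\<And>b I. b \<noteq> a \<Longrightarrow> length I = n \<Longrightarrow> f (I @ [b]) = 0"
  shows "(\<Sum>I\<in>words (Suc n). f I) = (\<Sum>I\<in>words n. f (I @ [a :: 'b::finite]))"
proof -
  have "(\<Sum>I\<in>words (Suc n). f I) = (\<Sum>I\<in>words n. \<Sum>b\<in>UNIV. if b = a then f (I @ [a]) else 0)"
    unfolding sum_words_snoc using assms by (intro sum.cong) auto
  then show ?thesis by simp
qed

lemma sum_words_rev: "(\<Sum>I\<in>words n. f (rev I)) = (\<Sum>I\<in>(words n :: 'b::finite list set). f I)"
  by (rule sum.reindex_bij_witness[where i = rev and j = rev]) auto

lemma mm_assoc: "mm n (mm m A B) C = mm m A (mm n B (C :: 'b::finite mat))"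
  unfolding mm_def
  by (intro ext, simp add: sum_distrib_left sum_distrib_right mult.assoc, rule sum.swap)

lemma mat_supp_idm [simp]: "mat_supp n n (idm n)"
  by (auto simp: mat_supp_def idm_def)

lemma mat_supp_mm [simp]: "mat_supp k n A \<Longrightarrow> mat_supp n m B \<Longrightarrow> mat_supp k m (mm n A B)"
  unfolding mat_supp_def mm_def
  by (metis (no_types, lifting) mult_eq_0_iff sum.neutral)

lemma mat_supp_madd [simp]: "mat_supp k m A \<Longrightarrow> mat_supp k m B \<Longrightarrow> mat_supp k m (madd A B)"
  unfolding mat_supp_def madd_def by (metis add.right_neutral)

lemma mat_supp_mscale [simp]: "mat_supp k m A \<Longrightarrow> mat_supp k m (mscale c A)"
  unfolding mat_supp_def mscale_def by auto

lemma mat_suppI_ext: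
  assumes "mat_supp k m A" "mat_supp k m B" "\<And>I J. length I = k \<Longrightarrow> length J = m \<Longrightarrow> A I J = B I J"
  shows "A = B"
  using assms unfolding mat_supp_def by (intro ext) metis

lemma mm_idm_row: "length I = n \<Longrightarrow> mm n (idm n) M I J = (M :: ('b::finite) mat) I J"
proof -
  assume "length I = n"
  moreover have "mm n (idm n) M I J = (\<Sum>K\<in>words n. if K = I then M I J else 0)"
    unfolding mm_def by (intro sum.cong) (auto simp: idm_def)
  ultimately show ?thesis by simp
qed

lemma mm_idm_col: "length J = n \<Longrightarrow> mm n M (idm n) I J = (M :: ('b::finite) mat) I J"
proof -
  assume "length J = n"
  moreover have "mm n M (idm n) I J = (\<Sum>K\<in>words n. if K = J then M I J else 0)"
    unfolding mm_def by (intro sum.cong) (auto simp: idm_def)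
  ultimately show ?thesis by simp
qed

lemma mm_idm_left: "mat_supp n m A \<Longrightarrow> mm n (idm n) A = (A :: ('b::finite) mat)"
  by (rule mat_suppI_ext[OF mat_supp_mm[OF mat_supp_idm]]) (auto simp: mm_idm_row)

lemma mm_idm_right: "mat_supp m n A \<Longrightarrow> mm n A (idm n) = (A :: ('b::finite) mat)"
  by (rule mat_suppI_ext[OF mat_supp_mm[OF _ mat_supp_idm]]) (auto simp: mm_idm_col)

lemma sh_eqI:
  assumes "\<And>a I b J. B (a # I) (b # J) = (if a = b then A I J else 0)" "\<And>J. B [] J = 0" "\<And>I. B I [] = 0"
  shows "sh A = B"
proof (intro ext)
  fix I J show "sh A I J = B I J"
    by (cases "(A, I, J)" rule: sh.cases) (auto simp: assms)
qed

lemma sh_idm [simp]: "sh (idm n) = idm (Suc n)"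
  by (rule sh_eqI) (auto simp: idm_def)

lemma sh_madd: "sh (madd A B) = madd (sh A) (sh B)"
  by (rule sh_eqI) (auto simp: madd_def)

lemma sh_mscale: "sh (mscale c A) = mscale c (sh A)"
  by (rule sh_eqI) (auto simp: mscale_def)

lemma sh_mm: "sh (mm n A B) = mm (Suc n) (sh A) (sh (B :: 'b::finite mat))"
proof (intro ext)
  fix I J :: "'b list"
  show "sh (mm n A B) I J = mm (Suc n) (sh A) (sh B) I J"
  proof (cases "(A, I, J)" rule: sh.cases)
    case (1 A' a I' b J')
    then show ?thesis unfolding mm_def by (subst sum_words_head[of a]) auto
  qed (auto simp: mm_def sum_words_Suc)
qed

lemma mm_madd_left: "mm n (madd A B) C = madd (mm n A C) (mm n B C)"
  and mm_madd_right: "mm n C (madd A B) = madd (mm n C A) (mm n C B)"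
  and mm_mscale_left: "mm n (mscale c A) C = mscale c (mm n A C)"
  and mm_mscale_right: "mm n C (mscale c A) = mscale c (mm n C A)"
  by (auto simp: mm_def madd_def mscale_def sum.distrib sum_distrib_left algebra_simps)


section \<open>Generators\<close>

definition kop :: "('b::finite) kernel \<Rightarrow> ('b \<times> 'b \<Rightarrow> complex) \<Rightarrow> ('b \<times> 'b \<Rightarrow> complex)" where
  "kop r x = (\<lambda>p. \<Sum>q\<in>UNIV. r p q * x q)"

definition kmul :: "('b::finite) kernel \<Rightarrow> 'b kernel \<Rightarrow> 'b kernel" where
  "kmul r r' = (\<lambda>p q. \<Sum>z\<in>UNIV. r p z * r' z q)"

definition kid :: "'b kernel" where
  "kid = (\<lambda>p q. of_bool (p = q))"

definition ker_of :: "('b \<times> 'b \<Rightarrow> ('b \<times> 'b \<Rightarrow>\<^sub>0 complex)) \<Rightarrow> 'b kernel" where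
  "ker_of R = (\<lambda>p q. Poly_Mapping.lookup (R q) p)"

lemma linear_ext_kop: "linear_ext R = kop (ker_of R)"
  by (intro ext) (simp add: linear_ext_def kop_def ker_of_def mult.commute)

lemma kop_kmul: "kop (kmul r r') x = kop r (kop r' x)"
  unfolding kop_def kmul_def
  by (intro ext, simp add: sum_distrib_left sum_distrib_right mult.assoc, rule sum.swap)

lemma kop_kid [simp]: "kop kid x = x"
  unfolding kop_def kid_def by (intro ext) (simp add: of_bool_def if_distrib[of "\<lambda>a. a * _"] cong: if_cong)

lemma kmul_column: "kmul r r' p q = kop r (\<lambda>z. r' z q) p"
  by (simp add: kop_def kmul_def)

lemma kmul_assoc: "kmul (kmul r r') r'' = kmul r (kmul r' r'')"
  unfolding kmul_def
  by (intro ext, simp add: sum_distrib_left sum_distrib_right mult.assoc, rule sum.swap)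

lemma kmul_kid [simp]: "kmul kid r = r" "kmul r kid = r"
  by (auto simp: kmul_def kid_def of_bool_def if_distrib[of "\<lambda>a. a * _"] if_distrib[of "\<lambda>a. _ * a"] cong: if_cong)

text \<open>Positions start from zero: \<open>gen_mat n r i\<close> is the image of \<open>s\<^sub>i\<^sub>+\<^sub>1\<close>.\<close>

fun gm :: "'b kernel \<Rightarrow> nat \<Rightarrow> 'b mat" where
  "gm r 0 (a # b # I) (c # d # J) = (if I = J then r (a, b) (c, d) else 0)"
| "gm r (Suc i) (a # I) (c # J) = (if a = c then gm r i I J else 0)"
| "gm r i I J = 0"

definition gen_mat :: "nat \<Rightarrow> 'b kernel \<Rightarrow> nat \<Rightarrow> 'b mat" where
  "gen_mat n r i I J = (if length I = n then gm r i I J else 0)"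

lemma gm_length: "gm r i I J \<noteq> 0 \<Longrightarrow> length I = length J"
  by (induction r i I J rule: gm.induct) (auto split: if_splits)

lemma mat_supp_gen [simp]: "mat_supp n n (gen_mat n r i)"
  using gm_length by (fastforce simp: mat_supp_def gen_mat_def split: if_splits)

lemma gen_mat_Suc: "gen_mat (Suc n) r (Suc i) = sh (gen_mat n r i)"
  by (rule sh_eqI[symmetric]) (auto simp: gen_mat_def)

lemma gen_mat_0:
  "gen_mat (Suc (Suc n)) r 0 (a # b # I) (c # d # J) = (if I = J \<and> length I = n then r (a, b) (c, d) else 0)"
  by (auto simp: gen_mat_def)

lemma sum_pair_UNIV: "(\<Sum>q\<in>(UNIV :: ('a::finite \<times> 'b::finite) set). f q) = (\<Sum>a\<in>UNIV. \<Sum>b\<in>UNIV. f (a, b))"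
  by (simp add: sum.cartesian_product)

lemma mm_gen_mat_0:
  assumes "length I = n"
  shows "mm (Suc (Suc n)) (gen_mat (Suc (Suc n)) r 0) M (a # b # I) J
       = (\<Sum>q\<in>(UNIV :: ('b::finite \<times> 'b) set). r (a, b) q * M (fst q # snd q # I) J)"
proof -
  have "mm (Suc (Suc n)) (gen_mat (Suc (Suc n)) r 0) M (a # b # I) J
     = (\<Sum>c\<in>UNIV. \<Sum>d\<in>UNIV. \<Sum>K\<in>words n. if K = I then r (a, b) (c, d) * M (c # d # I) J else 0)"
    using assms unfolding mm_def sum_words_Suc by (intro sum.cong) (auto simp: gen_mat_0)
  also have "\<dots> = (\<Sum>c\<in>UNIV. \<Sum>d\<in>UNIV. r (a, b) (c, d) * M (c # d # I) J)"
    using assms by simp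
  finally show ?thesis by (simp add: sum_pair_UNIV)
qed

lemma mm_gen_mat_0_right:
  assumes "length J = n"
  shows "mm (Suc (Suc n)) M (gen_mat (Suc (Suc n)) r 0) I (c # d # J)
       = (\<Sum>q\<in>(UNIV :: ('b::finite \<times> 'b) set). M I (fst q # snd q # J) * r q (c, d))"
proof -
  have "mm (Suc (Suc n)) M (gen_mat (Suc (Suc n)) r 0) I (c # d # J)
     = (\<Sum>a\<in>UNIV. \<Sum>b\<in>UNIV. \<Sum>K\<in>words n. if K = J then M I (a # b # J) * r (a, b) (c, d) else 0)"
    using assms unfolding mm_def sum_words_Suc by (intro sum.cong) (auto simp: gen_mat_0)
  also have "\<dots> = (\<Sum>a\<in>UNIV. \<Sum>b\<in>UNIV. M I (a # b # J) * r (a, b) (c, d))"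
    using assms by simp
  finally show ?thesis by (simp add: sum_pair_UNIV)
qed

lemma length_Suc2: "Suc i < n \<Longrightarrow> \<exists>m. n = Suc (Suc m)"
  by presburger

lemma gen_mat_kmul:
  assumes "Suc i < n"
  shows "mm n (gen_mat n r i) (gen_mat n r' i) = gen_mat n (kmul r r') (i :: nat)"
  using assms
proof (induction i arbitrary: n)
  case 0
  then obtain m where n: "n = Suc (Suc m)" using length_Suc2 by blast
  show ?case
  proof (rule mat_suppI_ext[where k = n and m = n])
    fix I J :: "'a list" assume "length I = n" "length J = n"
    then obtain a b I' c d J' where "I = a # b # I'" "J = c # d # J'" "length I' = m" "length J' = m"
      using n by (metis length_Suc_conv)
    then show "mm n (gen_mat n r 0) (gen_mat n r' 0) I J = gen_mat n (kmul r r') 0 I J"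
      using n by (auto simp: mm_gen_mat_0 gen_mat_0 kmul_def)
  qed auto
next
  case (Suc i)
  then obtain m where "n = Suc m" by (cases n) auto
  then show ?case using Suc by (simp add: gen_mat_Suc flip: sh_mm)
qed

lemma gen_mat_kid: "Suc i < n \<Longrightarrow> gen_mat n kid i = idm n"
proof (induction i arbitrary: n)
  case 0
  then obtain m where n: "n = Suc (Suc m)" using length_Suc2 by blast
  show ?case
  proof (rule mat_suppI_ext[where k = n and m = n])
    fix I J :: "'a list" assume "length I = n" "length J = n"
    then obtain a b I' c d J' where "I = a # b # I'" "J = c # d # J'" "length I' = m" "length J' = m"
      using n by (metis length_Suc_conv)
    then show "gen_mat n kid 0 I J = idm n I J"
      using n by (auto simp: gen_mat_0 kid_def idm_def)
  qed auto
next
  case (Suc i)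
  then obtain m where "n = Suc m" by (cases n) auto
  then show ?case using Suc by (simp add: gen_mat_Suc)
qed

lemma gm_linear: "gm (\<lambda>p q. c * r p q + c' * r' p q) i I J = c * gm r i I J + c' * gm r' i I J"
  by (induction r i I J rule: gm.induct) auto

lemma gen_mat_linear:
  "gen_mat n (\<lambda>p q. c * r p q + c' * r' p q) i = madd (mscale c (gen_mat n r i)) (mscale c' (gen_mat n r' i))"
  by (intro ext) (simp add: gen_mat_def gm_linear madd_def mscale_def)

text \<open>Both \<open>R\<close>-matrices have the eigenvalues \<open>t\<^sub>0\<close>, \<open>-1\<close>, \<open>t\<^sub>1\<close>, so that
  \<open>R\<^sup>-\<^sup>1\<close> is a quadratic polynomial in \<open>R\<close>. The redundant coefficients of \<open>kinv\<close> fit the linearity lemmas.\<close>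

definition cubic :: "complex \<Rightarrow> complex \<Rightarrow> ('b::finite) kernel \<Rightarrow> bool" where
  "cubic t0 t1 r \<longleftrightarrow> t0 \<noteq> 0 \<and> t1 \<noteq> 0 \<and> (\<forall>x p. kop r (kop r (kop r x)) p + (1 - t0 - t1) * kop r (kop r x) p
     + (t0 * t1 - t0 - t1) * kop r x p + t0 * t1 * x p = 0)"

definition kinv :: "complex \<Rightarrow> complex \<Rightarrow> ('b::finite) kernel \<Rightarrow> 'b kernel" where
  "kinv t0 t1 r = (\<lambda>p q. (- 1 / (t0 * t1)) * (1 * kmul r r p q
      + 1 * ((1 - t0 - t1) * r p q + (t0 * t1 - t0 - t1) * kid p q)) + 0 * kid p q)"

text \<open>Applying the cubic relation to the columns of the identity kernel lifts it from vectors
  to kernels; on vectors it can be checked entry by entry with the tables for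
  \<open>kop\<close>.\<close>

lemma cubic_kmul:
  assumes "cubic t0 t1 r"
  shows "kmul r (kmul r r) p q + (1 - t0 - t1) * kmul r r p q + (t0 * t1 - t0 - t1) * r p q
      + t0 * t1 * kid p q = 0"
proof -
  have *: "(\<lambda>z. kid z q) = (\<lambda>z. of_bool (z = q))" for q :: "'a \<times> 'a"
    by (simp add: kid_def)
  have r: "kop r (\<lambda>z. kid z q) = (\<lambda>z. r z q)"
    by (metis kmul_column kmul_kid(2) ext)
  have rr: "kop r (\<lambda>z. r z q) = (\<lambda>z. kmul r r z q)"
    by (metis kmul_column ext)
  have rrr: "kop r (\<lambda>z. kmul r r z q) = (\<lambda>z. kmul r (kmul r r) z q)"
    by (metis kmul_column ext)
  show ?thesis
    using assms[unfolded cubic_def, THEN conjunct2, THEN conjunct2, rule_format, of "\<lambda>z. kid z q" p]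
    by (simp only: r rr rrr)
qed

lemma kmul_linear:
  "kmul s (\<lambda>p q. c * r p q + c' * r' p q) = (\<lambda>p q. c * kmul s r p q + c' * kmul s r' p q)"
  "kmul (\<lambda>p q. c * r p q + c' * r' p q) s = (\<lambda>p q. c * kmul r s p q + c' * kmul r' s p q)"
  by (intro ext; simp add: kmul_def sum_distrib_left algebra_simps flip: sum.distrib)+

lemma kmul_kinv:
  assumes "cubic t0 t1 r"
  shows "kmul r (kinv t0 t1 r) = kid" "kmul (kinv t0 t1 r) r = kid"
proof -
  have nz: "t0 * t1 \<noteq> 0" using assms by (auto simp: cubic_def)
  have key: "(- 1 / (t0 * t1)) * (kmul r (kmul r r) p q + ((1 - t0 - t1) * kmul r r p q
      + (t0 * t1 - t0 - t1) * r p q)) = kid p q" for p q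
    using cubic_kmul[OF assms, of p q] nz by (simp add: divide_simps) algebra
  show "kmul r (kinv t0 t1 r) = kid" "kmul (kinv t0 t1 r) r = kid"
    unfolding kinv_def kmul_linear kmul_kid kmul_assoc using key by (auto simp: fun_eq_iff)
qed

lemma gen_mat_kinv:
  assumes "Suc i < n"
  shows "gen_mat n (kinv t0 t1 r) i = mscale (- 1 / (t0 * t1))
     (madd (mm n (gen_mat n r i) (gen_mat n r i))
        (madd (mscale (1 - t0 - t1) (gen_mat n r i)) (mscale (t0 * t1 - t0 - t1) (idm n))))"
  unfolding kinv_def gen_mat_linear gen_mat_kmul[OF assms] gen_mat_kid[OF assms]
  by (intro ext) (simp add: madd_def mscale_def)

section \<open>Braid words as products of matrices\<close>

fun letter_mat :: "nat \<Rightarrow> ('b::finite) kernel \<Rightarrow> 'b kernel \<Rightarrow> letter \<Rightarrow> 'b mat" where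
  "letter_mat n r r' (Gen i) = gen_mat n r (i - 1)"
| "letter_mat n r r' (GenInv i) = gen_mat n r' (i - 1)"

fun braid_mat :: "nat \<Rightarrow> ('b::finite) kernel \<Rightarrow> 'b kernel \<Rightarrow> braid_word \<Rightarrow> 'b mat" where
  "braid_mat n r r' [] = idm n"
| "braid_mat n r r' (l # \<beta>) = mm n (letter_mat n r r' l) (braid_mat n r r' \<beta>)"

lemma mat_supp_letter [simp]: "mat_supp n n (letter_mat n r r' l)"
  by (cases l) auto

lemma mat_supp_braid [simp]: "mat_supp n n (braid_mat n r r' \<beta>)"
  by (induction \<beta>) auto

lemma braid_words_induct [consumes 1, case_names Nil Cons]:
  assumes "\<beta> \<in> braid_words n" "P []"
    and "\<And>l \<beta>. 1 \<le> letter_index l \<Longrightarrow> letter_index l \<le> n - 1 \<Longrightarrow> \<beta> \<in> braid_words n \<Longrightarrow> P \<beta> \<Longrightarrow> P (l # \<beta>)"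
  shows "P \<beta>"
  using assms(1) by (induction \<beta>) (auto simp: braid_words_def assms(2) intro!: assms(3))

text \<open>By \<open>gen_mat_kinv\<close> the matrix of an inverse letter is a quadratic polynomial
  in that of the generator, so stability under the algebra operations carries a property from the
  generators to all braids.\<close>

lemma braid_mat_closed:
  assumes "\<beta> \<in> braid_words n" and "P (idm n)" and gen: "\<And>i. Suc i < n \<Longrightarrow> P (gen_mat n r i)"
    and mm: "\<And>A B. P A \<Longrightarrow> P B \<Longrightarrow> P (mm n A B)" and "\<And>A B. P A \<Longrightarrow> P B \<Longrightarrow> P (madd A B)"
    and "\<And>c A. P A \<Longrightarrow> P (mscale c A)"
  shows "P (braid_mat n r (kinv t0 t1 r) \<beta>)"
  using assms(1)
proof (induction rule: braid_words_induct)
  case (Cons l \<beta>)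
  then have "P (letter_mat n r (kinv t0 t1 r) l)"
    using assms by (cases l) (auto simp: gen_mat_kinv)
  then show ?case using Cons.IH by (auto intro: mm)
qed (simp add: assms)

text \<open>The operator \<open>act_at\<close> counts tensor factors from one and updates lists,
  while \<open>gm\<close> counts from zero and recurses along them. Induction on the position peels
  off the first letter and replaces \<open>x\<close> by its slice at that letter; hence
  \<open>x\<close> is generalised.\<close>

lemma act_at_gm:
  fixes r :: "('b::finite) kernel"
  assumes "Suc i < length I"
  shows "act_at (kop r) (Suc i) x I = (\<Sum>K\<in>words (length I). gm r i I K * x K)"
  using assms
proof (induction i arbitrary: I x)
  case 0
  then obtain a b I' where I: "I = a # b # I'" by (cases I; cases "tl I") auto
  have "(\<Sum>K\<in>words (length I). gm r 0 I K * x K)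
      = mm (Suc (Suc (length I'))) (gen_mat (Suc (Suc (length I'))) r 0) (\<lambda>K J. x K) I I"
    unfolding mm_def I by (intro sum.cong) (auto simp: gen_mat_def)
  also have "\<dots> = act_at (kop r) (Suc 0) x I"
    unfolding I mm_gen_mat_0[OF refl] by (auto simp: act_at_def kop_def case_prod_unfold)
  finally show ?case by simp
next
  case (Suc i)
  then obtain a I' where I: "I = a # I'" by (cases I) auto
  have "act_at (kop r) (Suc (Suc i)) x I = act_at (kop r) (Suc i) (\<lambda>K. x (a # K)) I'"
    by (simp add: act_at_def I case_prod_unfold)
  also have "\<dots> = (\<Sum>K\<in>words (length I'). gm r i I' K * x (a # K))"
    using Suc I by simp
  also have "\<dots> = (\<Sum>K\<in>words (length I). gm r (Suc i) I K * x K)"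
    unfolding I list.size(4) add_Suc_right add_0_right by (subst sum_words_head[of a]) auto
  finally show ?case .
qed

lemma inv_kop:
  assumes "kmul r r' = kid" "kmul r' r = kid"
  shows "inv (kop r) = kop r'"
  using assms by (intro inv_unique_comp) (auto simp flip: kop_kmul)

lemma braid_rep_mat:
  assumes "kmul r r' = kid" "kmul r' r = kid" "\<beta> \<in> braid_words n" "length I = n" "length J = n"
  shows "braid_rep (kop r) \<beta> (ket J) I = braid_mat n r r' \<beta> I J"
  using assms(3,4)
proof (induction \<beta> arbitrary: I)
  case Nil
  then show ?case using assms(5) by (auto simp: ket_def idm_def)
next
  case (Cons l \<beta>)
  have i: "1 \<le> letter_index l" "letter_index l \<le> n - 1" and \<beta>: "\<beta> \<in> braid_words n"
    using Cons.prems by (auto simp: braid_words_def)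
  have *: "act_at (kop s) (letter_index l) (braid_rep (kop r) \<beta> (ket J)) I
      = mm n (gen_mat n s (letter_index l - 1)) (braid_mat n r r' \<beta>) I J" for s
  proof -
    have "act_at (kop s) (letter_index l) (braid_rep (kop r) \<beta> (ket J)) I
       = (\<Sum>K\<in>words n. gm s (letter_index l - 1) I K * braid_rep (kop r) \<beta> (ket J) K)"
      using act_at_gm[of "letter_index l - 1" I s] i Cons.prems(2) by fastforce
    also have "\<dots> = mm n (gen_mat n s (letter_index l - 1)) (braid_mat n r r' \<beta>) I J"
      using Cons.prems(2) Cons.IH[OF \<beta>] by (auto simp: mm_def gen_mat_def intro!: sum.cong)
    finally show ?thesis .
  qed
  show ?case
    using *[of r] *[of r'] by (cases l) (auto simp: inv_kop[OF assms(1,2)])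
qed

lemma braid_operator_mat:
  assumes "kmul r r' = kid" "kmul r' r = kid" "ker_of R = r" "\<beta> \<in> braid_words n" "n \<noteq> 0"
  shows "braid_operator n R h \<beta> a b = (\<Sum>K\<in>words (n - 1). wprod h K * braid_mat n r r' \<beta> (a # K) (b # K))"
  using assms unfolding braid_operator_def partial_trace_def linear_ext_kop words_def
  by (intro sum.cong) (auto simp: tail_diag_def braid_rep_mat)

section \<open>Skew-primitive operators and partial traces\<close>

text \<open>The iterated coproduct of \<open>E\<close>, where \<open>\<Delta>(E) = E \<otimes> 1 + k \<otimes> E\<close> and \<open>k\<close> is diagonal and grouplike.\<close>

fun prim :: "('b \<Rightarrow> 'b \<Rightarrow> complex) \<Rightarrow> ('b \<Rightarrow> complex) \<Rightarrow> 'b mat" where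
  "prim E k (a # I) (b # J) = E a b * of_bool (I = J) + of_bool (a = b) * k a * prim E k I J"
| "prim E k I J = 0"

definition prim_kernel :: "('b \<Rightarrow> 'b \<Rightarrow> complex) \<Rightarrow> ('b \<Rightarrow> complex) \<Rightarrow> 'b kernel" where
  "prim_kernel E k = (\<lambda>(a, b) (c, d). E a c * of_bool (b = d) + of_bool (a = c) * k a * E b d)"

text \<open>Tested at words of length \<open>n\<close> only, since neither \<open>prim\<close> nor
  \<open>M\<close> is confined to that length.\<close>

definition commutes :: "nat \<Rightarrow> ('b::finite) mat \<Rightarrow> 'b mat \<Rightarrow> bool" where
  "commutes n P M \<longleftrightarrow> (\<forall>I\<in>words n. \<forall>J\<in>words n. mm n M P I J = mm n P M I J)"

definition conserves :: "('b \<Rightarrow> nat \<times> nat) \<Rightarrow> 'b mat \<Rightarrow> bool" where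
  "conserves wt M \<longleftrightarrow> (\<forall>I J. M I J \<noteq> 0 \<longrightarrow> wsum wt I = wsum wt J)"

definition rtr :: "('b::finite \<Rightarrow> complex) \<Rightarrow> 'b mat \<Rightarrow> 'b mat" where
  "rtr h M = (\<lambda>I J. \<Sum>b\<in>UNIV. h b * M (I @ [b]) (J @ [b]))"

definition ltr :: "('b::finite \<Rightarrow> complex) \<Rightarrow> 'b mat \<Rightarrow> 'b mat" where
  "ltr g M = (\<lambda>I J. \<Sum>a\<in>UNIV. g a * M (a # I) (a # J))"

lemma commutesD: "commutes n P M \<Longrightarrow> length I = n \<Longrightarrow> length J = n \<Longrightarrow> mm n M P I J = mm n P M I J"
  by (simp add: commutes_def)

lemma commutes_idm: "commutes n P (idm n)"
  by (simp add: commutes_def mm_idm_row mm_idm_col)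

lemma mm_cong_right: "(\<And>K. length K = n \<Longrightarrow> B K J = B' K J) \<Longrightarrow> mm n A B I J = mm n A B' I J"
  unfolding mm_def by (intro sum.cong) auto

lemma mm_cong_left: "(\<And>K. length K = n \<Longrightarrow> A I K = A' I K) \<Longrightarrow> mm n A B I J = mm n A' B I J"
  unfolding mm_def by (intro sum.cong) auto

lemma commutes_mm:
  assumes "commutes n P A" "commutes n P B"
  shows "commutes n P (mm n A B)"
  unfolding commutes_def
proof (intro ballI)
  fix I J :: "'a list" assume IJ: "I \<in> words n" "J \<in> words n"
  have "mm n (mm n A B) P I J = mm n A (mm n B P) I J" by (simp add: mm_assoc)
  also have "\<dots> = mm n A (mm n P B) I J"
    using assms(2) IJ by (intro mm_cong_right) (auto simp: commutes_def)
  also have "\<dots> = mm n (mm n A P) B I J" by (simp add: mm_assoc)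
  also have "\<dots> = mm n (mm n P A) B I J"
    using assms(1) IJ by (intro mm_cong_left) (auto simp: commutes_def)
  finally show "mm n (mm n A B) P I J = mm n P (mm n A B) I J" by (simp add: mm_assoc)
qed

lemma commutes_madd: "commutes n P A \<Longrightarrow> commutes n P B \<Longrightarrow> commutes n P (madd A B)"
  unfolding commutes_def mm_madd_left mm_madd_right by (simp add: madd_def)

lemma commutes_mscale: "commutes n P A \<Longrightarrow> commutes n P (mscale c A)"
  unfolding commutes_def mm_mscale_left mm_mscale_right by (simp add: mscale_def)

lemma conserves_idm: "conserves wt (idm n)"
  by (auto simp: conserves_def idm_def)

lemma conserves_mm: "conserves wt A \<Longrightarrow> conserves wt B \<Longrightarrow> conserves wt (mm n A B)"
  unfolding conserves_def mm_def by (fastforce elim!: sum.not_neutral_contains_not_neutral)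

lemma conserves_madd: "conserves wt A \<Longrightarrow> conserves wt B \<Longrightarrow> conserves wt (madd A B)"
  unfolding conserves_def madd_def by (metis add.right_neutral)

lemma conserves_mscale: "conserves wt A \<Longrightarrow> conserves wt (mscale c A)"
  by (auto simp: conserves_def mscale_def)

lemma gm_multiplicative:
  assumes "\<And>a b c d. r (a, b) (c, d) \<noteq> 0 \<Longrightarrow> w a * w b = w c * w (d :: 'b)"
    and "gm r i I J \<noteq> 0"
  shows "prod_list (map w I) = (prod_list (map w J) :: 'c::comm_monoid_mult)"
  using assms(2,1)
proof (induction r i I J rule: gm.induct)
  case (1 r a b I c d J)
  then show ?case by (auto simp flip: mult.assoc split: if_splits)
qed (auto split: if_splits)

lemma gm_additive:
  assumes "\<And>a b c d. r (a, b) (c, d) \<noteq> 0 \<Longrightarrow> w a + w b = w c + w (d :: 'b)"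
    and "gm r i I J \<noteq> 0"
  shows "sum_list (map w I) = (sum_list (map w J) :: 'c::comm_monoid_add)"
  using assms(2,1)
proof (induction r i I J rule: gm.induct)
  case (1 r a b I c d J)
  then show ?case by (auto simp flip: add.assoc split: if_splits)
qed (auto split: if_splits)

lemma conserves_gen:
  assumes "\<And>a b c d. r (a, b) (c, d) \<noteq> 0 \<Longrightarrow> wt a + wt b = wt c + wt d"
  shows "conserves wt (gen_mat n r i)"
  using gm_additive[of r wt, OF assms] by (auto simp: conserves_def gen_mat_def)

lemma mm_sh_prim:
  fixes A :: "('b::finite) mat"
  assumes "length J = n" "mat_supp n n A"
  shows "mm (Suc n) (sh A) (prim E k) (a # I) (b # J)
       = E a b * A I J + of_bool (a = b) * k a * mm n A (prim E k) I J" (is ?L)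
    and "length I = n \<Longrightarrow> mm (Suc n) (prim E k) (sh A) (a # I) (b # J)
       = E a b * A I J + of_bool (a = b) * k a * mm n (prim E k) A I J"
proof -
  have "mm (Suc n) (sh A) (prim E k) (a # I) (b # J) = (\<Sum>K\<in>words n. A I K * prim E k (a # K) (b # J))"
    unfolding mm_def by (subst sum_words_head[of a]) auto
  also have "\<dots> = (\<Sum>K\<in>words n. (if K = J then E a b * A I J else 0)
        + of_bool (a = b) * k a * (A I K * prim E k K J))"
    by (intro sum.cong) (auto simp: algebra_simps)
  finally show ?L using assms by (simp add: sum.distrib mm_def flip: sum_distrib_left)
next
  assume I: "length I = n"
  have "mm (Suc n) (prim E k) (sh A) (a # I) (b # J) = (\<Sum>K\<in>words n. prim E k (a # I) (b # K) * A K J)"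
    unfolding mm_def by (subst sum_words_head[of b]) auto
  also have "\<dots> = (\<Sum>K\<in>words n. (if K = I then E a b * A I J else 0)
        + of_bool (a = b) * k a * (prim E k I K * A K J))"
    by (intro sum.cong) (auto simp: algebra_simps)
  finally show "mm (Suc n) (prim E k) (sh A) (a # I) (b # J)
       = E a b * A I J + of_bool (a = b) * k a * mm n (prim E k) A I J"
    using I by (simp add: sum.distrib mm_def flip: sum_distrib_left)
qed

text \<open>At the first two strands, coassociativity splits \<open>prim\<close> into the two-strand
  coproduct tensored with the identity and \<open>k \<otimes> k\<close> tensored with
  \<open>prim\<close> on the remaining strands. The kernel commutes with the first by
  \<open>comm\<close> and with the second by \<open>kk\<close>.\<close>

lemma commutes_gen:
  fixes r :: "('b::finite) kernel"
  assumes comm: "kmul r (prim_kernel E k) = kmul (prim_kernel E k) r"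
    and kk: "\<And>a b c d. r (a, b) (c, d) \<noteq> 0 \<Longrightarrow> k a * k b = k c * k d"
    and "Suc i < n"
  shows "commutes n (prim E k) (gen_mat n r i)"
  using assms(3)
proof (induction i arbitrary: n)
  case 0
  then obtain m where n: "n = Suc (Suc m)" using length_Suc2 by blast
  show ?case
    unfolding commutes_def
  proof (intro ballI)
    fix I J :: "'b list" assume "I \<in> words n" "J \<in> words n"
    then obtain a b I' c d J' where IJ: "I = a # b # I'" "J = c # d # J'" "length I' = m" "length J' = m"
      using n by (metis length_Suc_conv in_words)
    have prim2: "prim E k (x # y # K) (z # w # L)
        = of_bool (K = L) * prim_kernel E k (x, y) (z, w) + of_bool (x = z \<and> y = w) * (k x * k y * prim E k K L)"
      for x y z w K L by (auto simp: prim_kernel_def algebra_simps)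
    have "mm n (gen_mat n r 0) (prim E k) I J = (\<Sum>q\<in>UNIV. of_bool (I' = J') * (r (a, b) q * prim_kernel E k q (c, d))
         + (if q = (c, d) then r (a, b) (c, d) * (k c * k d * prim E k I' J') else 0))"
      unfolding IJ n mm_gen_mat_0[OF IJ(3)] prim2
      by (intro sum.cong) (auto simp: algebra_simps)
    also have "\<dots> = of_bool (I' = J') * kmul r (prim_kernel E k) (a, b) (c, d)
         + r (a, b) (c, d) * (k c * k d * prim E k I' J')"
      by (simp add: sum.distrib kmul_def flip: sum_distrib_left)
    also have "r (a, b) (c, d) * (k c * k d * prim E k I' J') = r (a, b) (c, d) * (k a * k b * prim E k I' J')"
      using kk[of a b c d] by auto
    also have "of_bool (I' = J') * kmul r (prim_kernel E k) (a, b) (c, d)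
         + r (a, b) (c, d) * (k a * k b * prim E k I' J')
       = of_bool (I' = J') * kmul (prim_kernel E k) r (a, b) (c, d)
         + r (a, b) (c, d) * (k a * k b * prim E k I' J')"
      by (simp only: comm)
    also have "\<dots> = (\<Sum>q\<in>UNIV. of_bool (I' = J') * (prim_kernel E k (a, b) q * r q (c, d))
         + (if q = (a, b) then r (a, b) (c, d) * (k a * k b * prim E k I' J') else 0))"
      by (simp add: sum.distrib kmul_def flip: sum_distrib_left)
    also have "\<dots> = mm n (prim E k) (gen_mat n r 0) I J"
      unfolding IJ n mm_gen_mat_0_right[OF IJ(4)] prim2
      by (intro sum.cong) (auto simp: algebra_simps)
    finally show "mm n (gen_mat n r 0) (prim E k) I J = mm n (prim E k) (gen_mat n r 0) I J" .
  qed
next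
  case (Suc i)
  then obtain m where n: "n = Suc m" by (cases n) auto
  show ?case
    unfolding commutes_def
  proof (intro ballI)
    fix I J :: "'b list" assume "I \<in> words n" "J \<in> words n"
    then obtain a I' c J' where IJ: "I = a # I'" "J = c # J'" "length I' = m" "length J' = m"
      using n by (metis length_Suc_conv in_words)
    show "mm n (gen_mat n r (Suc i)) (prim E k) I J = mm n (prim E k) (gen_mat n r (Suc i)) I J"
      using Suc.IH[of m] Suc.prems
      by (simp add: n gen_mat_Suc IJ mm_sh_prim commutes_def)
  qed
qed

section \<open>Partial traces of operators that commute with a skew-primitive one\<close>

lemma prim_snoc:
  "length I = length J \<Longrightarrow> prim E k (I @ [a]) (J @ [b])
     = prim E k I J * of_bool (a = b) + of_bool (I = J) * wprod k I * E a b"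
  by (induction I J rule: list_induct2) (auto simp: algebra_simps)

text \<open>Splitting off the last strand, the coproduct is \<open>prim\<close> on the others plus
  \<open>k\<close> on the others times \<open>E\<close> on the last. Terms of the second kind cancel
  when the last strand is closed: \<open>M\<close> conserves weight and hence products of
  \<open>k\<close>, while \<open>kh\<close> says that the diagonal map \<open>k h\<close> commutes
  with \<open>E\<close>.\<close>

lemma commutes_rtr:
  fixes M :: "('b::finite) mat"
  assumes comm: "commutes (Suc n) (prim E k) M" and cons: "conserves wt M"
    and kh: "\<And>b c. E b c \<noteq> 0 \<Longrightarrow> k b * h b = k c * h c"
    and k0: "\<And>b. k b \<noteq> 0"
    and kl: "\<And>I J. length I = length J \<Longrightarrow> wsum wt I = wsum wt J
        \<Longrightarrow> wprod k I = wprod k J"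
  shows "commutes n (prim E k) (rtr h M)"
  unfolding commutes_def
proof (intro ballI)
  fix I J :: "'b list" assume IJ: "I \<in> words n" "J \<in> words n"
  let ?P = "prim E k" and ?k = "\<lambda>I. wprod k I"
  have L: "mm (Suc n) M ?P (I @ [b]) (J @ [b])
      = (\<Sum>K\<in>words n. M (I @ [b]) (K @ [b]) * ?P K J) + (\<Sum>c\<in>UNIV. M (I @ [b]) (J @ [c]) * (?k J * E c b))" for b
  proof -
    have "mm (Suc n) M ?P (I @ [b]) (J @ [b])
      = (\<Sum>K\<in>words n. \<Sum>c\<in>UNIV. (if c = b then M (I @ [b]) (K @ [b]) * ?P K J else 0)
          + (if K = J then M (I @ [b]) (J @ [c]) * (?k J * E c b) else 0))"
      unfolding mm_def sum_words_snoc using IJ by (intro sum.cong) (auto simp: prim_snoc algebra_simps)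
    also have "\<dots> = (\<Sum>K\<in>words n. M (I @ [b]) (K @ [b]) * ?P K J
         + (if K = J then \<Sum>c\<in>UNIV. M (I @ [b]) (J @ [c]) * (?k J * E c b) else 0))"
      by (intro sum.cong) (auto simp: sum.distrib)
    finally show ?thesis using IJ by (simp add: sum.distrib)
  qed
  have R: "mm (Suc n) ?P M (I @ [b]) (J @ [b])
      = (\<Sum>K\<in>words n. ?P I K * M (K @ [b]) (J @ [b])) + (\<Sum>c\<in>UNIV. ?k I * E b c * M (I @ [c]) (J @ [b]))" for b
  proof -
    have "mm (Suc n) ?P M (I @ [b]) (J @ [b])
      = (\<Sum>K\<in>words n. \<Sum>c\<in>UNIV. (if c = b then ?P I K * M (K @ [b]) (J @ [b]) else 0)
          + (if K = I then ?k I * E b c * M (I @ [c]) (J @ [b]) else 0))"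
      unfolding mm_def sum_words_snoc using IJ by (intro sum.cong) (auto simp: prim_snoc algebra_simps)
    also have "\<dots> = (\<Sum>K\<in>words n. ?P I K * M (K @ [b]) (J @ [b])
         + (if K = I then \<Sum>c\<in>UNIV. ?k I * E b c * M (I @ [c]) (J @ [b]) else 0))"
      by (intro sum.cong) (auto simp: sum.distrib)
    finally show ?thesis using IJ by (simp add: sum.distrib)
  qed
  \<comment> \<open>Weight conservation gives \<open>?k I * k c = ?k J * k b\<close>. Combined with
    \<open>k b * h b = k c * h c\<close>, after cancelling \<open>k b\<close>, this is
    \<open>h b * ?k I = h c * ?k J\<close>.\<close>
  have cross: "h c * (M (I @ [c]) (J @ [b]) * (?k J * E b c)) = h b * (?k I * E b c * M (I @ [c]) (J @ [b]))" for b c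
  proof (cases "M (I @ [c]) (J @ [b]) = 0 \<or> E b c = 0")
    case False
    then have "wsum wt (I @ [c]) = wsum wt (J @ [b])"
      using cons unfolding conserves_def by blast
    then have "?k (I @ [c]) = ?k (J @ [b])" using IJ by (intro kl) auto
    then have 1: "?k I * k c = ?k J * k b" by simp
    have 2: "k b * h b = k c * h c" using kh False by simp
    have "k b * (h b * ?k I) = k b * h b * ?k I" by simp
    also have "\<dots> = h c * (?k I * k c)" unfolding 2 by simp
    also have "\<dots> = k b * (h c * ?k J)" unfolding 1 by simp
    finally have "k b * (h b * ?k I) = k b * (h c * ?k J)" .
    then have "h b * ?k I = h c * ?k J" using k0 by simp
    then show ?thesis by (simp add: algebra_simps)
  qed auto
  have "mm n (rtr h M) ?P I J = (\<Sum>b\<in>UNIV. h b * (\<Sum>K\<in>words n. M (I @ [b]) (K @ [b]) * ?P K J))"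
    unfolding mm_def rtr_def by (simp add: sum_distrib_left sum_distrib_right mult.assoc) (rule sum.swap)
  also have "\<dots> = (\<Sum>b\<in>UNIV. h b * mm (Suc n) M ?P (I @ [b]) (J @ [b]))
      - (\<Sum>b\<in>UNIV. \<Sum>c\<in>UNIV. h b * (M (I @ [b]) (J @ [c]) * (?k J * E c b)))"
    unfolding L by (simp add: distrib_left sum.distrib flip: sum_distrib_left)
  also have "(\<Sum>b\<in>UNIV. h b * mm (Suc n) M ?P (I @ [b]) (J @ [b]))
      = (\<Sum>b\<in>UNIV. h b * mm (Suc n) ?P M (I @ [b]) (J @ [b]))"
    using comm IJ by (intro sum.cong) (auto simp: commutes_def)
  also have "(\<Sum>b\<in>UNIV. \<Sum>c\<in>UNIV. h b * (M (I @ [b]) (J @ [c]) * (?k J * E c b)))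
      = (\<Sum>b\<in>UNIV. \<Sum>c\<in>UNIV. h c * (M (I @ [c]) (J @ [b]) * (?k J * E b c)))"
    by (rule sum.swap)
  also have "\<dots> = (\<Sum>b\<in>UNIV. \<Sum>c\<in>UNIV. h b * (?k I * E b c * M (I @ [c]) (J @ [b])))"
    unfolding cross ..
  also have "(\<Sum>b\<in>UNIV. h b * mm (Suc n) ?P M (I @ [b]) (J @ [b])) - \<dots>
      = (\<Sum>b\<in>UNIV. h b * (\<Sum>K\<in>words n. ?P I K * M (K @ [b]) (J @ [b])))"
    unfolding R by (simp add: distrib_left sum.distrib flip: sum_distrib_left)
  also have "\<dots> = mm n ?P (rtr h M) I J"
    unfolding mm_def rtr_def by (simp add: sum_distrib_left mult.left_commute) (rule sum.swap)
  finally show "mm n (rtr h M) ?P I J = mm n ?P (rtr h M) I J" .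
qed

text \<open>On the left the traced strand carries a factor \<open>k\<close> in the terms that should
  survive, so the coproduct is traced with the weight \<open>g / k\<close>. Terms with
  \<open>E\<close> on the traced strand cancel because \<open>g / k\<close> is constant along the
  nonzero entries of \<open>E\<close>.\<close>

lemma commutes_ltr:
  fixes M :: "('b::finite) mat"
  assumes comm: "commutes (Suc n) (prim E k) M"
    and gk: "\<And>b c. E b c \<noteq> 0 \<Longrightarrow> g b / k b = g c / k c"
    and k0: "\<And>b. k b \<noteq> 0"
  shows "commutes n (prim E k) (ltr g M)"
  unfolding commutes_def
proof (intro ballI)
  fix I J :: "'b list" assume IJ: "I \<in> words n" "J \<in> words n"
  let ?P = "prim E k"
  have L: "mm (Suc n) M ?P (a # I) (a # J)
      = k a * (\<Sum>K\<in>words n. M (a # I) (a # K) * ?P K J) + (\<Sum>c\<in>UNIV. M (a # I) (c # J) * E c a)" for a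
  proof -
    have "mm (Suc n) M ?P (a # I) (a # J)
      = (\<Sum>c\<in>UNIV. \<Sum>K\<in>words n. (if c = a then k a * (M (a # I) (a # K) * ?P K J) else 0)
          + (if K = J then M (a # I) (c # J) * E c a else 0))"
      unfolding mm_def sum_words_Suc using IJ by (intro sum.cong) (auto simp: algebra_simps)
    also have "\<dots> = (\<Sum>c\<in>UNIV. (if c = a then k a * (\<Sum>K\<in>words n. M (a # I) (a # K) * ?P K J) else 0)
         + M (a # I) (c # J) * E c a)"
      using IJ by (intro sum.cong) (auto simp: sum.distrib sum_distrib_left)
    finally show ?thesis by (simp add: sum.distrib)
  qed
  have R: "mm (Suc n) ?P M (a # I) (a # J)
      = k a * (\<Sum>K\<in>words n. ?P I K * M (a # K) (a # J)) + (\<Sum>c\<in>UNIV. E a c * M (c # I) (a # J))" for a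
  proof -
    have "mm (Suc n) ?P M (a # I) (a # J)
      = (\<Sum>c\<in>UNIV. \<Sum>K\<in>words n. (if c = a then k a * (?P I K * M (a # K) (a # J)) else 0)
          + (if K = I then E a c * M (c # I) (a # J) else 0))"
      unfolding mm_def sum_words_Suc using IJ by (intro sum.cong) (auto simp: algebra_simps)
    also have "\<dots> = (\<Sum>c\<in>UNIV. (if c = a then k a * (\<Sum>K\<in>words n. ?P I K * M (a # K) (a # J)) else 0)
         + E a c * M (c # I) (a # J))"
      using IJ by (intro sum.cong) (auto simp: sum.distrib sum_distrib_left)
    finally show ?thesis by (simp add: sum.distrib)
  qed
  have gkk: "g a / k a * (k a * z) = g a * z" for a z using k0 by simp
  have cross: "g c / k c * (M (c # I) (b # J) * E b c) = g b / k b * (E b c * M (c # I) (b # J))" for b c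
    using gk[of b c] by (cases "E b c = 0") auto
  have "mm n (ltr g M) ?P I J = (\<Sum>a\<in>UNIV. g a * (\<Sum>K\<in>words n. M (a # I) (a # K) * ?P K J))"
    unfolding mm_def ltr_def by (simp add: sum_distrib_left sum_distrib_right mult.assoc) (rule sum.swap)
  also have "\<dots> = (\<Sum>a\<in>UNIV. g a / k a * mm (Suc n) M ?P (a # I) (a # J))
      - (\<Sum>b\<in>UNIV. \<Sum>c\<in>UNIV. g b / k b * (M (b # I) (c # J) * E c b))"
    unfolding L distrib_left gkk sum.distrib by (simp add: sum_distrib_left)
  also have "(\<Sum>a\<in>UNIV. g a / k a * mm (Suc n) M ?P (a # I) (a # J))
      = (\<Sum>a\<in>UNIV. g a / k a * mm (Suc n) ?P M (a # I) (a # J))"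
    using comm IJ by (intro sum.cong) (auto simp: commutes_def)
  also have "(\<Sum>b\<in>UNIV. \<Sum>c\<in>UNIV. g b / k b * (M (b # I) (c # J) * E c b))
      = (\<Sum>b\<in>UNIV. \<Sum>c\<in>UNIV. g c / k c * (M (c # I) (b # J) * E b c))"
    by (rule sum.swap)
  also have "\<dots> = (\<Sum>b\<in>UNIV. \<Sum>c\<in>UNIV. g b / k b * (E b c * M (c # I) (b # J)))"
    unfolding cross ..
  also have "(\<Sum>a\<in>UNIV. g a / k a * mm (Suc n) ?P M (a # I) (a # J)) - \<dots>
      = (\<Sum>a\<in>UNIV. g a * (\<Sum>K\<in>words n. ?P I K * M (a # K) (a # J)))"
    unfolding R distrib_left gkk sum.distrib by (simp add: sum_distrib_left)
  also have "\<dots> = mm n ?P (ltr g M) I J"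
    unfolding mm_def ltr_def by (simp add: sum_distrib_left mult.left_commute) (rule sum.swap)
  finally show "mm n (ltr g M) ?P I J = mm n ?P (ltr g M) I J" .
qed

lemma conserves_rtr: "conserves wt M \<Longrightarrow> conserves wt (rtr h M)"
  unfolding conserves_def rtr_def by (fastforce elim!: sum.not_neutral_contains_not_neutral)

lemma conserves_ltr: "conserves wt M \<Longrightarrow> conserves wt (ltr h M)"
  unfolding conserves_def ltr_def by (fastforce elim!: sum.not_neutral_contains_not_neutral)

lemma rtr_pow: "(rtr h ^^ m) M I J = (\<Sum>K\<in>words m. wprod h K * M (I @ K) (J @ K))"
proof (induction m arbitrary: I J)
  case (Suc m)
  then show ?case by (simp add: rtr_def sum_words_Suc sum_distrib_left mult.assoc)
qed simp

lemma ltr_pow: "(ltr g ^^ m) M I J = (\<Sum>K\<in>words m. wprod g K * M (K @ I) (K @ J))"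
proof (induction m arbitrary: I J)
  case (Suc m)
  have "(ltr g ^^ Suc m) M I J = (\<Sum>a\<in>UNIV. \<Sum>K\<in>words m. wprod g K * g a * M (K @ a # I) (K @ a # J))"
    by (simp add: ltr_def Suc sum_distrib_left mult.assoc mult.left_commute)
  also have "\<dots> = (\<Sum>K\<in>words (Suc m). wprod g K * M (K @ I) (K @ J))"
    unfolding sum_words_snoc by (subst sum.swap) simp
  finally show ?case .
qed simp

lemma ltr_rtr: "ltr g (rtr h M) = rtr h (ltr g M)"
  unfolding ltr_def rtr_def
  by (intro ext, simp add: sum_distrib_left mult.left_commute, rule sum.swap)

lemma ltr_rtr_pow: "ltr g ((rtr h ^^ m) M) = (rtr h ^^ m) (ltr g M)"
  by (induction m) (auto simp: ltr_rtr)

text \<open>A class of operators with an ambidextrous open strand: the scalar obtained by closing all strands but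
  one does not depend on the strand left open, and hence is a trace on all generators.\<close>

locale ambidextrous =
  fixes C :: "nat \<Rightarrow> ('b::finite) mat set" and h g :: "'b \<Rightarrow> complex" and v :: 'b
  assumes C_rtr: "M \<in> C (Suc (Suc n)) \<Longrightarrow> rtr h M \<in> C (Suc n)"
    and C_ltr: "M \<in> C (Suc (Suc n)) \<Longrightarrow> ltr g M \<in> C (Suc n)"
    and C_mm: "A \<in> C n \<Longrightarrow> B \<in> C n \<Longrightarrow> mm n A B \<in> C n"
    and C_2: "M \<in> C (Suc (Suc 0)) \<Longrightarrow> rtr h M [v] [v] = ltr g M [v] [v]"
begin

definition open_trace :: "nat \<Rightarrow> 'b mat \<Rightarrow> complex" where
  "open_trace m M = (rtr h ^^ m) M [v] [v]"

lemma C_rtr_pow: "M \<in> C (Suc m + l) \<Longrightarrow> (rtr h ^^ l) M \<in> C (Suc m)"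
proof (induction l arbitrary: m)
  case (Suc l)
  then have "(rtr h ^^ l) M \<in> C (Suc (Suc m))" by simp
  then show ?case by (simp add: C_rtr)
qed simp

text \<open>Strands move from the right closure to the left one at a time: with all but the first
  two closed on the right, \<open>C_2\<close> closes the first on the left instead of the second on
  the right, and left closures commute with right closures.\<close>

lemma open_trace_left: "M \<in> C (Suc m) \<Longrightarrow> open_trace m M = (ltr g ^^ m) M [v] [v]"
proof (induction m arbitrary: M)
  case (Suc m)
  have "open_trace (Suc m) M = rtr h ((rtr h ^^ m) M) [v] [v]"
    by (simp add: open_trace_def)
  also have "\<dots> = ltr g ((rtr h ^^ m) M) [v] [v]"
    using C_rtr_pow[of M "Suc 0" m] Suc.prems by (intro C_2) simp
  also have "\<dots> = open_trace m (ltr g M)"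
    by (simp add: ltr_rtr_pow open_trace_def)
  also have "\<dots> = (ltr g ^^ m) (ltr g M) [v] [v]"
    using C_ltr[of M m] Suc.prems by (intro Suc.IH) simp
  finally show ?case by (simp add: funpow_swap1)
qed (simp add: open_trace_def)

lemma trace_swap:
  fixes A M :: "'b mat"
  assumes "\<And>K L. A K L \<noteq> 0 \<Longrightarrow> w K = (w L :: complex)"
  shows "(\<Sum>K\<in>words m. w K * (\<Sum>L\<in>words m. A K L * M L K))
       = (\<Sum>K\<in>words m. w K * (\<Sum>L\<in>words m. M K L * A L K))"
proof -
  have "(\<Sum>K\<in>words m. w K * (\<Sum>L\<in>words m. A K L * M L K))
      = (\<Sum>K\<in>words m. \<Sum>L\<in>words m. w L * (M L K * A K L))"
    unfolding sum_distrib_left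
  proof (intro sum.cong refl)
    fix K L
    show "w K * (A K L * M L K) = w L * (M L K * A K L)"
      using assms[of K L] by (cases "A K L = 0") auto
  qed
  also have "\<dots> = (\<Sum>K\<in>words m. w K * (\<Sum>L\<in>words m. M K L * A L K))"
    unfolding sum_distrib_left by (rule sum.swap)
  finally show ?thesis .
qed

lemma gm_snoc:
  "length K = length L \<Longrightarrow> Suc i < length K \<Longrightarrow> gm r i (K @ [a]) (L @ [b]) = (if a = b then gm r i K L else 0)"
  by (induction r i K L rule: gm.induct) auto

text \<open>A generator away from the open strand can be moved cyclically around the closure. With
  the first strand open this covers every position but zero; for position zero the last strand is
  left open, which the generator avoids because \<open>2 \<le> m\<close>.\<close>

lemma open_trace_gen:
  assumes M: "M \<in> C (Suc m)" and G: "gen_mat (Suc m) r i \<in> C (Suc m)" and i: "i < m" and m: "2 \<le> m"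
    and hh: "\<And>a b c d. r (a, b) (c, d) \<noteq> 0 \<Longrightarrow> h a * h b = h c * h d"
    and gg: "\<And>a b c d. r (a, b) (c, d) \<noteq> 0 \<Longrightarrow> g a * g b = g c * g d"
  shows "open_trace m (mm (Suc m) (gen_mat (Suc m) r i) M) = open_trace m (mm (Suc m) M (gen_mat (Suc m) r i))"
proof (cases i)
  case (Suc j)
  let ?G = "gen_mat m r j"
  have 1: "mm (Suc m) (sh ?G) M (v # K) (v # K) = (\<Sum>L\<in>words m. ?G K L * M (v # L) (v # K))"
    and 2: "mm (Suc m) M (sh ?G) (v # K) (v # K) = (\<Sum>L\<in>words m. M (v # K) (v # L) * ?G L K)" for K
    unfolding mm_def by (subst sum_words_head[of v]; auto)+
  have "wprod h K = wprod h L" if "?G K L \<noteq> 0" for K L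
    using that gm_multiplicative[of r h, OF hh] by (auto simp: gen_mat_def split: if_splits)
  then show ?thesis
    unfolding open_trace_def rtr_pow Suc gen_mat_Suc append_Cons append_Nil 1 2
    by (rule trace_swap)
next
  case 0
  let ?G = "gen_mat m r 0"
  have G0: "gen_mat (Suc m) r 0 (K @ [a]) (L @ [b]) = (if a = b then ?G K L else 0)"
    if "length K = m" "length L = m" for K L a b
    using that m by (simp add: gen_mat_def gm_snoc)
  have 1: "mm (Suc m) (gen_mat (Suc m) r 0) M (K @ [v]) (K @ [v]) = (\<Sum>L\<in>words m. ?G K L * M (L @ [v]) (K @ [v]))"
    and 2: "mm (Suc m) M (gen_mat (Suc m) r 0) (K @ [v]) (K @ [v]) = (\<Sum>L\<in>words m. M (K @ [v]) (L @ [v]) * ?G L K)"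
    if "length K = m" for K
    unfolding mm_def using that by (subst sum_words_last[of v]; auto simp: G0)+
  have w: "wprod g K = wprod g L" if "?G K L \<noteq> 0" for K L
    using that gm_multiplicative[of r g, OF gg] by (auto simp: gen_mat_def split: if_splits)
  have "(ltr g ^^ m) (mm (Suc m) (gen_mat (Suc m) r 0) M) [v] [v]
      = (ltr g ^^ m) (mm (Suc m) M (gen_mat (Suc m) r 0)) [v] [v]"
    unfolding ltr_pow using trace_swap[of ?G "\<lambda>K. wprod g K" "\<lambda>K L. M (K @ [v]) (L @ [v])" m, OF w]
    by (simp add: 1 2)
  then show ?thesis
    using 0 M G by (simp add: open_trace_left C_mm)
qed

end

section \<open>The two \<open>R\<close>-matrices\<close>

lemma kernel_eqI:
  assumes "\<And>x p. kop r x p = kop r' x p" shows "r = r'"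
proof (intro ext)
  fix p q
  have "r p q = kop r (\<lambda>z. kid z q) p" "r' p q = kop r' (\<lambda>z. kid z q) p"
    by (simp_all flip: kmul_column)
  then show "r p q = r' p q" using assms by simp
qed

text \<open>Identities of kernels are checked on a generic array, so that the tables for
  \<open>kop\<close> reduce each entry to a linear identity in the unknowns
  \<open>x (a, b)\<close>.\<close>

lemma kmul_eqI: "(\<And>x p. kop r (kop s x) p = kop s' (kop r' x) p) \<Longrightarrow> kmul r s = kmul s' r'"
  by (rule kernel_eqI) (simp add: kop_kmul)

lemma kop_prim_kernel:
  "kop (prim_kernel E k) x (a, b) = (\<Sum>c\<in>UNIV. E a c * x (c, b)) + k a * (\<Sum>d\<in>UNIV. E b d * x (a, d))"
proof -
  have "kop (prim_kernel E k) x (a, b) = (\<Sum>c\<in>UNIV. \<Sum>d\<in>UNIV. (if d = b then E a c * x (c, b) else 0)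
      + (if c = a then k a * (E b d * x (a, d)) else 0))"
    unfolding kop_def prim_kernel_def sum_pair_UNIV by (intro sum.cong) (auto simp: algebra_simps)
  also have "\<dots> = (\<Sum>c\<in>UNIV. E a c * x (c, b)
      + (if c = a then k a * (\<Sum>d\<in>UNIV. E b d * x (a, d)) else 0))"
    by (intro sum.cong) (auto simp: sum.distrib sum_distrib_left)
  finally show ?thesis by (simp add: sum.distrib)
qed

section \<open>The Links-Gould matrix and its raising operators\<close>

lemma UNIV_lg: "(UNIV :: lg_basis set) = {e0, e1, e2, e3}"
  using lg_basis.exhaust by blast

lemma UNIV_ado: "(UNIV :: ado_basis set) = {v0, v1, v2}"
  using ado_basis.exhaust by blast

text \<open>Rescaling \<open>e\<^sub>3\<close> turns the two occurrences of \<open>Y\<close> into arbitrary \<open>A\<close> and \<open>B\<close> with \<open>A B = Y\<^sup>2\<close>.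
  Unlike \<open>Y\<close>, these can be chosen as polynomials in \<open>t\<^sub>0\<close> and \<open>t\<^sub>1\<close>.\<close>

fun lg_column :: "complex \<Rightarrow> complex \<Rightarrow> complex \<Rightarrow> complex \<Rightarrow> lg_basis \<times> lg_basis \<Rightarrow> lg_basis \<times> lg_basis \<Rightarrow> complex" where
  "lg_column r0 r1 A B (e0, e0) p = r0^2 * ket (e0, e0) p"
| "lg_column r0 r1 A B (e0, e1) p = r0 * ket (e1, e0) p"
| "lg_column r0 r1 A B (e0, e2) p = r0 * ket (e2, e0) p"
| "lg_column r0 r1 A B (e0, e3) p = ket (e3, e0) p"
| "lg_column r0 r1 A B (e1, e0) p = r0 * ket (e0, e1) p + (r0^2 - 1) * ket (e1, e0) p"
| "lg_column r0 r1 A B (e1, e1) p = - ket (e1, e1) p"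
| "lg_column r0 r1 A B (e1, e2) p = (r0^2 * r1^2 - 1) * ket (e1, e2) p
     - r0 * r1 * ket (e2, e1) p - r0 * r1 * A * ket (e3, e0) p"
| "lg_column r0 r1 A B (e1, e3) p = r1 * ket (e3, e1) p"
| "lg_column r0 r1 A B (e2, e0) p = r0 * ket (e0, e2) p + (r0^2 - 1) * ket (e2, e0) p"
| "lg_column r0 r1 A B (e2, e1) p = - (r0 * r1) * ket (e1, e2) p + A * ket (e3, e0) p"
| "lg_column r0 r1 A B (e2, e2) p = - ket (e2, e2) p"
| "lg_column r0 r1 A B (e2, e3) p = r1 * ket (e3, e2) p"
| "lg_column r0 r1 A B (e3, e0) p = ket (e0, e3) p - r0 * r1 * B * ket (e1, e2) p
     + B * ket (e2, e1) p + A * B * ket (e3, e0) p"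
| "lg_column r0 r1 A B (e3, e1) p = r1 * ket (e1, e3) p + (r1^2 - 1) * ket (e3, e1) p"
| "lg_column r0 r1 A B (e3, e2) p = r1 * ket (e2, e3) p + (r1^2 - 1) * ket (e3, e2) p"
| "lg_column r0 r1 A B (e3, e3) p = r1^2 * ket (e3, e3) p"

definition lg_ker :: "complex \<Rightarrow> complex \<Rightarrow> complex \<Rightarrow> complex \<Rightarrow> lg_basis kernel" where
  "lg_ker r0 r1 A B p q = lg_column r0 r1 A B q p"

lemma ker_of_lg: "ker_of (lg_R r0 r1 Y) = lg_ker r0 r1 Y Y"
proof (intro ext)
  fix p q :: "lg_basis \<times> lg_basis"
  obtain a b where q: "q = (a, b)" by fastforce
  show "ker_of (lg_R r0 r1 Y) p q = lg_ker r0 r1 Y Y p q"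
    unfolding q ker_of_def lg_ker_def
    by (cases a; cases b) (auto simp: lookup_add lookup_single when_def ket_def power2_eq_square)
qed

lemma kop_lg:
  "kop (lg_ker r0 r1 A B) x (e0, e0) = r0^2 * x (e0, e0)"
  "kop (lg_ker r0 r1 A B) x (e0, e1) = r0 * x (e1, e0)"
  "kop (lg_ker r0 r1 A B) x (e0, e2) = r0 * x (e2, e0)"
  "kop (lg_ker r0 r1 A B) x (e0, e3) = x (e3, e0)"
  "kop (lg_ker r0 r1 A B) x (e1, e0) = r0 * x (e0, e1) + (r0^2 - 1) * x (e1, e0)"
  "kop (lg_ker r0 r1 A B) x (e1, e1) = - x (e1, e1)"
  "kop (lg_ker r0 r1 A B) x (e1, e2) = (r0^2 * r1^2 - 1) * x (e1, e2) - r0 * r1 * x (e2, e1) - r0 * r1 * B * x (e3, e0)"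
  "kop (lg_ker r0 r1 A B) x (e1, e3) = r1 * x (e3, e1)"
  "kop (lg_ker r0 r1 A B) x (e2, e0) = r0 * x (e0, e2) + (r0^2 - 1) * x (e2, e0)"
  "kop (lg_ker r0 r1 A B) x (e2, e1) = - r0 * r1 * x (e1, e2) + B * x (e3, e0)"
  "kop (lg_ker r0 r1 A B) x (e2, e2) = - x (e2, e2)"
  "kop (lg_ker r0 r1 A B) x (e2, e3) = r1 * x (e3, e2)"
  "kop (lg_ker r0 r1 A B) x (e3, e0) = x (e0, e3) - r0 * r1 * A * x (e1, e2) + A * x (e2, e1) + A * B * x (e3, e0)"
  "kop (lg_ker r0 r1 A B) x (e3, e1) = r1 * x (e1, e3) + (r1^2 - 1) * x (e3, e1)"
  "kop (lg_ker r0 r1 A B) x (e3, e2) = r1 * x (e2, e3) + (r1^2 - 1) * x (e3, e2)"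
  "kop (lg_ker r0 r1 A B) x (e3, e3) = r1^2 * x (e3, e3)"
  by (simp_all add: kop_def sum_pair_UNIV UNIV_lg lg_ker_def ket_def)

lemma cubic_lg:
  assumes "r0 \<noteq> 0" "r1 \<noteq> 0" "A * B = (r0^2 - 1) * (1 - r1^2)"
  shows "cubic (r0^2) (r1^2) (lg_ker r0 r1 A B)"
  unfolding cubic_def
proof (intro conjI allI)
  fix x :: "lg_basis \<times> lg_basis \<Rightarrow> complex" and p :: "lg_basis \<times> lg_basis"
  obtain a b where p: "p = (a, b)" by fastforce
  let ?R = "kop (lg_ker r0 r1 A B)"
  have AB: "A * B = (r0 * r0 - 1) * (1 - r1 * r1)" using assms(3) by (simp add: power2_eq_square)
  have AB': "A * (B * z) = (r0 * r0 - 1) * (1 - r1 * r1) * z" for z by (simp flip: AB)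
  show "?R (?R (?R x)) p + (1 - r0^2 - r1^2) * ?R (?R x) p
     + (r0^2 * r1^2 - r0^2 - r1^2) * ?R x p + r0^2 * r1^2 * x p = 0"
    unfolding p
    by (induct a; induct b; simp only: kop_lg;
        ((algebra add: assms(3)) | (simp add: algebra_simps power2_eq_square AB AB')))
qed (use assms in auto)

text \<open>The bidegree in the exterior algebra on \<open>e1\<close> and \<open>e2\<close>, with
  \<open>e3\<close> as their product.\<close>

fun lg_wt :: "lg_basis \<Rightarrow> nat \<times> nat" where
  "lg_wt e0 = (0, 0)" | "lg_wt e1 = (1, 0)" | "lg_wt e2 = (0, 1)" | "lg_wt e3 = (1, 1)"

lemma lg_ker_cases:
  assumes "lg_ker r0 r1 A B (a, b) (c, d) \<noteq> 0"
  shows "(a, b) = (c, d) \<or> (a, b) = (d, c) \<or> {(a, b), (c, d)} \<subseteq> {(e1, e2), (e2, e1), (e3, e0), (e0, e3)}"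
  using assms by (cases c; cases d) (auto simp: lg_ker_def ket_def split: if_splits)

lemma lg_ker_wt:
  "lg_ker r0 r1 A B (a, b) (c, d) \<noteq> 0 \<Longrightarrow> lg_wt a + lg_wt b = lg_wt c + lg_wt d"
  by (drule lg_ker_cases) (auto simp: add.commute)

lemma lg_ker_mult:
  fixes w :: "lg_basis \<Rightarrow> complex"
  assumes "w e1 * w e2 = w e0 * w e3"
  shows "lg_ker r0 r1 A B (a, b) (c, d) \<noteq> 0 \<Longrightarrow> w a * w b = w c * w d"
  using assms by - (drule lg_ker_cases, auto simp: mult.commute)

text \<open>Raising by the second exterior generator. The signs in \<open>lg_odd_k\<close> are the
  parity of the exterior degree. Together with \<open>lg_even\<close> the nonzero entries join
  \<open>e0\<close> to \<open>e2\<close>, \<open>e1\<close> to \<open>e3\<close> and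
  \<open>e1\<close> to \<open>e2\<close>, hence connect the whole basis.\<close>

fun lg_odd :: "complex \<Rightarrow> lg_basis \<Rightarrow> lg_basis \<Rightarrow> complex" where
  "lg_odd r0 e2 c = of_bool (c = e0)" | "lg_odd r0 e3 c = r0 * of_bool (c = e1)" | "lg_odd r0 a c = 0"

fun lg_odd_k :: "complex \<Rightarrow> complex \<Rightarrow> lg_basis \<Rightarrow> complex" where
  "lg_odd_k r0 r1 e0 = 1 / r0" | "lg_odd_k r0 r1 e1 = - r1"
| "lg_odd_k r0 r1 e2 = - 1 / r0" | "lg_odd_k r0 r1 e3 = r1"

fun lg_even :: "lg_basis \<Rightarrow> lg_basis \<Rightarrow> complex" where
  "lg_even e2 c = of_bool (c = e1)" | "lg_even a c = 0"

fun lg_even_k :: "complex \<Rightarrow> complex \<Rightarrow> lg_basis \<Rightarrow> complex" where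
  "lg_even_k r0 r1 e0 = 1" | "lg_even_k r0 r1 e1 = 1 / (r0 * r1)"
| "lg_even_k r0 r1 e2 = r0 * r1" | "lg_even_k r0 r1 e3 = 1"

text \<open>The operator reaches \<open>e3\<close>, so its coefficient there depends on the scaling
  of that vector; the coefficient \<open>r0\<close> belongs to \<open>A = r0^2 - 1\<close> and
  \<open>B = 1 - r1^2\<close>.\<close>

lemma lg_odd_commutes:
  assumes "r0 \<noteq> 0"
  shows "kmul (lg_ker r0 r1 (r0^2 - 1) (1 - r1^2)) (prim_kernel (lg_odd r0) (lg_odd_k r0 r1))
       = kmul (prim_kernel (lg_odd r0) (lg_odd_k r0 r1)) (lg_ker r0 r1 (r0^2 - 1) (1 - r1^2))"
proof (rule kmul_eqI)
  fix x :: "lg_basis \<times> lg_basis \<Rightarrow> complex" and p :: "lg_basis \<times> lg_basis"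
  obtain a b where p: "p = (a, b)" by fastforce
  let ?R = "kop (lg_ker r0 r1 (r0^2 - 1) (1 - r1^2))" and ?P = "kop (prim_kernel (lg_odd r0) (lg_odd_k r0 r1))"
  show "?R (?P x) p = ?P (?R x) p"
    unfolding p using assms
    by (cases a; cases b; simp add: kop_lg kop_prim_kernel UNIV_lg field_simps power2_eq_square)
qed

lemma lg_even_commutes:
  assumes "r0 \<noteq> 0" "r1 \<noteq> 0"
  shows "kmul (lg_ker r0 r1 A B) (prim_kernel lg_even (lg_even_k r0 r1))
       = kmul (prim_kernel lg_even (lg_even_k r0 r1)) (lg_ker r0 r1 A B)"
proof (rule kmul_eqI)
  fix x :: "lg_basis \<times> lg_basis \<Rightarrow> complex" and p :: "lg_basis \<times> lg_basis"
  obtain a b where p: "p = (a, b)" by fastforce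
  let ?R = "kop (lg_ker r0 r1 A B)" and ?P = "kop (prim_kernel lg_even (lg_even_k r0 r1))"
  show "?R (?P x) p = ?P (?R x) p"
    unfolding p using assms
    by (cases a; cases b; simp add: kop_lg kop_prim_kernel UNIV_lg field_simps power2_eq_square)
qed

section \<open>The sixth root of unity and the ADO_3 matrix\<close>

lemma omega_sq: "omega ^ 2 = omega - 1"
proof -
  have o: "omega = Complex (1/2) (sqrt 3 / 2)"
    unfolding omega_def by (simp add: complex_eq_iff Re_exp Im_exp cos_60 sin_60)
  show ?thesis unfolding o by (simp add: complex_eq_iff power2_eq_square)
qed

text \<open>The sixth cyclotomic equation as a rewrite rule. With the next lemma, for right-nested
  products, it lowers every polynomial in \<open>omega\<close> to degree at most one.\<close>

lemma omega_mult: "omega * omega = omega - 1"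
  using omega_sq by (simp add: power2_eq_square)

lemma omega_mult_left: "omega * (omega * z) = omega * z - z"
  by (metis omega_mult mult.assoc left_diff_distrib mult_1)

lemma omega_nz [simp]: "omega \<noteq> 0"
  by (simp add: omega_def)

lemma omega_inverse: "inverse omega = 1 - omega"
proof -
  have "omega * (1 - omega) = 1" using omega_sq by algebra
  then show ?thesis by (rule inverse_unique)
qed

definition ado_ker :: "complex \<Rightarrow> ado_basis kernel" where
  "ado_ker t = ker_of (ado_R t)"

lemma kop_ado:
  "kop (ado_ker t) x (v0, v0) = t^2 * x (v0, v0)"
  "kop (ado_ker t) x (v0, v1) = (t^2 - 1) * x (v0, v1) + t * x (v1, v0)"
  "kop (ado_ker t) x (v0, v2) = (t^2 - 1) * (t^2 - omega^2) / t^2 * x (v0, v2) + (t - inverse t) * x (v1, v1) + x (v2, v0)"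
  "kop (ado_ker t) x (v1, v0) = t * x (v0, v1)"
  "kop (ado_ker t) x (v1, v1) = (omega * t + inverse t) * x (v0, v2) + omega^2 * x (v1, v1)"
  "kop (ado_ker t) x (v1, v2) = (omega^2 / t^2 - 1) * x (v1, v2) - omega / t * x (v2, v1)"
  "kop (ado_ker t) x (v2, v0) = x (v0, v2)"
  "kop (ado_ker t) x (v2, v1) = - omega / t * x (v1, v2)"
  "kop (ado_ker t) x (v2, v2) = omega^2 / t^2 * x (v2, v2)"
  by (simp_all add: kop_def sum_pair_UNIV UNIV_ado ado_ker_def ker_of_def lookup_add lookup_single when_def)

text \<open>Writing \<open>u\<close> for the inverse of \<open>t\<close> makes all entries
  polynomial. With \<open>ado_norm\<close> for the resulting products, identities between entries
  are settled by rewriting, without clearing denominators.\<close>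

lemma ado_inverse_rules:
  fixes t u :: complex
  assumes "t * u = 1"
  shows "inverse t = u" "c / t^2 = c * u^2" "c / t = c * u"
proof -
  have "t \<noteq> 0" using assms by auto
  then show u: "inverse t = u" using assms by (simp add: inverse_unique)
  show "c / t^2 = c * u^2" "c / t = c * u" by (simp_all add: divide_inverse power_inverse flip: u)
qed

lemma ado_norm:
  fixes t u z :: complex
  assumes "t * u = 1"
  shows "t * u = 1" "t * (u * z) = z" "omega * omega = omega - 1" "omega * (omega * z) = omega * z - z"
proof -
  show "t * (u * z) = z" by (simp flip: mult.assoc add: assms)
qed (simp_all add: assms omega_mult omega_mult_left)

lemma cubic_ado:
  assumes "t \<noteq> 0"
  shows "cubic (t^2) (omega^2 / t^2) (ado_ker t)"
  unfolding cubic_def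
proof (intro conjI allI)
  fix x :: "ado_basis \<times> ado_basis \<Rightarrow> complex" and p :: "ado_basis \<times> ado_basis"
  obtain a b where p: "p = (a, b)" by fastforce
  obtain u where u: "t * u = 1" using assms right_inverse by blast
  let ?R = "kop (ado_ker t)" and ?s = "omega^2 / t^2"
  show "?R (?R (?R x)) p + (1 - t^2 - ?s) * ?R (?R x) p
     + (t^2 * ?s - t^2 - ?s) * ?R x p + t^2 * ?s * x p = 0"
    unfolding p
    by (induct a; induct b; simp only: kop_ado ado_inverse_rules[OF u]; (simp add: algebra_simps eval_nat_numeral ado_norm[OF u])?)
qed (use assms in auto)

fun ado_wt :: "ado_basis \<Rightarrow> nat \<times> nat" where
  "ado_wt v0 = (0, 0)" | "ado_wt v1 = (1, 0)" | "ado_wt v2 = (2, 0)"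

lemma ado_ker_wt: "ado_ker t (a, b) (c, d) \<noteq> 0 \<Longrightarrow> ado_wt a + ado_wt b = ado_wt c + ado_wt d"
  by (cases c; cases d) (auto simp: ado_ker_def ker_of_def lookup_add lookup_single when_def split: if_splits)

lemma ado_ker_mult:
  fixes w :: "ado_basis \<Rightarrow> complex"
  assumes "w v1 * w v1 = w v0 * w v2"
  shows "ado_ker t (a, b) (c, d) \<noteq> 0 \<Longrightarrow> w a * w b = w c * w d"
  using assms
  by (cases c; cases d)
     (auto simp: ado_ker_def ker_of_def lookup_add lookup_single when_def mult.commute split: if_splits)

fun ado_E :: "ado_basis \<Rightarrow> ado_basis \<Rightarrow> complex" where
  "ado_E v0 c = 0" | "ado_E v1 c = of_bool (c = v0)" | "ado_E v2 c = omega^4 * of_bool (c = v1)"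

text \<open>The two coefficients vanish exactly for \<open>t^2 = 1\<close> and for
  \<open>t^2 = omega^2\<close>. At these values the span of \<open>v1\<close> and \<open>v2\<close>,
  respectively of \<open>v2\<close>, becomes a submodule; they are excluded when left and right
  traces are compared.\<close>

fun ado_F :: "complex \<Rightarrow> ado_basis \<Rightarrow> ado_basis \<Rightarrow> complex" where
  "ado_F t v0 c = (t^2 - 1) * of_bool (c = v1)"
| "ado_F t v1 c = (omega^4 - omega^2 * t^2) * of_bool (c = v2)" | "ado_F t v2 c = 0"

fun ado_k :: "complex \<Rightarrow> ado_basis \<Rightarrow> complex" where
  "ado_k t v0 = t" | "ado_k t v1 = t * omega^4" | "ado_k t v2 = t * omega^2"

lemma ado_E_commutes:
  assumes "t \<noteq> 0"
  shows "kmul (ado_ker t) (prim_kernel ado_E (ado_k t)) = kmul (prim_kernel ado_E (ado_k t)) (ado_ker t)"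
proof (rule kmul_eqI)
  fix x :: "ado_basis \<times> ado_basis \<Rightarrow> complex" and p :: "ado_basis \<times> ado_basis"
  obtain a b where p: "p = (a, b)" by fastforce
  obtain u where u: "t * u = 1" using assms right_inverse by blast
  let ?R = "kop (ado_ker t)" and ?P = "kop (prim_kernel ado_E (ado_k t))"
  show "?R (?P x) p = ?P (?R x) p"
    unfolding p
    by (induct a; induct b; simp add: kop_ado kop_prim_kernel UNIV_ado ado_inverse_rules[OF u];
        (simp add: algebra_simps eval_nat_numeral ado_norm[OF u])?)
qed

lemma ado_F_commutes:
  assumes "t \<noteq> 0"
  shows "kmul (ado_ker t) (prim_kernel (ado_F t) (ado_k t)) = kmul (prim_kernel (ado_F t) (ado_k t)) (ado_ker t)"
proof (rule kmul_eqI)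
  fix x :: "ado_basis \<times> ado_basis \<Rightarrow> complex" and p :: "ado_basis \<times> ado_basis"
  obtain a b where p: "p = (a, b)" by fastforce
  obtain u where u: "t * u = 1" using assms right_inverse by blast
  let ?R = "kop (ado_ker t)" and ?P = "kop (prim_kernel (ado_F t) (ado_k t))"
  show "?R (?P x) p = ?P (?R x) p"
    unfolding p
    by (induct a; induct b; simp add: kop_ado kop_prim_kernel UNIV_ado ado_inverse_rules[OF u];
        (simp add: algebra_simps eval_nat_numeral ado_norm[OF u])?)
qed

section \<open>Braid relations\<close>

text \<open>Curried arrays with three indices, so that the Yang-Baxter equation reduces, for each
  basis triple, to an identity in the unknown entries.\<close>

definition kop12 :: "('b::finite) kernel \<Rightarrow> ('b \<Rightarrow> 'b \<Rightarrow> 'b \<Rightarrow> complex) \<Rightarrow> ('b \<Rightarrow> 'b \<Rightarrow> 'b \<Rightarrow> complex)" where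
  "kop12 r x a b c = kop r (\<lambda>q. x (fst q) (snd q) c) (a, b)"

definition kop23 :: "('b::finite) kernel \<Rightarrow> ('b \<Rightarrow> 'b \<Rightarrow> 'b \<Rightarrow> complex) \<Rightarrow> ('b \<Rightarrow> 'b \<Rightarrow> 'b \<Rightarrow> complex)" where
  "kop23 r x a b c = kop r (\<lambda>q. x a (fst q) (snd q)) (b, c)"

definition yang_baxter :: "('b::finite) kernel \<Rightarrow> bool" where
  "yang_baxter r \<longleftrightarrow> (\<forall>x a b c. kop12 r (kop23 r (kop12 r x)) a b c = kop23 r (kop12 r (kop23 r x)) a b c)"

lemma yang_baxter_ado:
  assumes "t \<noteq> 0"
  shows "yang_baxter (ado_ker t)"
  unfolding yang_baxter_def
proof (intro allI)
  fix x a b c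
  obtain u where u: "t * u = 1" using assms right_inverse by blast
  show "kop12 (ado_ker t) (kop23 (ado_ker t) (kop12 (ado_ker t) x)) a b c
      = kop23 (ado_ker t) (kop12 (ado_ker t) (kop23 (ado_ker t) x)) a b c"
    unfolding kop12_def kop23_def
    by (induct a; induct b; induct c;
        simp only: kop_ado ado_inverse_rules[OF u] fst_conv snd_conv; (simp add: algebra_simps eval_nat_numeral ado_norm[OF u])?)
qed

lemma mm_sh_left: "mm (Suc n) (sh G) M (a # I) J = mm n (G :: ('b::finite) mat) (\<lambda>K L. M (a # K) L) I J"
  unfolding mm_def by (subst sum_words_head[of a]) auto

text \<open>Two matrices are compared through their left action on an arbitrary third one. After
  reassociation each factor acts on rows, where \<open>mm_gen_mat_0\<close>, \<open>mm_cup_0\<close>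
  and \<open>mm_cap_0\<close> describe it.\<close>

lemma mat_eqI_mm:
  assumes "mat_supp k m A" "mat_supp k m (B :: ('b::finite) mat)"
    and "\<And>M I J. length I = k \<Longrightarrow> mm m A M I J = mm m B M I J"
  shows "A = B"
proof (rule mat_suppI_ext[OF assms(1,2)])
  fix I J :: "'b list" assume "length I = k"
  then have "mm m A (idm m) I J = mm m B (idm m) I J" by (rule assms(3))
  then show "A I J = B I J" using assms by (simp add: mm_idm_right)
qed

lemma braid_relation:
  fixes r :: "('b::finite) kernel"
  assumes "yang_baxter r" "Suc (Suc i) < n"
  defines "G \<equiv> gen_mat n r"
  shows "mm n (G i) (mm n (G (Suc i)) (G i)) = mm n (G (Suc i)) (mm n (G i) (G (Suc i)))"
  using assms(2) unfolding G_def
proof (induction i arbitrary: n)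
  case 0
  then obtain m where n: "n = Suc (Suc (Suc m))"
    using that[of "n - 3"] by simp
  show ?case
  proof (rule mat_eqI_mm)
    fix M :: "'b mat" and I J :: "'b list" assume "length I = n"
    then obtain a b c I' where I: "I = a # b # c # I'" "length I' = m"
      using n by (metis length_Suc_conv)
    have G0: "mm n (gen_mat n r 0) N (a # b # c # I') J = kop12 r (\<lambda>a b c. N (a # b # c # I') J) a b c"
      for N and a b c
      using mm_gen_mat_0[of "c # I'" "Suc m" r N a b J] I by (simp add: n kop12_def kop_def)
    have G1: "mm n (gen_mat n r (Suc 0)) N (a # b # c # I') J = kop23 r (\<lambda>a b c. N (a # b # c # I') J) a b c"
      for N and a b c
      using mm_gen_mat_0[of "I'" m r "\<lambda>K L. N (a # K) L" b c J] I
      by (simp add: n gen_mat_Suc mm_sh_left kop23_def kop_def)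
    show "mm n (mm n (gen_mat n r 0) (mm n (gen_mat n r (Suc 0)) (gen_mat n r 0))) M I J
        = mm n (mm n (gen_mat n r (Suc 0)) (mm n (gen_mat n r 0) (gen_mat n r (Suc 0)))) M I J"
      using assms(1) unfolding mm_assoc I(1) G0 G1 yang_baxter_def by blast
  qed auto
next
  case (Suc i)
  then obtain m where "n = Suc m" by (cases n) auto
  then show ?case using Suc by (simp add: gen_mat_Suc flip: sh_mm)
qed

lemma far_commutation:
  fixes r :: "('b::finite) kernel"
  assumes "Suc i < j" "Suc j < n"
  defines "G \<equiv> gen_mat n r"
  shows "mm n (G i) (G j) = mm n (G j) (G i)"
  using assms(1,2) unfolding G_def
proof (induction i arbitrary: n j)
  case 0
  then obtain m where n: "n = Suc (Suc m)" using length_Suc2 by blast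
  obtain k where j: "j = Suc (Suc k)" using 0 length_Suc2 by blast
  show ?case
  proof (rule mat_eqI_mm)
    fix M :: "'b mat" and I J :: "'b list" assume "length I = n"
    then obtain a b I' where I: "I = a # b # I'" "length I' = m"
      using n by (metis length_Suc_conv)
    have G0: "mm n (gen_mat n r 0) N (a # b # K) J = (\<Sum>q\<in>UNIV. r (a, b) q * N (fst q # snd q # K) J)"
      if "length K = m" for N and K a b
      using mm_gen_mat_0[OF that, of r N a b J] by (simp add: n)
    have Gj: "mm n (gen_mat n r j) N (a # b # K) J = mm m (gen_mat m r k) (\<lambda>K L. N (a # b # K) L) K J"
      for N a b K by (simp add: n j gen_mat_Suc mm_sh_left)
    have "mm n (gen_mat n r 0) (mm n (gen_mat n r j) M) I J = mm n (gen_mat n r j) (mm n (gen_mat n r 0) M) I J"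
      unfolding I(1) G0[OF I(2)] Gj
      unfolding mm_def[of m]
      using G0 by (simp add: sum_distrib_left mult.left_commute) (rule sum.swap)
    then show "mm n (mm n (gen_mat n r 0) (gen_mat n r j)) M I J = mm n (mm n (gen_mat n r j) (gen_mat n r 0)) M I J"
      by (simp add: mm_assoc)
  qed auto
next
  case (Suc i)
  then obtain m k where "n = Suc m" "j = Suc k" by (cases n; cases j) auto
  then show ?case using Suc by (simp add: gen_mat_Suc flip: sh_mm)
qed

section \<open>Temperley--Lieb operators with loop value one\<close>

text \<open>The middle vectors \<open>e\<^sub>1\<close>, \<open>e\<^sub>2\<close> are encoded as \<open>True\<close>, \<open>False\<close>. The cup \<open>mu\<close> and the cap \<open>nu\<close> are
  scaled such that loops and zigzags both evaluate to one.\<close>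

fun mu :: "bool \<Rightarrow> bool \<Rightarrow> complex" where
  "mu True False = - 1" | "mu False True = omega^2" | "mu _ _ = 0"

fun nu :: "bool \<Rightarrow> bool \<Rightarrow> complex" where
  "nu True False = - omega" | "nu False True = - 1" | "nu _ _ = 0"

fun cup :: "nat \<Rightarrow> bool mat" where
  "cup 0 (a # b # I) J = (if I = J then mu a b else 0)"
| "cup (Suc i) (a # I) (c # J) = (if a = c then cup i I J else 0)"
| "cup i I J = 0"

fun cap :: "nat \<Rightarrow> bool mat" where
  "cap 0 I (a # b # J) = (if I = J then nu a b else 0)"
| "cap (Suc i) (a # I) (c # J) = (if a = c then cap i I J else 0)"
| "cap i I J = 0"

definition cup_mat :: "nat \<Rightarrow> nat \<Rightarrow> bool mat" where
  "cup_mat n i I J = (if length J = n then cup i I J else 0)"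

definition cap_mat :: "nat \<Rightarrow> nat \<Rightarrow> bool mat" where
  "cap_mat n i I J = (if length I = n then cap i I J else 0)"

lemma cup_length: "cup i I J \<noteq> 0 \<Longrightarrow> length I = Suc (Suc (length J))"
  by (induction i I J rule: cup.induct) (auto split: if_splits)

lemma cap_length: "cap i I J \<noteq> 0 \<Longrightarrow> length J = Suc (Suc (length I))"
  by (induction i I J rule: cap.induct) (auto split: if_splits)

lemma mat_supp_cup [simp]: "mat_supp (Suc (Suc n)) n (cup_mat n i)"
  using cup_length by (fastforce simp: mat_supp_def cup_mat_def split: if_splits)

lemma mat_supp_cap [simp]: "mat_supp n (Suc (Suc n)) (cap_mat n i)"
  using cap_length by (fastforce simp: mat_supp_def cap_mat_def split: if_splits)

lemma sh_cup: "sh (cup_mat n i) = cup_mat (Suc n) (Suc i)"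
  by (rule sh_eqI) (auto simp: cup_mat_def)

lemma sh_cap: "sh (cap_mat n i) = cap_mat (Suc n) (Suc i)"
  by (rule sh_eqI) (auto simp: cap_mat_def)

lemma mm_cup_0:
  assumes "length I = n"
  shows "mm n (cup_mat n 0) M (a # b # I) J = mu a b * M I J"
proof -
  have "mm n (cup_mat n 0) M (a # b # I) J = (\<Sum>K\<in>words n. if K = I then mu a b * M I J else 0)"
    unfolding mm_def by (intro sum.cong) (auto simp: cup_mat_def)
  then show ?thesis using assms by simp
qed

lemma mm_cap_0:
  assumes "length I = n"
  shows "mm (Suc (Suc n)) (cap_mat n 0) M I J = (\<Sum>a\<in>UNIV. \<Sum>b\<in>UNIV. nu a b * M (a # b # I) J)"
proof -
  have "mm (Suc (Suc n)) (cap_mat n 0) M I J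
      = (\<Sum>a\<in>UNIV. \<Sum>b\<in>UNIV. \<Sum>K\<in>words n. if K = I then nu a b * M (a # b # I) J else 0)"
    using assms unfolding mm_def sum_words_Suc by (intro sum.cong) (auto simp: cap_mat_def)
  then show ?thesis using assms by simp
qed

abbreviation cap_cup :: "nat \<Rightarrow> nat \<Rightarrow> nat \<Rightarrow> bool mat" where
  "cap_cup n i j \<equiv> mm (Suc (Suc n)) (cap_mat n i) (cup_mat n j)"

text \<open>The two states of the loop add up to \<open>omega - omega^2\<close>, which is one for a
  primitive sixth root of unity.\<close>

lemma loop: "i \<le> n \<Longrightarrow> cap_cup n i i = idm n"
proof (induction i arbitrary: n)
  case 0
  show ?case
  proof (rule mat_eqI_mm)
    fix M and I J :: "bool list" assume I: "length I = n"
    show "mm n (cap_cup n 0 0) M I J = mm n (idm n) M I J"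
      using I omega_sq by (simp add: mm_assoc mm_cap_0 mm_cup_0 mm_idm_row UNIV_bool) (simp add: algebra_simps)
  qed (auto intro: mat_supp_mm)
next
  case (Suc i)
  then obtain m where "n = Suc m" by (cases n) auto
  then show ?case using Suc by (simp flip: sh_cup sh_cap sh_mm)
qed

text \<open>For one value of the incoming bit the cup and the cap contribute
  \<open>- omega^3\<close>, for the other \<open>(- 1) * (- 1)\<close>; both are one.\<close>

lemma zigzag_left: "i \<le> n \<Longrightarrow> cap_cup (Suc n) i (Suc i) = idm (Suc n)"
proof (induction i arbitrary: n)
  case 0
  show ?case
  proof (rule mat_eqI_mm)
    fix M and I J :: "bool list" assume "length I = Suc n"
    then obtain c I' where I: "I = c # I'" "length I' = n" by (metis length_Suc_conv)
    show "mm (Suc n) (cap_cup (Suc n) 0 (Suc 0)) M I J = mm (Suc n) (idm (Suc n)) M I J"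
      using I by (cases c) (simp_all add: mm_assoc mm_cap_0 mm_cup_0 mm_idm_row UNIV_bool mm_sh_left
        power2_eq_square omega_mult omega_mult_left algebra_simps flip: sh_cup)
  qed (auto intro: mat_supp_mm)
next
  case (Suc i)
  then obtain m where "n = Suc m" by (cases n) auto
  then show ?case using Suc.IH[of m] Suc.prems by (simp flip: sh_cup sh_cap sh_mm)
qed

lemma zigzag_right: "i \<le> n \<Longrightarrow> cap_cup (Suc n) (Suc i) i = idm (Suc n)"
proof (induction i arbitrary: n)
  case 0
  show ?case
  proof (rule mat_eqI_mm)
    fix M and I J :: "bool list" assume "length I = Suc n"
    then obtain c I' where I: "I = c # I'" "length I' = n" by (metis length_Suc_conv)
    have *: "mm (Suc n) (cup_mat (Suc n) 0) M (c # a # b # I') J = mu c a * M (b # I') J" for a b c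
      using mm_cup_0[of "b # I'" "Suc n"] I by simp
    show "mm (Suc n) (mm (Suc (Suc (Suc n))) (cap_mat (Suc n) (Suc 0)) (cup_mat (Suc n) 0)) M I J = mm (Suc n) (idm (Suc n)) M I J"
      using I by (cases c) (simp_all add: mm_assoc mm_cap_0 * mm_idm_row UNIV_bool mm_sh_left
        power2_eq_square omega_mult omega_mult_left algebra_simps flip: sh_cap)
  qed (auto intro: mat_supp_mm)
next
  case (Suc i)
  then obtain m where "n = Suc m" by (cases n) auto
  then show ?case using Suc.IH[of m] Suc.prems by (simp flip: sh_cup sh_cap sh_mm)
qed

lemma cap_cup_far:
  "i \<le> j \<Longrightarrow> j \<le> n \<Longrightarrow> cap_cup (Suc (Suc n)) i (Suc (Suc j))
     = mm n (cup_mat n j) (cap_mat n i)"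
proof (induction i arbitrary: j n)
  case 0
  show ?case
  proof (rule mat_eqI_mm)
    fix M and I J :: "bool list" assume I: "length I = Suc (Suc n)"
    have "mm n (cup_mat n j) (mm (Suc (Suc n)) (cap_mat n 0) M) I J
        = mm n (cup_mat n j) (\<lambda>K L. \<Sum>a\<in>UNIV. \<Sum>b\<in>UNIV. nu a b * M (a # b # K) L) I J"
      by (intro mm_cong_right mm_cap_0)
    also have "\<dots> = (\<Sum>a\<in>UNIV. \<Sum>b\<in>UNIV. nu a b * mm n (cup_mat n j) (\<lambda>K L. M (a # b # K) L) I J)"
      by (simp add: UNIV_bool) (simp add: mm_def sum.distrib sum_distrib_left sum_subtractf sum_negf algebra_simps)
    also have "\<dots> = mm (Suc (Suc (Suc (Suc n)))) (cap_mat (Suc (Suc n)) 0)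
        (mm (Suc (Suc n)) (cup_mat (Suc (Suc n)) (Suc (Suc j))) M) I J"
      unfolding mm_cap_0[OF I] by (simp add: mm_sh_left flip: sh_cup)
    finally show "mm (Suc (Suc n)) (cap_cup (Suc (Suc n)) 0 (Suc (Suc j))) M I J
        = mm (Suc (Suc n)) (mm n (cup_mat n j) (cap_mat n 0)) M I J"
      by (simp add: mm_assoc)
  qed (auto intro: mat_supp_mm)
next
  case (Suc i)
  then obtain m k where "n = Suc m" "j = Suc k" by (cases n; cases j) auto
  then show ?case using Suc.IH[of k m] Suc.prems by (simp flip: sh_cup sh_cap sh_mm)
qed

lemma cap_far_cup:
  "i \<le> j \<Longrightarrow> j \<le> n \<Longrightarrow> cap_cup (Suc (Suc n)) (Suc (Suc j)) i
     = mm n (cup_mat n i) (cap_mat n j)"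
proof (induction i arbitrary: j n)
  case 0
  show ?case
  proof (rule mat_eqI_mm)
    fix M and I J :: "bool list" assume "length I = Suc (Suc n)"
    then obtain a b I' where I: "I = a # b # I'" "length I' = n" by (metis length_Suc_conv)
    have R: "mm (Suc (Suc n)) (cup_mat (Suc (Suc n)) 0) M (a # b # L) J = mu a b * M L J" if "length L = Suc (Suc n)" for L
      using that by (rule mm_cup_0)
    have "mm (Suc (Suc (Suc (Suc n)))) (cap_mat (Suc (Suc n)) (Suc (Suc j))) (mm (Suc (Suc n)) (cup_mat (Suc (Suc n)) 0) M) I J
        = mm (Suc (Suc n)) (cap_mat n j) (\<lambda>K L. mm (Suc (Suc n)) (cup_mat (Suc (Suc n)) 0) M (a # b # K) L) I' J"
      by (simp add: I(1) mm_sh_left flip: sh_cap)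
    also have "\<dots> = mm (Suc (Suc n)) (cap_mat n j) (\<lambda>K L. mu a b * M K L) I' J"
      using R by (intro mm_cong_right) auto
    also have "\<dots> = mu a b * mm (Suc (Suc n)) (cap_mat n j) M I' J"
      by (simp add: mm_def sum_distrib_left mult.left_commute)
    also have "\<dots> = mm n (cup_mat n 0) (mm (Suc (Suc n)) (cap_mat n j) M) I J"
      using I by (simp add: mm_cup_0)
    finally show "mm (Suc (Suc n)) (cap_cup (Suc (Suc n)) (Suc (Suc j)) 0) M I J
        = mm (Suc (Suc n)) (mm n (cup_mat n 0) (cap_mat n j)) M I J"
      by (simp add: mm_assoc)
  qed (auto intro: mat_supp_mm)
next
  case (Suc i)
  then obtain m k where "n = Suc m" "j = Suc k" by (cases n; cases j) auto
  then show ?case using Suc.IH[of k m] Suc.prems by (simp flip: sh_cup sh_cap sh_mm)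
qed

section \<open>Normal forms of diagrams: cups after caps\<close>

inductive cups :: "nat \<Rightarrow> nat \<Rightarrow> bool mat \<Rightarrow> bool" where
  cups_id: "cups k k (idm k)"
| cups_step: "cups k j U \<Longrightarrow> i \<le> k \<Longrightarrow> cups (Suc (Suc k)) j (mm k (cup_mat k i) U)"

inductive caps :: "nat \<Rightarrow> nat \<Rightarrow> bool mat \<Rightarrow> bool" where
  caps_id: "caps k k (idm k)"
| caps_step: "caps (Suc (Suc k)) j A \<Longrightarrow> i \<le> k \<Longrightarrow> caps k j (mm (Suc (Suc k)) (cap_mat k i) A)"

definition zero_mat :: "'b mat" where
  "zero_mat = (\<lambda>I J. 0)"

text \<open>The span of the diagrams in normal form; the last argument is the sum of the coefficients.\<close>

inductive normal_form :: "nat \<Rightarrow> nat \<Rightarrow> bool mat \<Rightarrow> complex \<Rightarrow> bool" where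
  nf_diagram: "cups k j U \<Longrightarrow> caps j m A \<Longrightarrow> normal_form k m (mm j U A) 1"
| nf_zero: "normal_form k m zero_mat 0"
| nf_add: "normal_form k m D c \<Longrightarrow> normal_form k m D' c' \<Longrightarrow> normal_form k m (madd D D') (c + c')"
| nf_scale: "normal_form k m D c \<Longrightarrow> normal_form k m (mscale a D) (a * c)"

lemma mat_supp_cups [simp]: "cups k j U \<Longrightarrow> mat_supp k j U"
  by (induction rule: cups.induct) auto

lemma mat_supp_caps [simp]: "caps j m A \<Longrightarrow> mat_supp j m A"
  by (induction rule: caps.induct) auto

lemma mm_zero [simp]: "mm n A zero_mat = zero_mat" "mm n zero_mat A = zero_mat"
  by (auto simp: mm_def zero_mat_def)

lemma mat_supp_zero [simp]: "mat_supp k m zero_mat"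
  by (simp add: mat_supp_def zero_mat_def)

lemma sh_zero: "sh zero_mat = zero_mat"
  by (rule sh_eqI) (auto simp: zero_mat_def)

lemma nf_cup: "normal_form k m D c \<Longrightarrow> i \<le> k \<Longrightarrow> normal_form (Suc (Suc k)) m (mm k (cup_mat k i) D) c"
proof (induction rule: normal_form.induct)
  case (nf_diagram k j U m A)
  have "normal_form (Suc (Suc k)) m (mm j (mm k (cup_mat k i) U) A) 1"
    by (rule normal_form.nf_diagram[OF cups_step]) (use nf_diagram in auto)
  then show ?case by (simp add: mm_assoc)
qed (auto simp: mm_madd_right mm_mscale_right intro: normal_form.intros)

text \<open>The position of the cap is compared with that of the outermost cup. If they coincide or
  are adjacent, the two disappear as a loop or a zigzag, with factor one; otherwise they slide past
  each other and the cap meets the remaining cups. It disappears on the way or comes out behind all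
  of them.\<close>

lemma cap_cups:
  assumes "cups K j U" "K = Suc (Suc k)" "i \<le> k"
  shows "cups k j (mm (Suc (Suc k)) (cap_mat k i) U) \<or>
    (\<exists>j' i' U'. j = Suc (Suc j') \<and> i' \<le> j' \<and> cups k j' U' \<and>
       mm (Suc (Suc k)) (cap_mat k i) U = mm j' U' (cap_mat j' i'))"
  using assms
proof (induction arbitrary: k i rule: cups.induct)
  case (cups_id K)
  then have "mm (Suc (Suc k)) (cap_mat k i) (idm K) = mm k (idm k) (cap_mat k i)"
    by (simp add: mm_idm_right[OF mat_supp_cap] mm_idm_left[OF mat_supp_cap])
  then show ?case using cups_id by (auto intro: cups.cups_id)
next
  case (cups_step k0 j U i0)
  then have k0: "k0 = k" by simp
  note U = cups_step.hyps(1)[unfolded k0] and i0 = cups_step.hyps(2)[unfolded k0]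
  note IH = cups_step.IH[unfolded k0]
  have cancel: "cups k j (mm (Suc (Suc k)) (cap_mat k i) (mm k (cup_mat k i0) U))"
    if "cap_cup k i i0 = idm k"
    using U that by (simp add: mm_idm_left[OF mat_supp_cups] flip: mm_assoc)
  \<comment> \<open>The distant case: after sliding, the induction hypothesis treats the cap and the
    remaining cups, and the cup that was passed is put back in front.\<close>
  have push: ?case if k: "k = Suc (Suc l)" and ii: "i' \<le> l" "i1 \<le> l"
    and eq: "cap_cup k i i0 = mm l (cup_mat l i1) (cap_mat l i')" for l i' i1
  proof -
    have eq': "mm (Suc (Suc k)) (cap_mat k i) (mm k (cup_mat k i0) U) = mm l (cup_mat l i1) (mm k (cap_mat l i') U)"
      using eq by (metis mm_assoc)
    from IH[OF k ii(1)] show ?thesis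
    proof
      assume "cups l j (mm (Suc (Suc l)) (cap_mat l i') U)"
      then have "cups k j (mm l (cup_mat l i1) (mm (Suc (Suc l)) (cap_mat l i') U))"
        unfolding k by (rule cups.cups_step) (rule ii)
      then show ?thesis unfolding k0 using eq' k by simp
    next
      assume "\<exists>j' i'' U'. j = Suc (Suc j') \<and> i'' \<le> j' \<and> cups l j' U' \<and>
         mm (Suc (Suc l)) (cap_mat l i') U = mm j' U' (cap_mat j' i'')"
      then obtain j' i'' U' where *: "j = Suc (Suc j')" "i'' \<le> j'" "cups l j' U'"
        "mm (Suc (Suc l)) (cap_mat l i') U = mm j' U' (cap_mat j' i'')" by blast
      have "cups k j' (mm l (cup_mat l i1) U')"
        unfolding k by (rule cups.cups_step[OF *(3)]) (rule ii)
      then show ?thesis unfolding k0 using eq' k * by (metis mm_assoc)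
    qed
  qed
  consider "i = i0" | "i0 = Suc i" | "i = Suc i0" | "Suc (Suc i) \<le> i0" | "Suc (Suc i0) \<le> i" by linarith
  then show ?case
  proof cases
    case 1
    then show ?thesis unfolding k0 using 1 cancel loop cups_step.prems i0 by auto
  next
    case 2
    then obtain l where l: "k = Suc l" using i0 by (cases k) auto
    then show ?thesis unfolding k0 using 2 cancel zigzag_left[of i l] i0 by auto
  next
    case 3
    then obtain l where l: "k = Suc l" using cups_step.prems by (cases k) auto
    then show ?thesis unfolding k0 using 3 cancel zigzag_right[of i0 l] cups_step.prems by auto
  next
    case 4
    then obtain i1 l where l: "i0 = Suc (Suc i1)" "k = Suc (Suc l)" "i \<le> i1"
      using i0 that[of "i0 - 2" "k - 2"] by auto
    show ?thesis using push[OF l(2) _ _ cap_cup_far[of i i1 l, folded l(1,2)]] l i0 by simp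
  next
    case 5
    then obtain i1 l where l: "i = Suc (Suc i1)" "k = Suc (Suc l)" "i0 \<le> i1"
      using cups_step.prems that[of "i - 2" "k - 2"] by auto
    show ?thesis using push[OF l(2) _ _ cap_far_cup[of i0 i1 l, folded l(1,2)]] l cups_step.prems i0 by simp
  qed
qed

lemma nf_cap: "normal_form K m D c \<Longrightarrow> K = Suc (Suc k) \<Longrightarrow> i \<le> k
   \<Longrightarrow> normal_form k m (mm (Suc (Suc k)) (cap_mat k i) D) c"
proof (induction rule: normal_form.induct)
  case (nf_diagram K j U m A)
  from cap_cups[OF nf_diagram.hyps(1) nf_diagram.prems] show ?case
  proof
    assume "cups k j (mm (Suc (Suc k)) (cap_mat k i) U)"
    from normal_form.nf_diagram[OF this nf_diagram.hyps(2)] show ?thesis by (simp add: mm_assoc)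
  next
    assume "\<exists>j' i' U'. j = Suc (Suc j') \<and> i' \<le> j' \<and> cups k j' U' \<and>
       mm (Suc (Suc k)) (cap_mat k i) U = mm j' U' (cap_mat j' i')"
    then obtain j' i' U' where *: "j = Suc (Suc j')" "i' \<le> j'" "cups k j' U'"
       "mm (Suc (Suc k)) (cap_mat k i) U = mm j' U' (cap_mat j' i')" by blast
    have "caps j' m (mm (Suc (Suc j')) (cap_mat j' i') A)"
      using nf_diagram.hyps(2) * by (auto intro: caps_step)
    from normal_form.nf_diagram[OF *(3) this] show ?thesis using * by (metis mm_assoc)
  qed
qed (auto simp: mm_madd_right mm_mscale_right intro: normal_form.intros)

lemma nf_caps_cups: "caps j k A \<Longrightarrow> cups k m U \<Longrightarrow> normal_form j m (mm k A U) 1"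
proof (induction rule: caps.induct)
  case (caps_id k)
  then show ?case using normal_form.nf_diagram[OF _ caps.caps_id, of k m U]
    by (simp add: mm_idm_left[OF mat_supp_cups] mm_idm_right[OF mat_supp_cups])
next
  case (caps_step k j A i)
  then show ?case by (simp add: mm_assoc nf_cap)
qed

subsection \<open>The trace\<close>

text \<open>The weights multiply to one, so that cups, which pair \<open>True\<close> with
  \<open>False\<close>, preserve their products; they add up to one, so that the identity has trace
  one on any number of strands.\<close>

fun kap :: "bool \<Rightarrow> complex" where
  "kap True = omega" | "kap False = inverse omega"

definition tl_trace :: "nat \<Rightarrow> bool mat \<Rightarrow> complex" where
  "tl_trace k D = (\<Sum>I\<in>words k. wprod kap I * D I I)"

lemma cup_kap: "cup i I J \<noteq> 0 \<Longrightarrow> wprod kap I = wprod kap J"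
proof (induction i I J rule: cup.induct)
  case (1 a b I J)
  then show ?case by (cases a; cases b) (auto split: if_splits)
qed (auto split: if_splits)

lemma cups_kap: "cups k j U \<Longrightarrow> U I J \<noteq> 0 \<Longrightarrow> wprod kap I = wprod kap J"
proof (induction arbitrary: I rule: cups.induct)
  case (cups_id k)
  then show ?case by (auto simp: idm_def)
next
  case (cups_step k j U i)
  then obtain K where "cup_mat k i I K * U K J \<noteq> 0"
    unfolding mm_def by (meson sum.not_neutral_contains_not_neutral)
  then have "cup i I K \<noteq> 0" "U K J \<noteq> 0" by (auto simp: cup_mat_def split: if_splits)
  then show ?case using cup_kap cups_step.IH by metis
qed

lemma cups_le: "cups k j U \<Longrightarrow> j \<le> k \<and> (j = k \<longrightarrow> U = idm k)"
  by (induction rule: cups.induct) auto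

lemma caps_le: "caps j k A \<Longrightarrow> j \<le> k \<and> (j = k \<longrightarrow> A = idm k)"
  by (induction rule: caps.induct) auto

lemma tl_trace_idm: "tl_trace k (idm k) = 1"
proof -
  have "(\<Sum>I\<in>words k. wprod kap I) = 1" for k
    by (induction k) (auto simp: sum_words_Suc UNIV_bool omega_inverse simp flip: sum_distrib_left distrib_right)
  then show ?thesis by (simp add: tl_trace_def idm_def)
qed

text \<open>Every closed diagram evaluates to one: cyclicity moves the caps of a normal form in front of its cups,
  which reduces the number of strands.\<close>

lemma tl_trace_nf: "normal_form k k D c \<Longrightarrow> tl_trace k D = c"
proof (induction k arbitrary: D c rule: less_induct)
  case (less k)
  have "tl_trace k D = c" if "normal_form l m D c" "l = k" "m = k" for l m D c
    using that
  proof (induction rule: normal_form.induct)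
    case (nf_diagram l j U m A)
    note 1 = nf_diagram.hyps[unfolded nf_diagram.prems] nf_diagram.prems
    show ?case
    proof (cases "j = k")
      case True
      then show ?thesis
        using cups_le[OF 1(1)] caps_le[OF 1(2)] 1(3,4) by (simp add: mm_idm_left[OF mat_supp_idm] tl_trace_idm)
    next
      case False
      then have "j < k" using cups_le[OF 1(1)] 1(3) by simp
      have "tl_trace k (mm j U A) = (\<Sum>I\<in>words k. \<Sum>J\<in>words j. wprod kap I * (U I J * A J I))"
        by (simp add: tl_trace_def mm_def sum_distrib_left)
      also have "\<dots> = (\<Sum>I\<in>words k. \<Sum>J\<in>words j. wprod kap J * (A J I * U I J))"
      proof (intro sum.cong refl)
        fix I J
        show "wprod kap I * (U I J * A J I) = wprod kap J * (A J I * U I J)"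
          using cups_kap[OF 1(1), of I J] by (cases "U I J = 0") auto
      qed
      also have "\<dots> = tl_trace j (mm k A U)"
        by (simp add: tl_trace_def mm_def sum_distrib_left) (rule sum.swap)
      also have "\<dots> = 1"
        using less.IH[OF \<open>j < k\<close>] nf_caps_cups 1 by blast
      finally show ?thesis .
    qed
  qed (auto simp: tl_trace_def zero_mat_def madd_def mscale_def sum.distrib sum_distrib_left algebra_simps)
  then show ?case using less.prems by blast
qed

text \<open>The last argument belongs to the derivation. That the matrix determines it is not part
  of the definition but follows, for square matrices, from \<open>tl_span_trace\<close>.\<close>

inductive tl_span :: "nat \<Rightarrow> nat \<Rightarrow> bool mat \<Rightarrow> complex \<Rightarrow> bool" where
  tl_id: "tl_span k k (idm k) 1"
| tl_cup: "i \<le> k \<Longrightarrow> tl_span (Suc (Suc k)) k (cup_mat k i) 1"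
| tl_cap: "i \<le> k \<Longrightarrow> tl_span k (Suc (Suc k)) (cap_mat k i) 1"
| tl_zero: "tl_span k m zero_mat 0"
| tl_add: "tl_span k m D c \<Longrightarrow> tl_span k m D' c' \<Longrightarrow> tl_span k m (madd D D') (c + c')"
| tl_scale: "tl_span k m D c \<Longrightarrow> tl_span k m (mscale a D) (a * c)"
| tl_mm: "tl_span k l D c \<Longrightarrow> tl_span l m D' c' \<Longrightarrow> tl_span k m (mm l D D') (c * c')"

lemma mat_supp_tl: "tl_span k m D c \<Longrightarrow> mat_supp k m D"
  by (induction rule: tl_span.induct) auto

lemma mat_supp_nf: "normal_form k m D c \<Longrightarrow> mat_supp k m D"
  by (induction rule: normal_form.induct) (auto intro: mat_supp_mm)

text \<open>Normal forms absorb a cup or a cap from the left, so a product in the span is normalised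
  factor by factor from the right.\<close>

lemma tl_nf: "tl_span k l D c \<Longrightarrow> normal_form l m D' c' \<Longrightarrow> normal_form k m (mm l D D') (c * c')"
proof (induction arbitrary: D' c' rule: tl_span.induct)
  case (tl_id k)
  then show ?case by (simp add: mm_idm_left[OF mat_supp_nf])
next
  case (tl_mm k l D c m D1 c1)
  then show ?case by (simp add: mm_assoc mult.assoc)
qed (auto simp: mm_madd_left mm_mscale_left mult.assoc distrib_right intro: normal_form.intros nf_cup nf_cap)

lemma tl_span_trace: "tl_span k k D c \<Longrightarrow> tl_trace k D = c"
proof -
  assume D: "tl_span k k D c"
  have "normal_form k k (mm k (idm k) (idm k)) 1"
    by (rule nf_diagram) (auto intro: cups_id caps_id)
  then have "normal_form k k (idm k) 1" by (simp add: mm_idm_left[OF mat_supp_idm])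
  from tl_nf[OF D this] have "normal_form k k D c" by (simp add: mm_idm_right[OF mat_supp_tl[OF D]])
  then show ?thesis by (rule tl_trace_nf)
qed

lemma tl_sh: "tl_span k m D c \<Longrightarrow> tl_span (Suc k) (Suc m) (sh D) c"
proof (induction rule: tl_span.induct)
  case (tl_cup i k)
  then show ?case using tl_span.tl_cup[of "Suc i" "Suc k"] by (simp add: sh_cup)
next
  case (tl_cap i k)
  then show ?case using tl_span.tl_cap[of "Suc i" "Suc k"] by (simp add: sh_cap)
qed (auto simp: sh_zero sh_madd sh_mscale sh_mm intro: tl_span.intros)

section \<open>Collapsing the middle vectors\<close>

fun mids :: "ado_basis list \<Rightarrow> nat" where
  "mids [] = 0"
| "mids (v1 # p) = Suc (mids p)"
| "mids (v0 # p) = mids p"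
| "mids (v2 # p) = mids p"

text \<open>A Links-Gould word is a pattern of colours together with one bit for every middle
  letter. The last equation covers exhausted lists as well as lengths that do not match.\<close>

fun merge :: "ado_basis list \<Rightarrow> bool list \<Rightarrow> lg_basis list" where
  "merge (v0 # p) x = e0 # merge p x"
| "merge (v2 # p) x = e3 # merge p x"
| "merge (v1 # p) (c # x) = (if c then e1 else e2) # merge p x"
| "merge _ _ = []"

fun colour :: "lg_basis \<Rightarrow> ado_basis" where
  "colour e0 = v0" | "colour e1 = v1" | "colour e2 = v1" | "colour e3 = v2"

lemma colour_merge: "length x = mids p \<Longrightarrow> map colour (merge p x) = p"
  by (induction p x rule: merge.induct) auto

lemma length_merge: "length x = mids p \<Longrightarrow> length (merge p x) = length p"
  by (induction p x rule: merge.induct) auto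

lemma merge_inj: "length x = mids p \<Longrightarrow> length y = mids p \<Longrightarrow> merge p x = merge p y \<longleftrightarrow> x = y"
proof (induction p arbitrary: x y)
  case (Cons a p)
  show ?case
  proof (cases a)
    case v1
    then obtain b x' c y' where "x = b # x'" "y = c # y'" "length x' = mids p" "length y' = mids p"
      using Cons.prems by (auto simp: length_Suc_conv)
    then show ?thesis using v1 Cons.IH[of x' y'] by auto
  qed (use Cons in auto)
qed auto

lemma sum_merge:
  "(\<Sum>I\<in>words n. f I) = (\<Sum>p\<in>words n. \<Sum>x\<in>words (mids p). f (merge p x))"
proof (induction n arbitrary: f)
  case (Suc n)
  have "(\<Sum>I\<in>words (Suc n). f I) = (\<Sum>a\<in>UNIV. \<Sum>p\<in>words n. \<Sum>x\<in>words (mids p). f (a # merge p x))"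
    by (simp add: sum_words_Suc Suc)
  also have "\<dots> = (\<Sum>c\<in>UNIV. \<Sum>p\<in>words n. \<Sum>x\<in>words (mids (c # p)). f (merge (c # p) x))"
    by (simp add: UNIV_lg UNIV_ado UNIV_bool sum_words_Suc sum.distrib ac_simps)
  finally show ?case by (simp add: sum_words_Suc)
qed simp

definition ado_flip :: "complex \<Rightarrow> ado_basis kernel" where
  "ado_flip t p q = ado_ker t (prod.swap p) (prod.swap q)"

text \<open>The root \<open>- omega / t\<close> of \<open>t1\<close> is the ADO_3 entry that
  exchanges \<open>v1\<close> and \<open>v2\<close>. Comparison with \<open>nu\<close> and
  \<open>mu\<close> forces \<open>- A = t - inverse t\<close> and
  \<open>- omega * B = omega * t + inverse t\<close>, the ADO_3 entries out of and into
  \<open>v1 \<otimes> v1\<close>.\<close>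

definition lg_special :: "complex \<Rightarrow> lg_basis kernel" where
  "lg_special t = lg_ker t (- omega / t) (- (t - inverse t)) (- (t + inverse omega * inverse t))"

lemma lg_special_AB:
  assumes "t \<noteq> 0"
  shows "(- (t - inverse t)) * (- (t + inverse omega * inverse t)) = (t^2 - 1) * (1 - (- omega / t)^2)"
proof -
  obtain u where u: "t * u = 1" using assms right_inverse by blast
  show ?thesis unfolding ado_inverse_rules[OF u] omega_inverse using omega_sq u by algebra
qed

definition collapses_at :: "ado_basis list \<Rightarrow> ado_basis list \<Rightarrow> lg_basis mat \<Rightarrow> complex \<Rightarrow> bool" where
  "collapses_at p q M c \<longleftrightarrow> (\<exists>D. tl_span (mids p) (mids q) D c \<and>
     (\<forall>x\<in>words (mids p). \<forall>y\<in>words (mids q). M (merge p x) (merge q y) = D x y))"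

definition collapses :: "nat \<Rightarrow> lg_basis mat \<Rightarrow> ado_basis mat \<Rightarrow> bool" where
  "collapses n M N \<longleftrightarrow> (\<forall>p\<in>words n. \<forall>q\<in>words n. collapses_at p q M (N p q))"

lemma collapses_atI:
  assumes "tl_span (mids p) (mids q) D c"
    "\<And>x y. length x = mids p \<Longrightarrow> length y = mids q \<Longrightarrow> M (merge p x) (merge q y) = D x y"
  shows "collapses_at p q M c"
  unfolding collapses_at_def using assms by (intro exI[of _ D]) auto

lemma collapses_atE:
  assumes "collapses_at p q M c"
  obtains D where "tl_span (mids p) (mids q) D c"
    "\<And>x y. length x = mids p \<Longrightarrow> length y = mids q \<Longrightarrow> M (merge p x) (merge q y) = D x y"
  using assms unfolding collapses_at_def by auto

lemma collapses_at_zero: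
  "(\<And>x y. length x = mids p \<Longrightarrow> length y = mids q \<Longrightarrow> M (merge p x) (merge q y) = 0) \<Longrightarrow> collapses_at p q M 0"
  by (rule collapses_atI[OF tl_zero]) (simp add: zero_mat_def)

lemma collapses_at_add:
  assumes "collapses_at p q M c" "collapses_at p q M' c'" shows "collapses_at p q (madd M M') (c + c')"
  using assms by (elim collapses_atE) (auto intro!: collapses_atI[OF tl_add] simp: madd_def)

lemma collapses_at_scale:
  assumes "collapses_at p q M c" shows "collapses_at p q (mscale a M) (a * c)"
  using assms by (elim collapses_atE) (auto intro!: collapses_atI[OF tl_scale] simp: mscale_def)

lemma collapses_idm: "collapses n (idm n) (idm n)"
  unfolding collapses_def
proof (intro ballI)
  fix p q :: "ado_basis list" assume pq: "p \<in> words n" "q \<in> words n"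
  show "collapses_at p q (idm n) (idm n p q)"
  proof (cases "p = q")
    case True
    then show ?thesis using pq
      by (intro collapses_atI[of _ _ "idm (mids p)"]) (auto simp: idm_def length_merge merge_inj tl_id)
  next
    case False
    then have "merge p x \<noteq> merge q y" if "length x = mids p" "length y = mids q" for x y
      using that colour_merge by metis
    then show ?thesis using False collapses_at_zero by (auto simp: idm_def)
  qed
qed

lemma tl_sum:
  assumes "finite S" "\<And>s. s \<in> S \<Longrightarrow> tl_span k m (D s) (c s)"
  shows "tl_span k m (\<lambda>x y. \<Sum>s\<in>S. D s x y) (\<Sum>s\<in>S. c s)"
  using assms
proof (induction S rule: finite_induct)
  case empty
  then show ?case using tl_zero by (simp add: zero_mat_def)
next
  case (insert s S)
  then have "tl_span k m (madd (D s) (\<lambda>x y. \<Sum>s\<in>S. D s x y)) (c s + (\<Sum>s\<in>S. c s))"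
    by (intro tl_add) auto
  then show ?case using insert by (simp add: madd_def)
qed

text \<open>The product is a sum over intermediate colour patterns of products of Temperley-Lieb
  elements. Coefficient sums are additive and multiplicative, so they follow the matrix product on
  the ADO_3 side.\<close>

lemma collapses_mm:
  assumes "collapses n M N" "collapses n M' N'"
  shows "collapses n (mm n M M') (mm n N N')"
  unfolding collapses_def
proof (intro ballI)
  fix p q :: "ado_basis list" assume pq: "p \<in> words n" "q \<in> words n"
  have "\<forall>s\<in>words n. collapses_at p s M (N p s)" and 2: "\<forall>s\<in>words n. collapses_at s q M' (N' s q)"
    using assms pq unfolding collapses_def by blast+
  then obtain D where D: "\<And>s. s \<in> words n \<Longrightarrow> tl_span (mids p) (mids s) (D s) (N p s)"
      "\<And>s x y. s \<in> words n \<Longrightarrow> x \<in> words (mids p) \<Longrightarrow> y \<in> words (mids s) \<Longrightarrow> M (merge p x) (merge s y) = D s x y"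
    unfolding collapses_at_def by metis
  from 2 obtain D' where D': "\<And>s. s \<in> words n \<Longrightarrow> tl_span (mids s) (mids q) (D' s) (N' s q)"
      "\<And>s x y. s \<in> words n \<Longrightarrow> x \<in> words (mids s) \<Longrightarrow> y \<in> words (mids q) \<Longrightarrow> M' (merge s x) (merge q y) = D' s x y"
    unfolding collapses_at_def by metis
  show "collapses_at p q (mm n M M') (mm n N N' p q)"
  proof (rule collapses_atI)
    show "tl_span (mids p) (mids q) (\<lambda>x y. \<Sum>s\<in>words n. mm (mids s) (D s) (D' s) x y) (mm n N N' p q)"
      unfolding mm_def[of n N] using D(1) D'(1) by (intro tl_sum tl_mm) auto
    fix x y :: "bool list" assume xy: "length x = mids p" "length y = mids q"
    have "mm n M M' (merge p x) (merge q y)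
        = (\<Sum>s\<in>words n. \<Sum>z\<in>words (mids s). M (merge p x) (merge s z) * M' (merge s z) (merge q y))"
      unfolding mm_def by (rule sum_merge)
    also have "\<dots> = (\<Sum>s\<in>words n. mm (mids s) (D s) (D' s) x y)"
      unfolding mm_def using xy D(2) D'(2) by (intro sum.cong) auto
    finally show "mm n M M' (merge p x) (merge q y) = (\<Sum>s\<in>words n. mm (mids s) (D s) (D' s) x y)" .
  qed
qed

lemma collapses_madd: "collapses n M N \<Longrightarrow> collapses n M' N' \<Longrightarrow> collapses n (madd M M') (madd N N')"
  unfolding collapses_def madd_def[of N] by (simp add: collapses_at_add)

lemma collapses_mscale: "collapses n M N \<Longrightarrow> collapses n (mscale a M) (mscale a N)"
  unfolding collapses_def mscale_def[of a N] by (simp add: collapses_at_scale)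

lemma ado_ker_table:
  "ado_ker t p (v0, v0) = t^2 * ket (v0, v0) p"
  "ado_ker t p (v0, v1) = (t^2 - 1) * ket (v0, v1) p + t * ket (v1, v0) p"
  "ado_ker t p (v0, v2) = (t^2 - 1) * (t^2 - omega^2) / t^2 * ket (v0, v2) p
     + (omega * t + inverse t) * ket (v1, v1) p + ket (v2, v0) p"
  "ado_ker t p (v1, v0) = t * ket (v0, v1) p"
  "ado_ker t p (v1, v1) = (t - inverse t) * ket (v0, v2) p + omega^2 * ket (v1, v1) p"
  "ado_ker t p (v1, v2) = (omega^2 / t^2 - 1) * ket (v1, v2) p - omega / t * ket (v2, v1) p"
  "ado_ker t p (v2, v0) = ket (v0, v2) p"
  "ado_ker t p (v2, v1) = - omega / t * ket (v1, v2) p"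
  "ado_ker t p (v2, v2) = omega^2 / t^2 * ket (v2, v2) p"
  by (auto simp: ado_ker_def ker_of_def lookup_add lookup_single when_def ket_def)

text \<open>The blocks of the Links--Gould \<open>R\<close>-matrix between the colour patterns \<open>(c, d)\<close> and \<open>(a, b)\<close>.\<close>

definition block :: "complex \<Rightarrow> nat \<Rightarrow> ado_basis \<Rightarrow> ado_basis \<Rightarrow> ado_basis \<Rightarrow> ado_basis \<Rightarrow> bool mat" where
  "block t k a b c d = (let N = ado_flip t (a, b) (c, d) in
     if (a, b) = (v1, v1) \<and> (c, d) = (v1, v1) then
       madd (mscale (- 1) (idm (Suc (Suc k)))) (mscale omega (mm k (cup_mat k 0) (cap_mat k 0)))
     else if (a, b) = (v1, v1) then (if mids [c, d] = 0 then mscale N (cup_mat k 0) else zero_mat)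
     else if (c, d) = (v1, v1) then (if mids [a, b] = 0 then mscale N (cap_mat k 0) else zero_mat)
     else if mids [a, b] = mids [c, d] then mscale N (idm (mids [a, b] + k)) else zero_mat)"

lemma tl_mscale_1: "tl_span k m D 1 \<Longrightarrow> tl_span k m (mscale a D) a"
  using tl_scale[of k m D 1 a] by simp

text \<open>The only block with two terms is the one between middle vectors, where the coefficient
  sum \<open>- 1 + omega\<close> is the diagonal entry \<open>omega^2\<close>.\<close>

lemma tl_block:
  "tl_span (mids (a # b # p)) (mids (c # d # p)) (block t (mids p) a b c d) (ado_flip t (a, b) (c, d))"
proof -
  have 1: "tl_span (Suc (Suc k)) (Suc (Suc k)) (madd (mscale (- 1) (idm (Suc (Suc k))))
      (mscale omega (mm k (cup_mat k 0) (cap_mat k 0)))) (omega^2)" for k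
  proof -
    have "tl_span (Suc (Suc k)) (Suc (Suc k)) (mm k (cup_mat k 0) (cap_mat k 0)) (1 * 1)"
      by (intro tl_mm tl_cup tl_cap) auto
    then have "tl_span (Suc (Suc k)) (Suc (Suc k)) (madd (mscale (- 1) (idm (Suc (Suc k))))
      (mscale omega (mm k (cup_mat k 0) (cap_mat k 0)))) (- 1 + omega)"
      by (intro tl_add tl_mscale_1 tl_id) simp
    then show ?thesis by (simp add: omega_sq)
  qed
  show ?thesis
    by (cases a; cases b; cases c; cases d)
       (auto simp: block_def Let_def ado_flip_def ado_ker_table ket_def 1[simplified] tl_mscale_1 tl_id tl_cup tl_cap tl_zero
          intro: tl_zero tl_mscale_1[where a = 0, simplified])
qed

lemma cup_cap_entry:
  "length x = k \<Longrightarrow> length y = k \<Longrightarrow>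
    mm k (cup_mat k 0) (cap_mat k 0) (a # b # x) (c # d # y) = (if x = y then mu a b * nu c d else 0)"
  by (simp add: mm_cup_0) (simp add: cap_mat_def)

lemma block_entry:
  assumes "t \<noteq> 0" "length x = mids (a # b # p)" "length y = mids (c # d # p)"
  shows "gm (lg_special t) 0 (merge (a # b # p) x) (merge (c # d # p) y) = block t (mids p) a b c d x y"
proof -
  obtain u where u: "t * u = 1" using assms right_inverse by blast
  have tt: "c / (t * t) = c * (u * u)" for c
    using ado_inverse_rules(2)[OF u] by (simp add: power2_eq_square)
  have lg: "lg_special t = lg_ker t (- (omega * u)) (u - t) (- (t + (1 - omega) * u))"
    unfolding lg_special_def ado_inverse_rules[OF u] omega_inverse by simp
  show ?thesis
    using assms(2,3) unfolding lg
    by (cases a; cases b; cases c; cases d)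
       (auto simp: length_Suc_conv block_def Let_def ado_flip_def ado_ker_table ket_def ado_inverse_rules[OF u] lg_ker_def
          merge_inj idm_def cup_mat_def cap_mat_def madd_def mscale_def zero_mat_def cup_cap_entry
          algebra_simps eval_nat_numeral tt ado_norm[OF u] split: if_splits)
qed

lemma collapses_gen:
  assumes "t \<noteq> 0" "Suc i < n"
  shows "collapses n (gen_mat n (lg_special t) i) (gen_mat n (ado_flip t) i)"
proof -
  have "collapses_at p q (gm (lg_special t) i) (gm (ado_flip t) i p q)"
    if "length p = n" "length q = n" for p q
    using assms(2) that
  proof (induction i arbitrary: n p q)
    case 0
    then obtain m where n: "n = Suc (Suc m)" using length_Suc2 by blast
    then obtain a b p' c d q' where pq: "p = a # b # p'" "q = c # d # q'" "length p' = m" "length q' = m"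
      using 0 by (metis length_Suc_conv)
    show ?case
    proof (cases "p' = q'")
      case True
      then show ?thesis
        using tl_block[of a b p' c d t] block_entry[OF assms(1)] pq
        by (intro collapses_atI[of _ _ "block t (mids p') a b c d"]) auto
    next
      case False
      have "gm (lg_special t) 0 (merge p x) (merge q y) = 0" if lx: "length x = mids p" and ly: "length y = mids q" for x y
      proof (rule ccontr)
        assume *: "gm (lg_special t) 0 (merge p x) (merge q y) \<noteq> 0"
        obtain a' b' I' where I: "merge p x = a' # b' # I'"
          using length_merge[OF lx] pq by (metis length_Suc_conv)
        obtain c' d' J' where J: "merge q y = c' # d' # J'"
          using length_merge[OF ly] pq by (metis length_Suc_conv)
        have "I' = J'" using * I J by (auto split: if_splits)
        moreover have "map colour I' = p'" "map colour J' = q'"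
          using colour_merge[OF lx] colour_merge[OF ly] I J pq by auto
        ultimately show False using False by simp
      qed
      then show ?thesis using False pq collapses_at_zero by auto
    qed
  next
    case (Suc i)
    then obtain m where n: "n = Suc m" by (cases n) auto
    then obtain a p' c q' where pq: "p = a # p'" "q = c # q'" "length p' = m" "length q' = m"
      using Suc.prems by (metis length_Suc_conv)
    have "collapses_at p' q' (gm (lg_special t) i) (gm (ado_flip t) i p' q')"
      using Suc.IH[of m p' q'] Suc.prems n pq by auto
    then obtain D where D: "tl_span (mids p') (mids q') D (gm (ado_flip t) i p' q')"
      "\<And>x y. length x = mids p' \<Longrightarrow> length y = mids q' \<Longrightarrow> gm (lg_special t) i (merge p' x) (merge q' y) = D x y"
      by (rule collapses_atE) blast
    show ?case
    proof (cases "a = c")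
      case True
      \<comment> \<open>Only the letter \<open>v1\<close> carries a Temperley-Lieb strand, on which
        the generator is the identity; for \<open>v0\<close> and \<open>v2\<close> the same
        \<open>D\<close> serves.\<close>
      show ?thesis
      proof (cases a)
        case v1
        have "gm (lg_special t) (Suc i) (merge p x) (merge q y) = sh D x y"
          if xy: "length x = mids p" "length y = mids q" for x y
        proof -
          obtain b x' d y' where "x = b # x'" "y = d # y'" "length x' = mids p'" "length y' = mids q'"
            using xy pq v1 True by (auto simp: length_Suc_conv)
          then show ?thesis using D(2) pq v1 True by auto
        qed
        then show ?thesis using tl_sh[OF D(1)] pq v1 True by (intro collapses_atI[of _ _ "sh D"]) auto
      qed (use D pq True in \<open>auto intro: collapses_atI[of _ _ D]\<close>)
    next
      case False
      have "gm (lg_special t) (Suc i) (merge p x) (merge q y) = 0" if lx: "length x = mids p" and ly: "length y = mids q" for x y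
      proof -
        obtain a' I' where I: "merge p x = a' # I'"
          using length_merge[OF lx] pq by (metis length_Suc_conv)
        obtain c' J' where J: "merge q y = c' # J'"
          using length_merge[OF ly] pq by (metis length_Suc_conv)
        have "colour a' = a" "colour c' = c"
          using colour_merge[OF lx] colour_merge[OF ly] I J pq by auto
        then show ?thesis using False I J by auto
      qed
      then show ?thesis using False pq collapses_at_zero by auto
    qed
  qed
  then show ?thesis
    unfolding collapses_def collapses_at_def by (auto simp: gen_mat_def length_merge)
qed

lemma collapses_letter:
  assumes "t \<noteq> 0" "1 \<le> letter_index l" "letter_index l \<le> n - 1"
  shows "collapses n (letter_mat n (lg_special t) (kinv (t^2) (omega^2 / t^2) (lg_special t)) l)
     (letter_mat n (ado_flip t) (kinv (t^2) (omega^2 / t^2) (ado_flip t)) l)"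
proof -
  have i: "Suc (letter_index l - 1) < n" using assms by linarith
  note G = collapses_gen[OF assms(1) i]
  show ?thesis
    using i G by (cases l) (auto simp: gen_mat_kinv
      intro!: collapses_mscale collapses_madd collapses_mm collapses_idm)
qed

lemma collapses_braid:
  assumes "t \<noteq> 0" "\<beta> \<in> braid_words n"
  shows "collapses n (braid_mat n (lg_special t) (kinv (t^2) (omega^2 / t^2) (lg_special t)) \<beta>)
     (braid_mat n (ado_flip t) (kinv (t^2) (omega^2 / t^2) (ado_flip t)) \<beta>)"
  using assms(2)
proof (induction rule: braid_words_induct)
  case (Cons l \<beta>)
  then show ?case using Cons.IH collapses_letter[OF assms(1)] by (auto intro: collapses_mm)
qed (simp add: collapses_idm)

abbreviation ado_g :: "complex \<Rightarrow> ado_basis \<Rightarrow> complex" where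
  "ado_g t \<equiv> \<lambda>a. inverse (ado_h t a)"

text \<open>The eigenvalues \<open>-t\<^sub>1\<close>, \<open>-t\<^sub>0\<^sup>-\<^sup>1\<close> of \<open>h\<close> on the middle vectors are \<open>\<omega>, \<omega>\<^sup>-\<^sup>1\<close> up to
  the common factor \<open>\<omega>\<^sup>4 t\<^sup>-\<^sup>2\<close>.\<close>

lemma lg_h_merge:
  assumes "t \<noteq> 0" "length x = mids p"
  shows "wprod (lg_h (t^2) (omega^2 / t^2)) (merge p x)
       = wprod kap x * wprod (ado_g t) p"
proof -
  obtain u where u: "t * u = 1" using assms right_inverse by blast
  have w2: "(1 - omega)^2 = - omega" using omega_sq by (simp add: power2_diff)
  have w4: "(1 - omega)^4 = omega^2" using power_mult[of "1 - omega" 2 2] by (simp add: w2)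
  have h: "lg_h (t^2) (omega^2 / t^2) e0 = inverse (ado_h t v0)"
    "lg_h (t^2) (omega^2 / t^2) e3 = inverse (ado_h t v2)"
    "lg_h (t^2) (omega^2 / t^2) e1 = kap True * inverse (ado_h t v1)"
    "lg_h (t^2) (omega^2 / t^2) e2 = kap False * inverse (ado_h t v1)"
    by (simp_all only: lg_h.simps ado_h.simps kap.simps inverse_mult_distrib ado_inverse_rules[OF u]
      power_inverse[symmetric] omega_inverse w2 w4)
       (simp_all add: power2_eq_square omega_mult omega_mult_left algebra_simps)
  show ?thesis
    using assms(2) by (induction p x rule: merge.induct) (auto simp: h simp del: lg_h.simps ado_h.simps kap.simps)
qed

text \<open>The open strand carries \<open>e0\<close>, which has no bit. For a fixed colour pattern
  the sum over the bits is therefore a full Temperley-Lieb trace, which returns the coefficient sum;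
  \<open>lg_h_merge\<close> splits the weights accordingly.\<close>

lemma collapsed_trace:
  assumes "t \<noteq> 0" "collapses (Suc n) M N"
  shows "(\<Sum>K\<in>words n. wprod (lg_h (t^2) (omega^2 / t^2)) K * M (e0 # K) (e0 # K))
       = (\<Sum>p\<in>words n. wprod (ado_g t) p * N (v0 # p) (v0 # p))"
proof -
  have "(\<Sum>x\<in>words (mids p). wprod kap x * M (e0 # merge p x) (e0 # merge p x)) = N (v0 # p) (v0 # p)"
    if "p \<in> words n" for p
  proof -
    have "collapses_at (v0 # p) (v0 # p) M (N (v0 # p) (v0 # p))"
      using assms(2) \<open>p \<in> words n\<close> unfolding collapses_def by simp
    then obtain D where D: "tl_span (mids (v0 # p)) (mids (v0 # p)) D (N (v0 # p) (v0 # p))"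
      "\<And>x y. length x = mids (v0 # p) \<Longrightarrow> length y = mids (v0 # p) \<Longrightarrow> M (merge (v0 # p) x) (merge (v0 # p) y) = D x y"
      by (rule collapses_atE) blast
    show ?thesis using tl_span_trace[OF D(1)] D(2) by (simp add: tl_trace_def)
  qed
  then have *: "(\<Sum>x\<in>words (mids p). c * (wprod kap x * M (e0 # merge p x) (e0 # merge p x)))
      = c * N (v0 # p) (v0 # p)" if "p \<in> words n" for p c
    using that by (simp flip: sum_distrib_left)
  show ?thesis
    unfolding sum_merge
  proof (intro sum.cong refl)
    fix p :: "ado_basis list" assume p: "p \<in> words n"
    show "(\<Sum>x\<in>words (mids p). wprod (lg_h (t^2) (omega^2 / t^2)) (merge p x) * M (e0 # merge p x) (e0 # merge p x))
        = wprod (ado_g t) p * N (v0 # p) (v0 # p)"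
      unfolding *[OF p, symmetric] by (intro sum.cong) (auto simp: lg_h_merge[OF assms(1)])
  qed
qed

section \<open>Moving the open strand in \<open>ADO\<^sub>3\<close>\<close>

definition ado_class :: "complex \<Rightarrow> nat \<Rightarrow> ado_basis mat set" where
  "ado_class t n = {M. conserves ado_wt M \<and> commutes n (prim ado_E (ado_k t)) M
      \<and> commutes n (prim (ado_F t) (ado_k t)) M}"

lemma omega_powers: "omega^3 = - 1" "omega^4 = - omega" "omega^6 = 1"
proof -
  show 3: "omega^3 = - 1" by (simp add: eval_nat_numeral omega_mult omega_mult_left algebra_simps)
  show "omega^4 = - omega" using 3 by (simp add: eval_nat_numeral)
  show "omega^6 = 1" using 3 power_mult[of omega 3 2] by simp
qed

text \<open>A constant product serves both closures: \<open>k h\<close> commutes with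
  \<open>E\<close> and \<open>F\<close>, and with \<open>g\<close> the inverse of \<open>h\<close>
  the quotient \<open>g / k\<close> is constant too.\<close>

lemma ado_h_k: "ado_k t a * ado_h t a = t^3"
  by (cases a) (simp_all add: eval_nat_numeral omega_mult omega_mult_left algebra_simps)

lemma ado_k_nz: "t \<noteq> 0 \<Longrightarrow> ado_k t a \<noteq> 0"
  by (cases a) auto

lemma ado_k_wt: "ado_k t a = t * (omega^4) ^ fst (ado_wt a)"
proof -
  have "omega^2 = (omega^4)^2" using omega_powers(3) by (simp add: eval_nat_numeral)
  then show ?thesis by (cases a) simp_all
qed

lemma prod_ado_k: "wprod (ado_k t) I = t ^ length I * (omega^4) ^ fst (wsum ado_wt I)"
  by (induction I) (simp_all add: ado_k_wt power_add)

text \<open>Commutation with \<open>E\<close> and \<open>F\<close> gives linear relations between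
  the entries of \<open>M\<close> within the first three weight spaces. They express every entry
  needed through \<open>M [v0, b] [v0, b]\<close> for the three basis vectors \<open>b\<close>, and
  in these terms both traces can be computed.\<close>

lemma ado_ambidextrous_2:
  assumes t: "t \<noteq> 0" "t^2 \<noteq> 1" "t^2 \<noteq> omega^2" and M: "M \<in> ado_class t (Suc (Suc 0))"
  shows "rtr (ado_h t) M [v0] [v0] = ltr (ado_g t) M [v0] [v0]"
proof -
  obtain u where u: "t * u = 1" using assms right_inverse by blast
  have z: "M [a, b] [c, d] = 0" if "ado_wt a + ado_wt b \<noteq> ado_wt c + ado_wt d" for a b c d
    using M that by (force simp: ado_class_def conserves_def)
  have E: "mm (Suc (Suc 0)) M (prim ado_E (ado_k t)) [a, b] [c, d] = mm (Suc (Suc 0)) (prim ado_E (ado_k t)) M [a, b] [c, d]"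
    and F: "mm (Suc (Suc 0)) M (prim (ado_F t) (ado_k t)) [a, b] [c, d] = mm (Suc (Suc 0)) (prim (ado_F t) (ado_k t)) M [a, b] [c, d]"
    for a b c d using M by (auto simp: ado_class_def intro: commutesD)
  let ?f1 = "t^2 - 1" and ?f2 = "omega^4 - omega^2 * t^2"
  note expand = mm_def sum_words_Suc UNIV_ado z
  have f2: "?f2 \<noteq> 0"
  proof
    assume "?f2 = 0"
    then have "omega^2 * (omega^2 - t^2) = 0" by (simp add: algebra_simps flip: power_add)
    then show False using t by simp
  qed
  have e1: "M [v0, v1] [v1, v0] + t * M [v0, v1] [v0, v1] = t * M [v0, v0] [v0, v0]"
    using E[of v0 v1 v0 v0] by (simp add: expand algebra_simps)
  have "?f1 * (M [v1, v0] [v1, v0] + t * M [v0, v1] [v1, v0]) = ?f1 * M [v0, v0] [v0, v0]"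
    using F[of v0 v0 v1 v0] by (simp add: expand algebra_simps)
  then have e2: "M [v1, v0] [v1, v0] + t * M [v0, v1] [v1, v0] = M [v0, v0] [v0, v0]"
    using t(2) by simp
  have e3: "?f2 * M [v2, v0] [v2, v0] + t * omega^4 * ?f1 * M [v1, v1] [v2, v0] = ?f2 * M [v1, v0] [v1, v0]"
    using F[of v1 v0 v2 v0] by (simp add: expand algebra_simps)
  have e4: "?f1 * M [v1, v1] [v2, v0] + t * ?f2 * M [v0, v2] [v2, v0] = ?f2 * M [v0, v1] [v1, v0]"
    using F[of v0 v1 v2 v0] by (simp add: expand algebra_simps)
  have "omega^4 * (M [v0, v2] [v2, v0] + t * M [v0, v2] [v1, v1]) = omega^4 * (t * M [v0, v1] [v1, v0])"
    using E[of v0 v2 v1 v0] by (simp add: expand algebra_simps)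
  then have e5: "M [v0, v2] [v2, v0] + t * M [v0, v2] [v1, v1] = t * M [v0, v1] [v1, v0]"
    by simp
  have e6: "M [v0, v2] [v1, v1] + t * omega^4 * M [v0, v2] [v0, v2] = t * omega^4 * M [v0, v1] [v0, v1]"
    using E[of v0 v2 v0 v1] by (simp add: expand algebra_simps)
  \<comment> \<open>The entry \<open>M [v1, v1] [v2, v0]\<close> is eliminated between
    \<open>e3\<close> and \<open>e4\<close>; the common factor \<open>?f2\<close> is cancelled
    afterwards.\<close>
  have "?f2 * (M [v2, v0] [v2, v0] + t * omega^4 * M [v0, v1] [v1, v0]) = ?f2 * (M [v1, v0] [v1, v0] + t^2 * omega^4 * M [v0, v2] [v2, v0])"
    using e3 e4 by algebra
  then have e7: "M [v2, v0] [v2, v0] + t * omega^4 * M [v0, v1] [v1, v0] = M [v1, v0] [v1, v0] + t^2 * omega^4 * M [v0, v2] [v2, v0]"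
    using f2 by simp
  \<comment> \<open>Solving the relations for \<open>b\<close>, \<open>d\<close>, \<open>q\<close>,
    \<open>r\<close>, \<open>x\<close> leaves a polynomial identity in \<open>a\<close>,
    \<open>a1\<close>, \<open>z\<close> modulo \<open>t * u = 1\<close> and the equation for
    \<open>omega\<close>.\<close>
  have *: "t^2 * a + t^2 * omega^2 * a1 + t^2 * omega^4 * z = u^2 * a + u^2 * omega^4 * d + u^2 * omega^2 * x"
    if 1: "b + t * a1 = t * a" and 2: "d + t * b = a" and 5: "q + t * r = t * b" 
      and 6: "r + t * omega^4 * z = t * omega^4 * a1" and 7: "x + t * omega^4 * b = d + t^2 * omega^4 * q"
    for a a1 b d q r x z
  proof -
    have w: "omega^4 = - omega" by (rule omega_powers)
    have b: "b = t * a - t * a1" using 1 by (simp add: eq_diff_eq)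
    have d: "d = a - t * b" using 2 by (simp add: eq_diff_eq)
    have q: "q = t * b - t * r" using 5 by (simp add: eq_diff_eq)
    have r: "r = t * omega * z - t * omega * a1" using 6 w by algebra
    have x: "x = d + t * omega * b - t^2 * omega * q" using 7 w by algebra
    show ?thesis unfolding x q r d b w
      by (simp add: algebra_simps eval_nat_numeral ado_norm[OF u])
  qed
  have inv: "inverse (ado_h t v0) = u^2" "inverse (ado_h t v1) = u^2 * omega^4" "inverse (ado_h t v2) = u^2 * omega^2"
  proof -
    have tu: "t^2 * u^2 = 1" using u by (simp flip: power_mult_distrib)
    show "inverse (ado_h t v0) = u^2" using tu by (simp add: inverse_unique)
    have ww: "omega^2 * omega^4 = 1" using omega_powers(3) by (simp flip: power_add)
    have "t^2 * omega^2 * (u^2 * omega^4) = t^2 * u^2 * (omega^2 * omega^4)" by (simp only: ac_simps)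
    then have "t^2 * omega^2 * (u^2 * omega^4) = 1" unfolding tu ww by simp
    then show "inverse (ado_h t v1) = u^2 * omega^4" unfolding ado_h.simps by (rule inverse_unique)
    have "t^2 * omega^4 * (u^2 * omega^2) = t^2 * u^2 * (omega^2 * omega^4)" by (simp only: ac_simps)
    then have "t^2 * omega^4 * (u^2 * omega^2) = 1" unfolding tu ww by simp
    then show "inverse (ado_h t v2) = u^2 * omega^2" unfolding ado_h.simps by (rule inverse_unique)
  qed
  show ?thesis
    using *[OF e1 e2 e5 e6 e7] by (simp add: rtr_def ltr_def UNIV_ado inv del: ado_h.simps) (simp add: algebra_simps)
qed

lemma ambidextrous_ado:
  assumes t: "t \<noteq> 0" "t^2 \<noteq> 1" "t^2 \<noteq> omega^2"
  shows "ambidextrous (ado_class t) (ado_h t) (ado_g t) v0"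
proof
  have kh: "ado_k t b * ado_h t b = ado_k t c * ado_h t c" for b c by (simp add: ado_h_k)
  have gk: "inverse (ado_h t b) / ado_k t b = inverse (ado_h t c) / ado_k t c" for b c
    using ado_h_k[of t] by (metis divide_inverse inverse_mult_distrib mult.commute)
  have kl: "wprod (ado_k t) I = wprod (ado_k t) J"
    if "length I = length J" "wsum ado_wt I = wsum ado_wt J" for I J
    using that by (simp add: prod_ado_k)
  show "rtr (ado_h t) M \<in> ado_class t (Suc n)" if "M \<in> ado_class t (Suc (Suc n))" for M n
    using that kh kl ado_k_nz[OF t(1)] unfolding ado_class_def
    by (auto intro!: conserves_rtr commutes_rtr[where wt = ado_wt])
  show "ltr (ado_g t) M \<in> ado_class t (Suc n)" if "M \<in> ado_class t (Suc (Suc n))" for M n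
    using that gk ado_k_nz[OF t(1)] unfolding ado_class_def
    by (auto intro!: conserves_ltr commutes_ltr)
  show "mm n A B \<in> ado_class t n" if "A \<in> ado_class t n" "B \<in> ado_class t n" for A B n
    using that by (auto simp: ado_class_def intro: conserves_mm commutes_mm)
qed (rule ado_ambidextrous_2[OF t])

lemma ado_class_gen:
  assumes "t \<noteq> 0" "Suc i < n"
  shows "gen_mat n (ado_ker t) i \<in> ado_class t n"
proof -
  have "omega^4 * omega^4 = omega^2" using omega_powers(3) by (simp add: eval_nat_numeral)
  then have "ado_k t v1 * ado_k t v1 = ado_k t v0 * ado_k t v2"
    by (simp add: algebra_simps)
  then have kk: "ado_ker t (a, b) (c, d) \<noteq> 0 \<Longrightarrow> ado_k t a * ado_k t b = ado_k t c * ado_k t d" for a b c d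
    by (rule ado_ker_mult)
  show ?thesis
    using assms ado_ker_wt unfolding ado_class_def
    by (auto intro!: conserves_gen commutes_gen ado_E_commutes ado_F_commutes kk)
qed

lemma ado_class_closed:
  "idm n \<in> ado_class t n"
  "A \<in> ado_class t n \<Longrightarrow> B \<in> ado_class t n \<Longrightarrow> mm n A B \<in> ado_class t n"
  "A \<in> ado_class t n \<Longrightarrow> B \<in> ado_class t n \<Longrightarrow> madd A B \<in> ado_class t n"
  "A \<in> ado_class t n \<Longrightarrow> mscale c A \<in> ado_class t n"
  by (auto simp: ado_class_def intro: conserves_idm commutes_idm conserves_mm commutes_mm
      conserves_madd commutes_madd conserves_mscale commutes_mscale)

abbreviation ado_inv :: "complex \<Rightarrow> ado_basis kernel" where
  "ado_inv t \<equiv> kinv (t^2) (omega^2 / t^2) (ado_ker t)"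

abbreviation ado_braid :: "nat \<Rightarrow> complex \<Rightarrow> braid_word \<Rightarrow> ado_basis mat" where
  "ado_braid n t \<equiv> braid_mat n (ado_ker t) (ado_inv t)"

lemma ado_class_inv:
  assumes "t \<noteq> 0" "Suc i < n"
  shows "gen_mat n (ado_inv t) i \<in> ado_class t n"
  unfolding gen_mat_kinv[OF assms(2)] by (intro ado_class_closed ado_class_gen assms)

lemma ado_class_braid:
  assumes "t \<noteq> 0" "\<beta> \<in> braid_words n"
  shows "ado_braid n t \<beta> \<in> ado_class t n"
  by (rule braid_mat_closed[where P = "\<lambda>M. M \<in> ado_class t n", OF assms(2)])
     (intro ado_class_closed ado_class_gen assms | assumption)+

section \<open>Conjugation by the half twist\<close>

text \<open>The generators are maps applied to an argument, so that a braid relation rewrites a word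
  whatever follows it. \<open>D\<close> is the half twist on five strands, factored as
  \<open>(abcd)(abc)(ab)a\<close>.\<close>

lemma half_twist:
  fixes a b c d :: "'x \<Rightarrow> 'x"
  assumes ab: "\<And>x. a (b (a x)) = b (a (b x))" and bc: "\<And>x. b (c (b x)) = c (b (c x))"
    and cd: "\<And>x. c (d (c x)) = d (c (d x))"
    and ac: "\<And>x. c (a x) = a (c x)" and ad: "\<And>x. d (a x) = a (d x)" and bd: "\<And>x. d (b x) = b (d x)"
  defines "D \<equiv> \<lambda>x. a (b (c (d (a (b (c (a (b (a x)))))))))"
  shows "D (a x) = d (D x)" "D (b x) = c (D x)" "D (c x) = b (D x)" "D (d x) = a (D x)"
proof -
  \<comment> \<open>Moving a generator to the left through \<open>abc\<close> or \<open>abcd\<close>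
    replaces it by the next one.\<close>
  have x3a: "a (b (c (a y))) = b (a (b (c y)))" and x3b: "a (b (c (b y))) = c (a (b (c y)))" for y
    by (simp_all only: ac ab bc)
  have x4a: "a (b (c (d (a y)))) = b (a (b (c (d y))))" and x4b: "a (b (c (d (b y)))) = c (a (b (c (d y))))" for y
    by (simp_all only: ad bd x3a x3b)
  have x4c: "a (b (c (d (c y)))) = d (a (b (c (d y))))" for y
    by (simp only: cd ad bd)
  \<comment> \<open>The half twist \<open>(abc)(ab)a\<close> of the first four strands turns
    \<open>c\<close> into \<open>a\<close>.\<close>
  have twist4: "a (b (c (a (b (a (c y)))))) = a (a (b (c (a (b (a y))))))" for y
  proof -
    have "a (b (c (a (b (a (c y)))))) = a (b (a (c (b (c (a y))))))" by (simp only: ac[symmetric])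
    also have "\<dots> = a (b (a (b (c (b (a y))))))" by (simp only: bc[of "a y"])
    also have "\<dots> = a (a (b (a (c (b (a y))))))" by (simp only: ab[of "c (b (a y))"])
    finally show ?thesis by (simp only: ac)
  qed
  \<comment> \<open>A second factorisation: the half twist on four strands times
    \<open>dcba\<close>. The generator \<open>d\<close> becomes \<open>c\<close> on passing
    \<open>dcba\<close> and then \<open>a\<close> by \<open>twist4\<close>.\<close>
  have D: "D y = a (b (c (a (b (a (d (c (b (a y)))))))))" for y
    unfolding D_def by (simp only: ad bd ac)
  show "D (a x) = d (D x)"
    unfolding D_def ab[of "a x"] x3b[of "a (b (a x))"] x4c ..
  show "D (b x) = c (D x)"
    unfolding D_def ab[of x, symmetric] x3a[of "a (b (a x))"] x4b ..
  show "D (c x) = b (D x)"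
    unfolding D_def twist4 x4a[of "a (b (c (a (b (a x)))))"] ..
  have "d (c (b (a (d x)))) = d (c (d (b (a x))))" by (simp only: ad bd)
  then have "d (c (b (a (d x)))) = c (d (c (b (a x))))" by (simp only: cd)
  then show "D (d x) = a (D x)"
    unfolding D by (simp only: twist4)
qed

text \<open>This substitution arises twice: from conjugation by the half twist and from reversing
  the order of the tensor factors.\<close>

definition flip_letter :: "nat \<Rightarrow> letter \<Rightarrow> letter" where
  "flip_letter n l = (case l of Gen i \<Rightarrow> Gen (n - i) | GenInv i \<Rightarrow> GenInv (n - i))"

lemma flip_braid_words: "\<beta> \<in> braid_words n \<Longrightarrow> map (flip_letter n) \<beta> \<in> braid_words n"
  unfolding braid_words_def
proof (clarsimp simp: flip_letter_def split: letter.splits)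
  fix l assume "\<forall>l\<in>set \<beta>. Suc 0 \<le> letter_index l \<and> letter_index l \<le> n - Suc 0" "l \<in> set \<beta>"
  then have "Suc 0 \<le> letter_index l \<and> letter_index l \<le> n - Suc 0" by blast
  then show "(\<forall>i. l = Gen i \<longrightarrow> Suc 0 \<le> n - i \<and> n - i \<le> n - Suc 0)
      \<and> (\<forall>i. l = GenInv i \<longrightarrow> Suc 0 \<le> n - i \<and> n - i \<le> n - Suc 0)" by auto
qed

context
  fixes t :: complex
  assumes t: "t \<noteq> 0" "t^2 \<noteq> 1" "t^2 \<noteq> omega^2"
begin

interpretation ambidextrous "ado_class t" "ado_h t" "ado_g t" v0
  by (rule ambidextrous_ado[OF t])

definition "ado_gen = gen_mat 5 (ado_ker t)"
definition "ado_gen_inv = gen_mat 5 (ado_inv t)"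

lemma ado_gen_inverse: "i < 4 \<Longrightarrow> mm 5 (ado_gen i) (ado_gen_inv i) = idm 5" "i < 4 \<Longrightarrow> mm 5 (ado_gen_inv i) (ado_gen i) = idm 5"
  using kmul_kinv[OF cubic_ado[OF t(1)]] by (auto simp: ado_gen_def ado_gen_inv_def gen_mat_kmul gen_mat_kid)

lemma ado_gen_class: "i < 4 \<Longrightarrow> ado_gen i \<in> ado_class t 5" "i < 4 \<Longrightarrow> ado_gen_inv i \<in> ado_class t 5"
  by (auto simp: ado_gen_def ado_gen_inv_def intro!: ado_class_gen ado_class_inv t)

lemma supp_ado_gen [simp]: "mat_supp 5 5 (ado_gen i)" "mat_supp 5 5 (ado_gen_inv i)"
  by (simp_all add: ado_gen_def ado_gen_inv_def)

lemma open_trace_conj: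
  assumes "M \<in> ado_class t 5" "mat_supp 5 5 M" "i < 4"
  shows "open_trace 4 (mm 5 (ado_gen i) (mm 5 M (ado_gen_inv i))) = open_trace 4 M"
proof -
  have hh: "ado_h t v1 * ado_h t v1 = ado_h t v0 * ado_h t v2"
    by (simp add: algebra_simps flip: power_add)
  have 5: "5 = Suc 4" by simp
  have "open_trace 4 (mm 5 (ado_gen i) (mm 5 M (ado_gen_inv i))) = open_trace 4 (mm 5 (mm 5 M (ado_gen_inv i)) (ado_gen i))"
    unfolding ado_gen_def 5
  proof (rule open_trace_gen)
    show "mm (Suc 4) M (ado_gen_inv i) \<in> ado_class t (Suc 4)"
      using ado_class_closed(2)[OF assms(1) ado_gen_class(2)[OF assms(3)]] by simp
    show "gen_mat (Suc 4) (ado_ker t) i \<in> ado_class t (Suc 4)"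
      using ado_gen_class(1)[OF assms(3)] by (simp add: ado_gen_def)
    show "ado_h t a * ado_h t b = ado_h t c * ado_h t d" if "ado_ker t (a, b) (c, d) \<noteq> 0" for a b c d
      using ado_ker_mult[of "ado_h t", OF hh that] .
    show "inverse (ado_h t a) * inverse (ado_h t b) = inverse (ado_h t c) * inverse (ado_h t d)"
      if "ado_ker t (a, b) (c, d) \<noteq> 0" for a b c d
      using ado_ker_mult[of "ado_h t", OF hh that] by (simp flip: inverse_mult_distrib)
  qed (use assms in auto)
  then show ?thesis
    using assms by (simp add: mm_assoc ado_gen_inverse mm_idm_right)
qed

fun twist_word :: "nat list \<Rightarrow> ado_basis mat" where
  "twist_word [] = idm 5"
| "twist_word (i # w) = mm 5 (ado_gen i) (twist_word w)"

lemma supp_twist [simp]: "mat_supp 5 5 (twist_word w)"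
  by (induction w) auto

text \<open>The trace property is known for single generators, so conjugation by a word is done
  letter by letter. The inverse \<open>V\<close> of the word is built along the way, together with
  membership of the conjugates in the class, which the next letter requires.\<close>

lemma open_trace_conj_word:
  assumes "set w \<subseteq> {..<4}" "mm 5 (twist_word w) M = mm 5 N (twist_word w)"
    "M \<in> ado_class t 5" "mat_supp 5 5 M" "N \<in> ado_class t 5" "mat_supp 5 5 N"
  shows "open_trace 4 M = open_trace 4 N"
proof -
  have "\<exists>V. mat_supp 5 5 V \<and> mm 5 (twist_word w) V = idm 5 \<and>
      (\<forall>M\<in>ado_class t 5. mat_supp 5 5 M \<longrightarrow> mm 5 (twist_word w) (mm 5 M V) \<in> ado_class t 5 \<and>
          open_trace 4 (mm 5 (twist_word w) (mm 5 M V)) = open_trace 4 M)"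
    using assms(1)
  proof (induction w)
    case Nil
    then show ?case by (intro exI[of _ "idm 5"]) (auto simp: mm_idm_left[of 5 5] mm_idm_right)
  next
    case (Cons i w)
    then obtain V where V: "mat_supp 5 5 V" "mm 5 (twist_word w) V = idm 5"
      "\<And>M. M \<in> ado_class t 5 \<Longrightarrow> mat_supp 5 5 M \<Longrightarrow> mm 5 (twist_word w) (mm 5 M V) \<in> ado_class t 5"
      "\<And>M. M \<in> ado_class t 5 \<Longrightarrow> mat_supp 5 5 M \<Longrightarrow> open_trace 4 (mm 5 (twist_word w) (mm 5 M V)) = open_trace 4 M"
      by auto
    have i: "i < 4" using Cons.prems by simp
    have eq: "mm 5 (twist_word (i # w)) (mm 5 M (mm 5 V (ado_gen_inv i)))
        = mm 5 (ado_gen i) (mm 5 (mm 5 (twist_word w) (mm 5 M V)) (ado_gen_inv i))" for M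
      by (simp add: mm_assoc)
    have "mm 5 (twist_word (i # w)) (mm 5 V (ado_gen_inv i)) = mm 5 (ado_gen i) (mm 5 (mm 5 (twist_word w) V) (ado_gen_inv i))"
      by (simp add: mm_assoc)
    also have "\<dots> = idm 5" using i by (simp add: V mm_idm_left[OF supp_ado_gen(2)] ado_gen_inverse)
    finally have inv: "mm 5 (twist_word (i # w)) (mm 5 V (ado_gen_inv i)) = idm 5" .
    have "mm 5 (twist_word (i # w)) (mm 5 M (mm 5 V (ado_gen_inv i))) \<in> ado_class t 5 \<and>
        open_trace 4 (mm 5 (twist_word (i # w)) (mm 5 M (mm 5 V (ado_gen_inv i)))) = open_trace 4 M"
      if M: "M \<in> ado_class t 5" "mat_supp 5 5 M" for M
    proof -
      have s: "mat_supp 5 5 (mm 5 (twist_word w) (mm 5 M V))" using M V by simp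
      show ?thesis
        unfolding eq using open_trace_conj[OF V(3)[OF M] s i] V(4)[OF M]
          ado_class_closed(2)[OF ado_gen_class(1)[OF i] ado_class_closed(2)[OF V(3)[OF M] ado_gen_class(2)[OF i]]]
        by simp
    qed
    then show ?case
      using inv V(1) by (intro exI[of _ "mm 5 V (ado_gen_inv i)"]) (auto simp del: twist_word.simps)
  qed
  then obtain V where V: "mat_supp 5 5 V" "mm 5 (twist_word w) V = idm 5"
    "open_trace 4 (mm 5 (twist_word w) (mm 5 M V)) = open_trace 4 M"
    using assms by blast
  have "mm 5 (twist_word w) (mm 5 M V) = mm 5 N (mm 5 (twist_word w) V)"
    using assms(2) by (metis mm_assoc)
  also have "\<dots> = N" using assms by (simp add: V mm_idm_right)
  finally show ?thesis using V(3) by simp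
qed

definition "half_twist_mat = twist_word [0, 1, 2, 3, 0, 1, 2, 0, 1, 0]"

lemma half_twist_gen:
  assumes "i < 4" shows "mm 5 half_twist_mat (ado_gen i) = mm 5 (ado_gen (3 - i)) half_twist_mat"
proof -
  have Y: "yang_baxter (ado_ker t)" by (rule yang_baxter_ado[OF t(1)])
  have b: "mm 5 (ado_gen i) (mm 5 (ado_gen (Suc i)) (mm 5 (ado_gen i) X)) = mm 5 (ado_gen (Suc i)) (mm 5 (ado_gen i) (mm 5 (ado_gen (Suc i)) X))"
    if "i < 3" for i X
    using braid_relation[OF Y, of i 5] that by (simp add: ado_gen_def flip: mm_assoc)
  have f: "mm 5 (ado_gen j) (mm 5 (ado_gen i) X) = mm 5 (ado_gen i) (mm 5 (ado_gen j) X)" if "Suc i < j" "j < 4" for i j X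
    using far_commutation[of i j 5 "ado_ker t"] that by (simp add: ado_gen_def flip: mm_assoc)
  have ab: "mm 5 (ado_gen 0) (mm 5 (ado_gen 1) (mm 5 (ado_gen 0) X)) = mm 5 (ado_gen 1) (mm 5 (ado_gen 0) (mm 5 (ado_gen 1) X))"
    and bc: "mm 5 (ado_gen 1) (mm 5 (ado_gen 2) (mm 5 (ado_gen 1) X)) = mm 5 (ado_gen 2) (mm 5 (ado_gen 1) (mm 5 (ado_gen 2) X))"
    and cd: "mm 5 (ado_gen 2) (mm 5 (ado_gen 3) (mm 5 (ado_gen 2) X)) = mm 5 (ado_gen 3) (mm 5 (ado_gen 2) (mm 5 (ado_gen 3) X))" for X
    using b[of 0 X] b[of 1 X] b[of 2 X] by (simp_all add: numeral_2_eq_2 numeral_3_eq_3)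
  have ac: "mm 5 (ado_gen 2) (mm 5 (ado_gen 0) X) = mm 5 (ado_gen 0) (mm 5 (ado_gen 2) X)"
    and ad: "mm 5 (ado_gen 3) (mm 5 (ado_gen 0) X) = mm 5 (ado_gen 0) (mm 5 (ado_gen 3) X)"
    and bd: "mm 5 (ado_gen 3) (mm 5 (ado_gen 1) X) = mm 5 (ado_gen 1) (mm 5 (ado_gen 3) X)" for X
    using f[of 0 2 X] f[of 0 3 X] f[of 1 3 X] by simp_all
  note H = half_twist[where a = "mm 5 (ado_gen 0)" and b = "mm 5 (ado_gen 1)" and c = "mm 5 (ado_gen 2)" and d = "mm 5 (ado_gen 3)"
      and x = "idm 5", OF ab bc cd ac ad bd]
  have D: "mm 5 half_twist_mat X = mm 5 (ado_gen 0) (mm 5 (ado_gen 1) (mm 5 (ado_gen 2) (mm 5 (ado_gen 3)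
      (mm 5 (ado_gen 0) (mm 5 (ado_gen 1) (mm 5 (ado_gen 2) (mm 5 (ado_gen 0) (mm 5 (ado_gen 1) (mm 5 (ado_gen 0) X)))))))))"
    if "mat_supp 5 5 X" for X
    by (simp add: half_twist_mat_def mm_assoc mm_idm_left[OF that])
  have id: "mm 5 A (idm 5) = A" if "mat_supp 5 5 A" for A :: "ado_basis mat"
    using that by (rule mm_idm_right)
  have "mm 5 half_twist_mat (mm 5 (ado_gen i) (idm 5)) = mm 5 (ado_gen (3 - i)) (mm 5 half_twist_mat (idm 5))"
  proof -
    have s: "mat_supp 5 5 (mm 5 (ado_gen i) (idm 5))" by simp
    have "i \<in> {0, 1, 2, 3}" using assms by auto
    then show ?thesis unfolding D[OF s] D[OF mat_supp_idm] using H by auto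
  qed
  then show ?thesis by (simp add: half_twist_mat_def id)
qed

lemma half_twist_inv:
  assumes "i < 4" shows "mm 5 half_twist_mat (ado_gen_inv i) = mm 5 (ado_gen_inv (3 - i)) half_twist_mat"
proof -
  let ?H = half_twist_mat and ?j = "3 - i"
  have H: "mat_supp 5 5 ?H" by (simp add: half_twist_mat_def)
  have "mm 5 ?H (ado_gen_inv i) = mm 5 (mm 5 (ado_gen_inv ?j) (ado_gen ?j)) (mm 5 ?H (ado_gen_inv i))"
    using assms H by (simp add: ado_gen_inverse mm_idm_left[OF mat_supp_mm[OF H supp_ado_gen(2)]])
  also have "\<dots> = mm 5 (ado_gen_inv ?j) (mm 5 (mm 5 (ado_gen ?j) ?H) (ado_gen_inv i))" by (simp add: mm_assoc)
  also have "\<dots> = mm 5 (ado_gen_inv ?j) (mm 5 (mm 5 ?H (ado_gen i)) (ado_gen_inv i))" using assms by (simp add: half_twist_gen)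
  also have "\<dots> = mm 5 (ado_gen_inv ?j) ?H" using assms H by (simp add: mm_assoc ado_gen_inverse mm_idm_right)
  finally show ?thesis .
qed

lemma half_twist_braid:
  assumes "\<beta> \<in> braid_words 5"
  shows "mm 5 half_twist_mat (ado_braid 5 t \<beta>)
       = mm 5 (ado_braid 5 t (map (flip_letter 5) \<beta>)) half_twist_mat"
  using assms
proof (induction rule: braid_words_induct)
  case Nil
  have H: "mat_supp 5 5 half_twist_mat" by (simp add: half_twist_mat_def)
  then show ?case by (simp add: mm_idm_left[OF H] mm_idm_right[OF H])
next
  case (Cons l \<beta>)
  then have l: "1 \<le> letter_index l" "letter_index l \<le> 4" by simp_all
  let ?m = "letter_mat 5 (ado_ker t) (ado_inv t)"
  have eq: "mm 5 half_twist_mat (?m l) = mm 5 (?m (flip_letter 5 l)) half_twist_mat"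
  proof (cases l)
    case (Gen i)
    then show ?thesis using half_twist_gen[of "i - 1"] l by (simp add: ado_gen_def flip_letter_def)
  next
    case (GenInv i)
    then show ?thesis using half_twist_inv[of "i - 1"] l by (simp add: ado_gen_inv_def flip_letter_def)
  qed
  let ?b = "ado_braid 5 t"
  have "mm 5 half_twist_mat (?b (l # \<beta>)) = mm 5 (mm 5 half_twist_mat (?m l)) (?b \<beta>)"
    by (simp add: mm_assoc)
  also have "\<dots> = mm 5 (?m (flip_letter 5 l)) (mm 5 half_twist_mat (?b \<beta>))"
    unfolding eq by (rule mm_assoc)
  also have "\<dots> = mm 5 (?b (map (flip_letter 5) (l # \<beta>))) half_twist_mat"
    unfolding Cons.IH by (simp add: mm_assoc)
  finally show ?case .
qed

lemma open_trace_flip: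
  assumes "\<beta> \<in> braid_words 5"
  shows "open_trace 4 (ado_braid 5 t (map (flip_letter 5) \<beta>))
       = open_trace 4 (ado_braid 5 t \<beta>)"
  by (rule open_trace_conj_word[symmetric, where w = "[0, 1, 2, 3, 0, 1, 2, 0, 1, 0]"])
     (use half_twist_braid[OF assms] assms t in \<open>auto simp: half_twist_mat_def intro!: ado_class_braid flip_braid_words\<close>)

end

section \<open>Laurent polynomials as functions\<close>

lemma laurent_zero_imp:
  fixes c :: "int \<Rightarrow> complex"
  assumes "finite S" and zero: "\<And>t. t \<noteq> 0 \<Longrightarrow> (\<Sum>k\<in>S. c k * t powi k) = 0" and "k \<in> S"
  shows "c k = 0"
proof -
  obtain m where m: "\<And>j. j \<in> S \<Longrightarrow> m \<le> j"
    using \<open>finite S\<close> by (meson Min_le)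
  define N where "N = nat (Max S - m)"
  \<comment> \<open>The coefficients are shifted by one more than clearing negative exponents
    requires, so that the polynomial also vanishes at zero, where \<open>zero\<close> says
    nothing.\<close>
  define d where "d i = (case i of 0 \<Rightarrow> 0 | Suc i \<Rightarrow> if m + int i \<in> S then c (m + int i) else 0)" for i
  have bound: "nat (j - m) \<le> N" if "j \<in> S" for j
    using \<open>finite S\<close> that m[OF that] Max_ge[of S j] unfolding N_def by linarith
  have "(\<Sum>i\<le>Suc N. d i * t ^ i) = 0" for t
  proof (cases "t = 0")
    case False
    have "(\<Sum>i\<le>Suc N. d i * t ^ i) = (\<Sum>i\<le>N. (if m + int i \<in> S then c (m + int i) else 0) * t ^ Suc i)"
      by (simp only: sum.atMost_Suc_shift) (simp add: d_def)
    also have "\<dots> = (\<Sum>i | i \<le> N \<and> m + int i \<in> S. c (m + int i) * t ^ Suc i)"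
      by (rule sum.mono_neutral_cong_right) auto
    also have "\<dots> = (\<Sum>j\<in>S. c j * t ^ Suc (nat (j - m)))"
      by (rule sum.reindex_bij_witness[where i = "\<lambda>j. nat (j - m)" and j = "\<lambda>i. m + int i"])
         (use m bound in auto)
    also have "\<dots> = (\<Sum>j\<in>S. t powi (1 - m) * (c j * t powi j))"
    proof (intro sum.cong refl)
      fix j assume "j \<in> S"
      have "t ^ Suc (nat (j - m)) = t powi (1 + (j - m))"
        using m[OF \<open>j \<in> S\<close>] False by (simp add: power_int_def nat_add_distrib)
      also have "1 + (j - m) = (1 - m) + j" by simp
      also have "t powi ((1 - m) + j) = t powi (1 - m) * t powi j"
        using False by (intro power_int_add) simp
      finally show "c j * t ^ Suc (nat (j - m)) = t powi (1 - m) * (c j * t powi j)" by simp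
    qed
    also have "\<dots> = 0" using zero[OF False] by (simp flip: sum_distrib_left)
    finally show ?thesis .
  next
    case True
    then show ?thesis by (simp only: sum.atMost_Suc_shift) (simp add: d_def)
  qed
  then have "d (Suc (nat (k - m))) = 0"
    using polyfun_eq_0[of d "Suc N"] bound[OF \<open>k \<in> S\<close>] by auto
  then show ?thesis using \<open>k \<in> S\<close> m[OF \<open>k \<in> S\<close>] by (simp add: d_def)
qed

lemma laurent_eval_superset:
  "finite S \<Longrightarrow> Poly_Mapping.keys p \<subseteq> S \<Longrightarrow> laurent_eval p t = (\<Sum>k\<in>S. Poly_Mapping.lookup p k * t powi k)"
  unfolding laurent_eval_def by (rule sum.mono_neutral_left) (auto simp: in_keys_iff)

lemma laurent_eval_inject:
  assumes "\<And>t. t \<noteq> 0 \<Longrightarrow> laurent_eval p t = laurent_eval q t"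
  shows "p = q"
proof (rule poly_mapping_eqI)
  fix k
  let ?S = "insert k (Poly_Mapping.keys p \<union> Poly_Mapping.keys q)"
  have "Poly_Mapping.lookup p k - Poly_Mapping.lookup q k = 0"
  proof (rule laurent_zero_imp[where S = ?S and c = "\<lambda>k. Poly_Mapping.lookup p k - Poly_Mapping.lookup q k"])
    fix t :: complex assume "t \<noteq> 0"
    have "laurent_eval p t = (\<Sum>k\<in>?S. Poly_Mapping.lookup p k * t powi k)"
      "laurent_eval q t = (\<Sum>k\<in>?S. Poly_Mapping.lookup q k * t powi k)"
      by (rule laurent_eval_superset; auto)+
    then show "(\<Sum>k\<in>?S. (Poly_Mapping.lookup p k - Poly_Mapping.lookup q k) * t powi k) = 0"
      using assms[OF \<open>t \<noteq> 0\<close>] by (simp only: left_diff_distrib sum_subtractf diff_self)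
  qed auto
  then show "Poly_Mapping.lookup p k = Poly_Mapping.lookup q k" by simp
qed

lemma laurent2_eval_superset:
  "finite S \<Longrightarrow> Poly_Mapping.keys p \<subseteq> S \<Longrightarrow>
     laurent2_eval p t0 t1 = (\<Sum>(j, k)\<in>S. of_int (Poly_Mapping.lookup p (j, k)) * t0 powi j * t1 powi k)"
  unfolding laurent2_eval_def by (rule sum.mono_neutral_left) (auto simp: in_keys_iff)

text \<open>The one-variable result is applied twice: in \<open>t0\<close>, with coefficients that
  depend on \<open>t1\<close>, and then to these coefficients. For this the supports are enlarged to
  a common rectangle.\<close>

lemma laurent2_eval_inject:
  assumes "\<And>t0 t1. t0 \<noteq> 0 \<Longrightarrow> t1 \<noteq> 0 \<Longrightarrow> laurent2_eval p t0 t1 = laurent2_eval q t0 t1"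
  shows "p = q"
proof (rule poly_mapping_eqI)
  fix x :: "int \<times> int"
  let ?K = "insert x (Poly_Mapping.keys p \<union> Poly_Mapping.keys q)"
  define J where "J = fst ` ?K"
  define L where "L = snd ` ?K"
  let ?c = "\<lambda>j k. of_int (Poly_Mapping.lookup p (j, k)) - of_int (Poly_Mapping.lookup q (j, k)) :: complex"
  have K: "?K \<subseteq> J \<times> L"
    unfolding J_def L_def by (rule subset_fst_snd)
  have fin: "finite (J \<times> L)" "finite J" "finite L" by (simp_all add: J_def L_def)
  have sup: "Poly_Mapping.keys p \<subseteq> J \<times> L" "Poly_Mapping.keys q \<subseteq> J \<times> L"
    using K by blast+
  have zero: "(\<Sum>j\<in>J. (\<Sum>k\<in>L. ?c j k * t1 powi k) * t0 powi j) = 0" if "t0 \<noteq> 0" "t1 \<noteq> 0" for t0 t1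
  proof -
    have "(\<Sum>j\<in>J. (\<Sum>k\<in>L. ?c j k * t1 powi k) * t0 powi j) = (\<Sum>(j, k)\<in>J \<times> L. ?c j k * t0 powi j * t1 powi k)"
      unfolding sum.cartesian_product[symmetric] sum_distrib_right by (intro sum.cong refl) (simp only: ac_simps)
    also have "\<dots> = laurent2_eval p t0 t1 - laurent2_eval q t0 t1"
      unfolding laurent2_eval_superset[OF fin(1) sup(1)] laurent2_eval_superset[OF fin(1) sup(2)]
      by (simp add: case_prod_unfold left_diff_distrib sum_subtractf)
    finally show ?thesis using assms[OF that] by simp
  qed
  have "(\<Sum>k\<in>L. ?c (fst x) k * t1 powi k) = 0" if "t1 \<noteq> 0" for t1
    by (rule laurent_zero_imp[of J "\<lambda>j. \<Sum>k\<in>L. ?c j k * t1 powi k", OF fin(2)])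
       (use zero[OF _ that] in \<open>auto simp: J_def\<close>)
  then have "?c (fst x) (snd x) = 0"
    by (intro laurent_zero_imp[of L "?c (fst x)", OF fin(3)]) (auto simp: L_def)
  then show "Poly_Mapping.lookup p x = Poly_Mapping.lookup q x" by simp
qed

section \<open>Functions given by integral Laurent polynomials\<close>

definition is_laurent2 :: "(complex \<Rightarrow> complex \<Rightarrow> complex) \<Rightarrow> bool" where
  "is_laurent2 f \<longleftrightarrow> (\<exists>p. \<forall>t0 t1. t0 \<noteq> 0 \<longrightarrow> t1 \<noteq> 0 \<longrightarrow> f t0 t1 = laurent2_eval p t0 t1)"

lemma is_laurent2_monomial: "is_laurent2 (\<lambda>t0 t1. of_int c * t0 powi j * t1 powi k)"
  unfolding is_laurent2_def
  by (intro exI[of _ "Poly_Mapping.single (j, k) c"]) (simp add: laurent2_eval_def)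

lemma is_laurent2_add:
  assumes "is_laurent2 f" "is_laurent2 g" shows "is_laurent2 (\<lambda>t0 t1. f t0 t1 + g t0 t1)"
proof -
  obtain p q where pq: "\<And>t0 t1. t0 \<noteq> 0 \<Longrightarrow> t1 \<noteq> 0 \<Longrightarrow> f t0 t1 = laurent2_eval p t0 t1"
     "\<And>t0 t1. t0 \<noteq> 0 \<Longrightarrow> t1 \<noteq> 0 \<Longrightarrow> g t0 t1 = laurent2_eval q t0 t1"
    using assms unfolding is_laurent2_def by blast
  let ?S = "Poly_Mapping.keys p \<union> Poly_Mapping.keys q"
  have "laurent2_eval (p + q) t0 t1 = laurent2_eval p t0 t1 + laurent2_eval q t0 t1" for t0 t1
    using keys_add[of p q] laurent2_eval_superset[of ?S] 
    by (simp add: lookup_add case_prod_unfold sum.distrib algebra_simps)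
  then show ?thesis unfolding is_laurent2_def using pq by metis
qed

lemma is_laurent2_const: "is_laurent2 (\<lambda>t0 t1. of_int c)"
  using is_laurent2_monomial[of c 0 0] by simp

lemma is_laurent2_sum:
  "finite S \<Longrightarrow> (\<And>s. s \<in> S \<Longrightarrow> is_laurent2 (f s)) \<Longrightarrow> is_laurent2 (\<lambda>t0 t1. \<Sum>s\<in>S. f s t0 t1)"
proof (induction S rule: finite_induct)
  case empty
  then show ?case using is_laurent2_const[of 0] by simp
qed (simp add: is_laurent2_add)

lemma is_laurent2_cong:
  "is_laurent2 f \<Longrightarrow> (\<And>t0 t1. t0 \<noteq> 0 \<Longrightarrow> t1 \<noteq> 0 \<Longrightarrow> f t0 t1 = g t0 t1) \<Longrightarrow> is_laurent2 g"
  unfolding is_laurent2_def by metis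

lemma is_laurent2_mult:
  assumes "is_laurent2 f" "is_laurent2 g" shows "is_laurent2 (\<lambda>t0 t1. f t0 t1 * g t0 t1)"
proof -
  obtain p q where pq: "\<And>t0 t1. t0 \<noteq> 0 \<Longrightarrow> t1 \<noteq> 0 \<Longrightarrow> f t0 t1 = laurent2_eval p t0 t1"
     "\<And>t0 t1. t0 \<noteq> 0 \<Longrightarrow> t1 \<noteq> 0 \<Longrightarrow> g t0 t1 = laurent2_eval q t0 t1"
    using assms unfolding is_laurent2_def by blast
  have "is_laurent2 (\<lambda>t0 t1. \<Sum>x\<in>Poly_Mapping.keys p. \<Sum>y\<in>Poly_Mapping.keys q.
      of_int (Poly_Mapping.lookup p x * Poly_Mapping.lookup q y) * t0 powi (fst x + fst y) * t1 powi (snd x + snd y))"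
    by (intro is_laurent2_sum is_laurent2_monomial) auto
  then show ?thesis
    by (rule is_laurent2_cong)
       (simp add: pq laurent2_eval_def case_prod_unfold sum_product power_int_add mult.assoc mult.left_commute)
qed

lemma is_laurent2_powi: "is_laurent2 (\<lambda>t0 t1. t0 powi j)" "is_laurent2 (\<lambda>t0 t1. t1 powi j)"
  using is_laurent2_monomial[of 1 j 0] is_laurent2_monomial[of 1 0 j] by simp_all

lemma is_laurent2_basic:
  "is_laurent2 (\<lambda>t0 t1. 0)" "is_laurent2 (\<lambda>t0 t1. 1)" "is_laurent2 (\<lambda>t0 t1. t0)" "is_laurent2 (\<lambda>t0 t1. t1)"
  "is_laurent2 (\<lambda>t0 t1. inverse t0)" "is_laurent2 (\<lambda>t0 t1. inverse t1)"
  using is_laurent2_const[of 0] is_laurent2_const[of 1] is_laurent2_powi[of 1]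
    is_laurent2_powi[of "-1"] by (simp_all add: power_int_minus)

lemma is_laurent2_minus: "is_laurent2 f \<Longrightarrow> is_laurent2 (\<lambda>t0 t1. - f t0 t1)"
  using is_laurent2_mult[OF is_laurent2_const[of "-1"]] by simp

lemma is_laurent2_diff: "is_laurent2 f \<Longrightarrow> is_laurent2 g \<Longrightarrow> is_laurent2 (\<lambda>t0 t1. f t0 t1 - g t0 t1)"
  using is_laurent2_add[OF _ is_laurent2_minus] by simp

lemma is_laurent2_power: "is_laurent2 f \<Longrightarrow> is_laurent2 (\<lambda>t0 t1. f t0 t1 ^ k)"
  by (induction k) (auto intro: is_laurent2_basic is_laurent2_mult)

lemma is_laurent2_if:
  "is_laurent2 f \<Longrightarrow> is_laurent2 g \<Longrightarrow> is_laurent2 (\<lambda>t0 t1. if c then f t0 t1 else g t0 t1)"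
  by (cases c) auto

lemmas is_laurent2_intros = is_laurent2_basic is_laurent2_add is_laurent2_minus is_laurent2_diff
  is_laurent2_mult is_laurent2_power is_laurent2_powi

section \<open>Integrality of the Links--Gould invariant\<close>

text \<open>Square roots enter a matrix entry only through a factor \<open>r\<^sub>0\<^sup>a r\<^sub>1\<^sup>b\<close>, where the parity of the exponents
  is a coboundary: \<open>b\<close> counts the pairs of a vector of first weight one to the left of a vector of second
  weight one, and \<open>a\<close> adds to \<open>b\<close> the weighted sum of the positions and the number of vectors \<open>e\<^sub>3\<close>.\<close>

fun lg_total :: "lg_basis list \<Rightarrow> nat \<times> nat" where
  "lg_total I = wsum lg_wt I"

fun bexp :: "lg_basis list \<Rightarrow> nat" where
  "bexp [] = 0"
| "bexp (x # I) = bexp I + fst (lg_wt x) * snd (lg_total I)"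

fun pexp :: "lg_basis list \<Rightarrow> nat" where
  "pexp [] = 0"
| "pexp (x # I) = pexp I + fst (lg_total I) + snd (lg_total I)"

fun mexp :: "lg_basis list \<Rightarrow> nat" where
  "mexp [] = 0"
| "mexp (x # I) = mexp I + (if x = e3 then 1 else 0)"

definition aexp :: "lg_basis list \<Rightarrow> nat" where
  "aexp I = bexp I + pexp I + mexp I"

text \<open>A substitute for the power of \<open>A\<close> with integral exponent \<open>d\<close>:
  negative powers of \<open>A\<close>, which may vanish, are traded for powers of \<open>B\<close>,
  as \<open>A * B\<close> is a polynomial in \<open>t0\<close> and \<open>t1\<close>.\<close>

definition gam :: "complex \<Rightarrow> complex \<Rightarrow> int \<Rightarrow> complex" where
  "gam A B d = A ^ nat d * B ^ nat (- d)"

definition lg_params :: "complex \<Rightarrow> complex \<Rightarrow> complex \<Rightarrow> complex \<Rightarrow> bool" where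
  "lg_params r0 r1 A B \<longleftrightarrow> r0 \<noteq> 0 \<and> r1 \<noteq> 0 \<and> A * B = (r0^2 - 1) * (1 - r1^2)"

text \<open>The gauge factor between \<open>I\<close> and \<open>J\<close>. For the roots only the
  parity of the exponents matters, so sums replace differences and no negative powers occur.\<close>

definition hfactor :: "complex \<Rightarrow> complex \<Rightarrow> complex \<Rightarrow> complex \<Rightarrow> lg_basis list \<Rightarrow> lg_basis list \<Rightarrow> complex" where
  "hfactor r0 r1 A B I J = r0 ^ (aexp I + aexp J) * r1 ^ (bexp I + bexp J) * gam A B (int (mexp I) - int (mexp J))"

definition homog :: "lg_basis list \<Rightarrow> lg_basis list \<Rightarrow> (complex \<Rightarrow> complex \<Rightarrow> complex \<Rightarrow> complex \<Rightarrow> complex) \<Rightarrow> bool" where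
  "homog I J e \<longleftrightarrow> (\<exists>f. is_laurent2 f \<and> (\<forall>r0 r1 A B. lg_params r0 r1 A B \<longrightarrow>
     e r0 r1 A B = hfactor r0 r1 A B I J * f (r0^2) (r1^2)))"

lemma homogI:
  assumes "is_laurent2 f"
    "\<And>r0 r1 A B. lg_params r0 r1 A B \<Longrightarrow> e r0 r1 A B = hfactor r0 r1 A B I J * f (r0^2) (r1^2)"
  shows "homog I J e"
  using assms unfolding homog_def by blast

lemma homog_zero: "(\<And>r0 r1 A B. lg_params r0 r1 A B \<Longrightarrow> e r0 r1 A B = 0) \<Longrightarrow> homog I J e"
  by (rule homogI[OF is_laurent2_basic(1)]) simp

lemma homog_add:
  assumes "homog I J e" "homog I J e'" shows "homog I J (\<lambda>r0 r1 A B. e r0 r1 A B + e' r0 r1 A B)"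
proof -
  from assms obtain f f' where "is_laurent2 f" "is_laurent2 f'" and
    "\<And>r0 r1 A B. lg_params r0 r1 A B \<Longrightarrow> e r0 r1 A B = hfactor r0 r1 A B I J * f (r0^2) (r1^2)"
    "\<And>r0 r1 A B. lg_params r0 r1 A B \<Longrightarrow> e' r0 r1 A B = hfactor r0 r1 A B I J * f' (r0^2) (r1^2)"
    unfolding homog_def by blast
  then show ?thesis by (intro homogI[OF is_laurent2_add[of f f']]) (auto simp: algebra_simps)
qed

lemma homog_scale:
  assumes "is_laurent2 g" "homog I J e"
  shows "homog I J (\<lambda>r0 r1 A B. g (r0^2) (r1^2) * e r0 r1 A B)"
proof -
  from assms obtain f where "is_laurent2 f" and
    "\<And>r0 r1 A B. lg_params r0 r1 A B \<Longrightarrow> e r0 r1 A B = hfactor r0 r1 A B I J * f (r0^2) (r1^2)"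
    unfolding homog_def by blast
  then show ?thesis by (intro homogI[OF is_laurent2_mult[of g f]]) (use assms in auto)
qed

lemma homog_sum:
  "finite S \<Longrightarrow> (\<And>s. s \<in> S \<Longrightarrow> homog I J (e s)) \<Longrightarrow> homog I J (\<lambda>r0 r1 A B. \<Sum>s\<in>S. e s r0 r1 A B)"
  by (induction S rule: finite_induct) (auto intro: homog_zero homog_add)

text \<open>Opposite powers cancel into powers of \<open>A * B\<close>. The exponent
  \<open>k\<close> is the same for all \<open>A\<close> and \<open>B\<close>, so the correction is a
  fixed polynomial in \<open>t0\<close> and \<open>t1\<close>.\<close>

lemma gam_mult: "\<exists>k. \<forall>A B. gam A B d * gam A B d' = gam A B (d + d') * (A * B) ^ k"
proof -
  define k where "k = nat d + nat d' - nat (d + d')"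
  have k: "nat d + nat d' = nat (d + d') + k" "nat (- d) + nat (- d') = nat (- (d + d')) + k"
    unfolding k_def by linarith+
  have "gam A B d * gam A B d' = gam A B (d + d') * (A * B) ^ k" for A B
  proof -
    have "gam A B d * gam A B d' = A ^ (nat d + nat d') * B ^ (nat (- d) + nat (- d'))"
      by (simp add: power_add gam_def)
    also have "\<dots> = gam A B (d + d') * (A * B) ^ k"
      unfolding k power_add power_mult_distrib gam_def by (simp only: ac_simps)
    finally show ?thesis .
  qed
  then show ?thesis by blast
qed

text \<open>In the product of the two gauge factors the intermediate word \<open>K\<close>
  contributes even powers of the roots and a power of \<open>A * B\<close>, all of them polynomials
  in \<open>t0\<close> and \<open>t1\<close>.\<close>

lemma homog_mult:
  assumes "homog I K e" "homog K J e'" shows "homog I J (\<lambda>r0 r1 A B. e r0 r1 A B * e' r0 r1 A B)"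
proof -
  obtain f f' where f: "is_laurent2 f" "is_laurent2 f'" and
    e: "\<And>r0 r1 A B. lg_params r0 r1 A B \<Longrightarrow> e r0 r1 A B = hfactor r0 r1 A B I K * f (r0^2) (r1^2)"
    "\<And>r0 r1 A B. lg_params r0 r1 A B \<Longrightarrow> e' r0 r1 A B = hfactor r0 r1 A B K J * f' (r0^2) (r1^2)"
    using assms unfolding homog_def by blast
  obtain k where k: "\<And>A B. gam A B (int (mexp I) - int (mexp K)) * gam A B (int (mexp K) - int (mexp J))
      = gam A B (int (mexp I) - int (mexp J)) * (A * B) ^ k"
    using gam_mult[of "int (mexp I) - int (mexp K)" "int (mexp K) - int (mexp J)"] by auto
  show ?thesis
  proof (rule homogI)
    show "is_laurent2 (\<lambda>t0 t1. t0 ^ aexp K * t1 ^ bexp K * ((t0 - 1) * (1 - t1)) ^ k * (f t0 t1 * f' t0 t1))"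
      using f by (intro is_laurent2_intros)
    fix r0 r1 A B assume p: "lg_params r0 r1 A B"
    have "hfactor r0 r1 A B I K * hfactor r0 r1 A B K J = r0 ^ (aexp I + aexp J) * r1 ^ (bexp I + bexp J)
       * (gam A B (int (mexp I) - int (mexp K)) * gam A B (int (mexp K) - int (mexp J)))
       * ((r0^2) ^ aexp K * (r1^2) ^ bexp K)"
      by (simp add: hfactor_def power_add power2_eq_square power_mult_distrib)
    also have "\<dots> = hfactor r0 r1 A B I J * ((r0^2) ^ aexp K * (r1^2) ^ bexp K * ((r0^2 - 1) * (1 - r1^2)) ^ k)"
      unfolding k using p by (simp add: lg_params_def hfactor_def)
    finally have h: "hfactor r0 r1 A B I K * hfactor r0 r1 A B K J
      = hfactor r0 r1 A B I J * ((r0^2) ^ aexp K * (r1^2) ^ bexp K * ((r0^2 - 1) * (1 - r1^2)) ^ k)" .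
    have "e r0 r1 A B * e' r0 r1 A B
        = hfactor r0 r1 A B I K * hfactor r0 r1 A B K J * (f (r0^2) (r1^2) * f' (r0^2) (r1^2))"
      unfolding e(1)[OF p] e(2)[OF p] by (simp only: ac_simps)
    then show "e r0 r1 A B * e' r0 r1 A B = hfactor r0 r1 A B I J
       * ((r0^2) ^ aexp K * (r1^2) ^ bexp K * ((r0^2 - 1) * (1 - r1^2)) ^ k * (f (r0^2) (r1^2) * f' (r0^2) (r1^2)))"
      unfolding h by (simp only: ac_simps)
  qed
qed

lemma homog_even_shift:
  assumes e: "\<And>r0 r1 A B. lg_params r0 r1 A B \<Longrightarrow> e r0 r1 A B = r0 ^ i * r1 ^ j
       * gam A B (int (mexp I) - int (mexp J)) * f (r0^2) (r1^2)"
    and f: "is_laurent2 f" and k: "aexp I + aexp J = i + 2 * k" and l: "bexp I + bexp J = j + 2 * l"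
  shows "homog I J e"
proof (rule homogI)
  show "is_laurent2 (\<lambda>t0 t1. t0 powi (- int k) * t1 powi (- int l) * f t0 t1)"
    using f by (intro is_laurent2_intros)
  fix r0 r1 A B assume p: "lg_params r0 r1 A B"
  have sq: "r ^ (2 * n) * (r^2) powi (- int n) = 1" if "r \<noteq> 0" for r :: complex and n
    using that by (simp add: power_int_minus power_mult)
  have 1: "r0 ^ (2 * k) * (r0^2) powi (- int k) = 1" "r1 ^ (2 * l) * (r1^2) powi (- int l) = 1"
    using p by (auto simp: lg_params_def intro!: sq)
  have "e r0 r1 A B = r0 ^ i * r1 ^ j * gam A B (int (mexp I) - int (mexp J)) * f (r0^2) (r1^2)
     * (r0 ^ (2 * k) * (r0^2) powi (- int k)) * (r1 ^ (2 * l) * (r1^2) powi (- int l))"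
    unfolding e[OF p] 1 by simp
  then show "e r0 r1 A B = hfactor r0 r1 A B I J * ((r0^2) powi (- int k) * (r1^2) powi (- int l) * f (r0^2) (r1^2))"
    unfolding hfactor_def k l power_add by (simp only: ac_simps)
qed

text \<open>The gauge factor of a word with itself has even exponents and contains neither
  \<open>A\<close> nor \<open>B\<close>. This is why traces are free of square roots.\<close>

lemma homog_diag_iff:
  "homog I I e \<longleftrightarrow> (\<exists>f. is_laurent2 f \<and> (\<forall>r0 r1 A B. lg_params r0 r1 A B \<longrightarrow> e r0 r1 A B = f (r0^2) (r1^2)))"
proof
  assume "homog I I e"
  then obtain f where "is_laurent2 f" and
    e: "\<And>r0 r1 A B. lg_params r0 r1 A B \<Longrightarrow> e r0 r1 A B = hfactor r0 r1 A B I I * f (r0^2) (r1^2)"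
    unfolding homog_def by blast
  then show "\<exists>f. is_laurent2 f \<and> (\<forall>r0 r1 A B. lg_params r0 r1 A B \<longrightarrow> e r0 r1 A B = f (r0^2) (r1^2))"
    by (intro exI[of _ "\<lambda>t0 t1. t0 ^ aexp I * t1 ^ bexp I * f t0 t1"])
       (auto intro!: is_laurent2_intros simp: hfactor_def gam_def power_add power2_eq_square power_mult_distrib)
next
  assume "\<exists>f. is_laurent2 f \<and> (\<forall>r0 r1 A B. lg_params r0 r1 A B \<longrightarrow> e r0 r1 A B = f (r0^2) (r1^2))"
  then obtain f where "is_laurent2 f" "\<And>r0 r1 A B. lg_params r0 r1 A B \<Longrightarrow> e r0 r1 A B = f (r0^2) (r1^2)" by blast
  then show "homog I I e"
    by (intro homog_even_shift[where i = 0 and j = 0 and f = f and k = "aexp I" and l = "bexp I"]) (auto simp: gam_def)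
qed

text \<open>The change of the exponents caused by a new first letter depends only on that letter and
  the total weight. It is the same for both words, so sums change by an even number.\<close>

lemma homog_shift:
  assumes "homog I J e" "lg_total I = lg_total J"
  shows "homog (x # I) (x # J) e"
proof -
  obtain f where f: "is_laurent2 f" and
    e: "\<And>r0 r1 A B. lg_params r0 r1 A B \<Longrightarrow> e r0 r1 A B = hfactor r0 r1 A B I J * f (r0^2) (r1^2)"
    using assms(1) unfolding homog_def by blast
  define k where "k = fst (lg_wt x) * snd (lg_total J)"
  define l where "l = k + fst (lg_total J) + snd (lg_total J) + (if x = e3 then 1 else 0)"
  have a: "aexp (x # I) + aexp (x # J) = aexp I + aexp J + 2 * l"
    and b: "bexp (x # I) + bexp (x # J) = bexp I + bexp J + 2 * k"
    using assms(2) by (simp_all add: aexp_def l_def k_def del: lg_total.simps)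
  show ?thesis
    by (rule homog_even_shift[OF _ f a b]) (simp add: e hfactor_def)
qed

text \<open>The coefficients of the Links--Gould \<open>R\<close>-matrix up to powers of \<open>r\<^sub>0\<close>, \<open>r\<^sub>1\<close>, \<open>A\<close>, \<open>B\<close>.\<close>

fun lg_diag :: "lg_basis \<Rightarrow> lg_basis \<Rightarrow> complex \<Rightarrow> complex \<Rightarrow> complex" where
  "lg_diag e0 y t0 t1 = (if y = e0 then t0 else 0)"
| "lg_diag e1 y t0 t1 = (case y of e0 \<Rightarrow> t0 - 1 | e1 \<Rightarrow> - 1 | e2 \<Rightarrow> t0 * t1 - 1 | e3 \<Rightarrow> 0)"
| "lg_diag e2 y t0 t1 = (case y of e0 \<Rightarrow> t0 - 1 | e1 \<Rightarrow> 0 | e2 \<Rightarrow> - 1 | e3 \<Rightarrow> 0)"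
| "lg_diag e3 y t0 t1 = (case y of e0 \<Rightarrow> (t0 - 1) * (1 - t1) | e1 \<Rightarrow> t1 - 1 | e2 \<Rightarrow> t1 - 1 | e3 \<Rightarrow> t1)"

definition lg_coeff :: "lg_basis \<times> lg_basis \<Rightarrow> lg_basis \<times> lg_basis \<Rightarrow> complex \<Rightarrow> complex \<Rightarrow> complex" where
  "lg_coeff p q t0 t1 = (if p = q then lg_diag (fst p) (snd p) t0 t1
     else if (p, q) \<in> {((e2, e1), (e1, e2)), ((e1, e2), (e2, e1)), ((e3, e0), (e1, e2)), ((e1, e2), (e3, e0))} then - 1
     else if p = prod.swap q \<or> (p, q) \<in> {((e3, e0), (e2, e1)), ((e2, e1), (e3, e0))} then 1 else 0)"

lemma is_laurent2_coeff: "is_laurent2 (lg_coeff p q)"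
proof -
  have "is_laurent2 (\<lambda>t0 t1. lg_diag x y t0 t1)" for x y
    by (cases x; cases y) (auto intro!: is_laurent2_intros)
  then show ?thesis
    unfolding lg_coeff_def[abs_def] by (intro is_laurent2_if is_laurent2_intros)
qed

text \<open>The values of \<open>la\<close> and \<open>lb\<close> are \<open>aexp\<close> and
  \<open>bexp\<close> of a two-letter word.\<close>

definition la :: "lg_basis \<times> lg_basis \<Rightarrow> nat" where
  "la p = fst (lg_wt (fst p)) * snd (lg_wt (snd p)) + fst (lg_wt (snd p)) + snd (lg_wt (snd p)) + mexp [fst p, snd p]"

definition lb :: "lg_basis \<times> lg_basis \<Rightarrow> nat" where
  "lb p = fst (lg_wt (fst p)) * snd (lg_wt (snd p))"

lemma lg_ker_coeff:
  assumes "lg_params r0 r1 A B"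
  shows "lg_ker r0 r1 A B (x, y) (z, w) = r0 ^ ((la (x, y) + la (z, w)) mod 2) * r1 ^ ((lb (x, y) + lb (z, w)) mod 2)
      * gam A B (int (mexp [x, y]) - int (mexp [z, w])) * lg_coeff (x, y) (z, w) (r0^2) (r1^2)"
  using assms
  by (cases x; cases y; cases z; cases w)
     (simp_all add: lg_ker_def ket_def la_def lb_def gam_def lg_coeff_def lg_params_def algebra_simps)

lemma homog_lg_ker: "homog (x # y # I) (z # w # I) (\<lambda>r0 r1 A B. lg_ker r0 r1 A B (x, y) (z, w))"
proof (cases "lg_wt x + lg_wt y = lg_wt z + lg_wt w")
  case False
  then show ?thesis using lg_ker_wt by (intro homog_zero) blast
next
  case True
  let ?I = "x # y # I" and ?J = "z # w # I"
  let ?i = "(la (x, y) + la (z, w)) mod 2" and ?j = "(lb (x, y) + lb (z, w)) mod 2"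
  have wt: "fst (lg_wt x) + fst (lg_wt y) = fst (lg_wt z) + fst (lg_wt w)"
     "snd (lg_wt x) + snd (lg_wt y) = snd (lg_wt z) + snd (lg_wt w)"
    using True by (metis fst_add snd_add)+
  define N where "N = lg_total I"
  have b: "bexp ?I + bexp ?J = lb (x, y) + lb (z, w) + 2 * (bexp I + (fst (lg_wt x) + fst (lg_wt y)) * snd N)"
  proof -
    have "bexp ?I + bexp ?J = lb (x, y) + lb (z, w) + (2 * bexp I
        + ((fst (lg_wt x) + fst (lg_wt y)) * snd N + (fst (lg_wt z) + fst (lg_wt w)) * snd N))"
      by (simp add: lb_def N_def algebra_simps)
    then show ?thesis unfolding wt(1)[symmetric] by simp
  qed
  have a: "aexp ?I + aexp ?J = la (x, y) + la (z, w)
      + 2 * (bexp I + pexp I + mexp I + (fst (lg_wt x) + fst (lg_wt y)) * snd N + 2 * fst N + 2 * snd N)"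
    using b by (simp add: aexp_def la_def lb_def N_def algebra_simps)
  have m: "int (mexp ?I) - int (mexp ?J) = int (mexp [x, y]) - int (mexp [z, w])" by simp
  obtain k where k: "aexp ?I + aexp ?J = ?i + 2 * k"
    using a by (metis mod_mult_self1 mod_mult_div_eq mult.commute)
  obtain l where l: "bexp ?I + bexp ?J = ?j + 2 * l"
    using b by (metis mod_mult_self1 mod_mult_div_eq mult.commute)
  show ?thesis
    by (rule homog_even_shift[OF _ is_laurent2_coeff k l]) (simp only: lg_ker_coeff m)
qed

lemma homog_gm: "homog I J (\<lambda>r0 r1 A B. gm (lg_ker r0 r1 A B) i I J)"
proof (induction i arbitrary: I J)
  case 0
  show ?case
  proof (cases "\<exists>x y z w K. I = x # y # K \<and> J = z # w # K")
    case True
    then show ?thesis using homog_lg_ker by auto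
  next
    case False
    then have "gm (lg_ker r0 r1 A B) 0 I J = 0" for r0 r1 A B
      by (cases "(lg_ker r0 r1 A B, 0::nat, I, J)" rule: gm.cases) auto
    then show ?thesis by (intro homog_zero)
  qed
next
  case (Suc i)
  show ?case
  proof (cases "\<exists>x K L. I = x # K \<and> J = x # L \<and> lg_total K = lg_total L")
    case True
    then show ?thesis using Suc by (auto intro: homog_shift)
  next
    case False
    have "gm (lg_ker r0 r1 A B) (Suc i) I J = 0" for r0 r1 A B
    proof (rule ccontr)
      assume *: "gm (lg_ker r0 r1 A B) (Suc i) I J \<noteq> 0"
      then obtain x K L where IJ: "I = x # K" "J = x # L" "gm (lg_ker r0 r1 A B) i K L \<noteq> 0"
        by (cases "(lg_ker r0 r1 A B, Suc i, I, J)" rule: gm.cases) (auto split: if_splits)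
      have "lg_total K = lg_total L"
        using gm_additive[of "lg_ker r0 r1 A B" lg_wt, OF lg_ker_wt IJ(3)] by simp
      with IJ False show False by blast
    qed
    then show ?thesis by (intro homog_zero)
  qed
qed

definition homog_mat :: "nat \<Rightarrow> (complex \<Rightarrow> complex \<Rightarrow> complex \<Rightarrow> complex \<Rightarrow> lg_basis mat) \<Rightarrow> bool" where
  "homog_mat n M \<longleftrightarrow> (\<forall>I J. homog I J (\<lambda>r0 r1 A B. M r0 r1 A B I J))"

lemma homog_mat_closed:
  "homog_mat n (\<lambda>r0 r1 A B. idm n)"
  "homog_mat n (\<lambda>r0 r1 A B. gen_mat n (lg_ker r0 r1 A B) i)"
  "homog_mat n M \<Longrightarrow> homog_mat n N \<Longrightarrow> homog_mat n (\<lambda>r0 r1 A B. mm n (M r0 r1 A B) (N r0 r1 A B))"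
  "homog_mat n M \<Longrightarrow> homog_mat n N \<Longrightarrow> homog_mat n (\<lambda>r0 r1 A B. madd (M r0 r1 A B) (N r0 r1 A B))"
  "is_laurent2 g \<Longrightarrow> homog_mat n M \<Longrightarrow> homog_mat n (\<lambda>r0 r1 A B. mscale (g (r0^2) (r1^2)) (M r0 r1 A B))"
proof -
  show "homog_mat n (\<lambda>r0 r1 A B. idm n)"
    unfolding homog_mat_def
  proof (intro allI)
    fix I J :: "lg_basis list"
    show "homog I J (\<lambda>r0 r1 A B. idm n I J)"
    proof (cases "I = J \<and> length I = n")
      case True
      then show ?thesis by (auto simp: idm_def homog_diag_iff intro: is_laurent2_intros)
    qed (auto simp: idm_def intro: homog_zero)
  qed
  show "homog_mat n (\<lambda>r0 r1 A B. gen_mat n (lg_ker r0 r1 A B) i)"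
    unfolding homog_mat_def
  proof (intro allI)
    fix I J :: "lg_basis list"
    show "homog I J (\<lambda>r0 r1 A B. gen_mat n (lg_ker r0 r1 A B) i I J)"
      by (cases "length I = n") (auto simp: gen_mat_def intro: homog_gm homog_zero)
  qed
  show "homog_mat n (\<lambda>r0 r1 A B. mm n (M r0 r1 A B) (N r0 r1 A B))" if "homog_mat n M" "homog_mat n N"
    unfolding homog_mat_def mm_def
  proof (intro allI homog_sum)
    fix I J K :: "lg_basis list"
    show "homog I J (\<lambda>r0 r1 A B. M r0 r1 A B I K * N r0 r1 A B K J)"
      by (rule homog_mult[where K = K]) (use that in \<open>auto simp: homog_mat_def\<close>)
  qed simp
qed (auto simp: homog_mat_def madd_def mscale_def intro!: homog_add homog_scale)

abbreviation lg_inv :: "complex \<Rightarrow> complex \<Rightarrow> complex \<Rightarrow> complex \<Rightarrow> lg_basis kernel" where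
  "lg_inv r0 r1 A B \<equiv> kinv (r0^2) (r1^2) (lg_ker r0 r1 A B)"

abbreviation lg_braid :: "nat \<Rightarrow> complex \<Rightarrow> complex \<Rightarrow> complex \<Rightarrow> complex \<Rightarrow> braid_word \<Rightarrow> lg_basis mat" where
  "lg_braid n r0 r1 A B \<equiv> braid_mat n (lg_ker r0 r1 A B) (lg_inv r0 r1 A B)"

lemma homog_mat_inv:
  assumes "Suc i < n"
  shows "homog_mat n (\<lambda>r0 r1 A B. gen_mat n (lg_inv r0 r1 A B) i)"
proof -
  have l: "is_laurent2 (\<lambda>t0 t1. - 1 / (t0 * t1))" "is_laurent2 (\<lambda>t0 t1. 1 - t0 - t1)" "is_laurent2 (\<lambda>t0 t1. t0 * t1 - t0 - t1)"
    by (auto simp: divide_inverse intro!: is_laurent2_intros)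
  show ?thesis
    unfolding gen_mat_kinv[OF assms]
    by (intro homog_mat_closed homog_mat_closed(5)[OF l(1)] homog_mat_closed(5)[OF l(2)] homog_mat_closed(5)[OF l(3)])
qed

lemma homog_mat_braid:
  assumes "\<beta> \<in> braid_words n"
  shows "homog_mat n (\<lambda>r0 r1 A B. lg_braid n r0 r1 A B \<beta>)"
  using assms
proof (induction rule: braid_words_induct)
  case (Cons l \<beta>)
  then have "homog_mat n (\<lambda>r0 r1 A B. letter_mat n (lg_ker r0 r1 A B) (lg_inv r0 r1 A B) l)"
    by (cases l) (auto intro!: homog_mat_closed homog_mat_inv)
  from homog_mat_closed(3)[OF this Cons.IH] show ?case by simp
qed (simp add: homog_mat_closed)

text \<open>A closure involves diagonal entries only. One polynomial serves all choices of the roots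
  and of \<open>A\<close> and \<open>B\<close>, which allows closures in different scalings of
  \<open>e3\<close> to be compared.\<close>

lemma lg_closure_laurent:
  assumes "\<beta> \<in> braid_words (Suc m)"
  shows "\<exists>p. \<forall>r0 r1 A B. lg_params r0 r1 A B \<longrightarrow>
    (\<Sum>K\<in>words m. wprod (lg_h (r0^2) (r1^2)) K
       * lg_braid (Suc m) r0 r1 A B \<beta> (a # K) (a # K)) = laurent2_eval p (r0^2) (r1^2)"
proof -
  let ?M = "\<lambda>r0 r1 A B. lg_braid (Suc m) r0 r1 A B \<beta>"
  have "\<exists>f. is_laurent2 f \<and> (\<forall>r0 r1 A B. lg_params r0 r1 A B \<longrightarrow> ?M r0 r1 A B I I = f (r0^2) (r1^2))" for I
    using homog_mat_braid[OF assms] unfolding homog_mat_def by (intro homog_diag_iff[THEN iffD1]) blast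
  then obtain f where f: "\<And>I. is_laurent2 (f I)"
    "\<And>I r0 r1 A B. lg_params r0 r1 A B \<Longrightarrow> ?M r0 r1 A B I I = f I (r0^2) (r1^2)"
    by metis
  have h: "is_laurent2 (\<lambda>t0 t1. lg_h t0 t1 x)" for x
    by (cases x) (auto intro!: is_laurent2_intros)
  have hp: "is_laurent2 (\<lambda>t0 t1. wprod (lg_h t0 t1) K)" for K
    by (induction K) (auto intro!: is_laurent2_intros h)
  have "is_laurent2 (\<lambda>t0 t1. \<Sum>K\<in>words m. wprod (lg_h t0 t1) K * f (a # K) t0 t1)"
    by (intro is_laurent2_sum is_laurent2_mult hp f) simp
  then obtain p where p: "\<And>t0 t1. t0 \<noteq> 0 \<Longrightarrow> t1 \<noteq> 0 \<Longrightarrow>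
      (\<Sum>K\<in>words m. wprod (lg_h t0 t1) K * f (a # K) t0 t1) = laurent2_eval p t0 t1"
    unfolding is_laurent2_def by blast
  show ?thesis
  proof (intro exI[of _ p] allI impI)
    fix r0 r1 A B assume q: "lg_params r0 r1 A B"
    then have "r0^2 \<noteq> 0" "r1^2 \<noteq> 0" by (auto simp: lg_params_def)
    from p[OF this] show "(\<Sum>K\<in>words m. wprod (lg_h (r0^2) (r1^2)) K
       * ?M r0 r1 A B (a # K) (a # K)) = laurent2_eval p (r0^2) (r1^2)"
      using f(2)[OF q] by simp
  qed
qed

section \<open>Reversing the strands\<close>

definition rev_mat :: "'b mat \<Rightarrow> 'b mat" where
  "rev_mat M = (\<lambda>I J. M (rev I) (rev J))"

lemma rev_mat_simps:
  "rev_mat (mm n A B) = mm n (rev_mat A) (rev_mat (B :: ('b::finite) mat))"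
  "rev_mat (madd C D) = madd (rev_mat C) (rev_mat D)"
  "rev_mat (mscale c C) = mscale c (rev_mat C)"
  "rev_mat (idm n) = idm n"
proof -
  show "rev_mat (mm n A B) = mm n (rev_mat A) (rev_mat B)"
  proof (intro ext)
    fix I J
    show "rev_mat (mm n A B) I J = mm n (rev_mat A) (rev_mat B) I J"
      using sum_words_rev[of "\<lambda>K. A (rev I) K * B K (rev J)" n] by (simp add: rev_mat_def mm_def)
  qed
qed (auto simp: rev_mat_def madd_def mscale_def idm_def fun_eq_iff)

lemma gm_split:
  "length P = length P' \<Longrightarrow> gm r (length P) (P @ a # b # Q) (P' @ c # d # Q')
     = (if P = P' \<and> Q = Q' then r (a, b) (c, d) else 0)"
  by (induction P P' rule: list_induct2) auto

text \<open>Reversing a word exchanges the two letters on which the generator acts and moves the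
  left one of their two positions from \<open>i\<close> to \<open>n - 2 - i\<close>.\<close>

lemma gen_mat_flip:
  assumes "Suc i < n"
  shows "gen_mat n (ado_flip t) i = rev_mat (gen_mat n (ado_ker t) (n - 2 - i))"
proof (rule mat_suppI_ext[where k = n and m = n])
  show "mat_supp n n (rev_mat (gen_mat n (ado_ker t) (n - 2 - i)))"
    using mat_supp_gen[of n "ado_ker t" "n - 2 - i"] unfolding mat_supp_def rev_mat_def by fastforce
  fix I J :: "ado_basis list" assume "length I = n" "length J = n"
  moreover have "\<exists>P a b Q. K = P @ a # b # Q \<and> length P = i \<and> length Q = n - 2 - i" if "length K = n" for K :: "ado_basis list"
  proof -
    have "K = take i K @ K ! i # K ! Suc i # drop (Suc (Suc i)) K"
      using assms that by (metis Cons_nth_drop_Suc Suc_lessD append_take_drop_id)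
    then show ?thesis using assms that by (intro exI) auto
  qed
  ultimately obtain P a b Q P' c d Q' where IJ: "I = P @ a # b # Q" "J = P' @ c # d # Q'"
    "length P = i" "length P' = i" "length Q = n - 2 - i" "length Q' = n - 2 - i" by metis
  then show "gen_mat n (ado_flip t) i I J = rev_mat (gen_mat n (ado_ker t) (n - 2 - i)) I J"
    using gm_split[of P P' "ado_flip t" a b Q c d Q'] gm_split[of "rev Q" "rev Q'" "ado_ker t" b a "rev P" d c "rev P'"]
    by (auto simp: gen_mat_def rev_mat_def ado_flip_def)
qed simp

lemma gen_mat_kinv_flip:
  assumes "Suc i < n"
  shows "gen_mat n (kinv t0 t1 (ado_flip t)) i = rev_mat (gen_mat n (kinv t0 t1 (ado_ker t)) (n - 2 - i))"
proof -
  have "Suc (n - 2 - i) < n" using assms by linarith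
  then show ?thesis by (simp add: gen_mat_kinv[OF assms] gen_mat_kinv gen_mat_flip[OF assms] rev_mat_simps)
qed

lemma braid_mat_flip:
  assumes "\<beta> \<in> braid_words n"
  shows "braid_mat n (ado_flip t) (kinv t0 t1 (ado_flip t)) \<beta>
       = rev_mat (braid_mat n (ado_ker t) (kinv t0 t1 (ado_ker t)) (map (flip_letter n) \<beta>))"
  using assms
proof (induction rule: braid_words_induct)
  case (Cons l \<beta>)
  note l = Cons.hyps
  have i: "Suc (letter_index l - 1) < n" "n - 2 - (letter_index l - 1) = n - letter_index l - 1" using l by auto
  have "letter_mat n (ado_flip t) (kinv t0 t1 (ado_flip t)) l
      = rev_mat (letter_mat n (ado_ker t) (kinv t0 t1 (ado_ker t)) (flip_letter n l))"
    using gen_mat_flip[OF i(1)] gen_mat_kinv_flip[OF i(1)] i(2) by (cases l) (simp_all add: flip_letter_def)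
  then show ?case using Cons.IH by (simp add: rev_mat_simps)
qed (simp add: rev_mat_simps)

text \<open>The half twist replaces the braid by its flip, the open strand then moves from the first
  place to the last, and reversing all words turns the result into a closure of the interchanged
  matrix with the first strand open.\<close>

lemma ado_right_left:
  assumes t: "t \<noteq> 0" "t^2 \<noteq> 1" "t^2 \<noteq> omega^2" and \<beta>: "\<beta> \<in> braid_words 5"
  shows "(\<Sum>K\<in>words 4. wprod (ado_h t) K * ado_braid 5 t \<beta> (v0 # K) (v0 # K))
    = (\<Sum>K\<in>words 4. wprod (ado_g t) K
        * braid_mat 5 (ado_flip t) (kinv (t^2) (omega^2 / t^2) (ado_flip t)) \<beta> (v0 # K) (v0 # K))"
proof -
  interpret ambidextrous "ado_class t" "ado_h t" "ado_g t" v0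
    by (rule ambidextrous_ado[OF t])
  let ?M = "ado_braid 5 t" and ?f = "map (flip_letter 5) \<beta>"
  have "?M ?f \<in> ado_class t (Suc 4)"
    using ado_class_braid[OF t(1) flip_braid_words[OF \<beta>]] by simp
  have "(\<Sum>K\<in>words 4. wprod (ado_h t) K * ?M \<beta> (v0 # K) (v0 # K)) = open_trace 4 (?M \<beta>)"
    by (simp add: open_trace_def rtr_pow)
  also have "\<dots> = open_trace 4 (?M ?f)" using open_trace_flip[OF t \<beta>] by simp
  also have "\<dots> = (\<Sum>K\<in>words 4. wprod (ado_g t) K * ?M ?f (K @ [v0]) (K @ [v0]))"
    using \<open>?M ?f \<in> ado_class t (Suc 4)\<close> by (simp add: open_trace_left ltr_pow)
  also have "\<dots> = (\<Sum>K\<in>words 4. wprod (ado_g t) (rev K) * ?M ?f (rev K @ [v0]) (rev K @ [v0]))"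
    by (rule sum_words_rev[symmetric])
  finally show ?thesis
    by (simp add: braid_mat_flip[OF \<beta>] rev_mat_def prod_list.rev flip: rev_map)
qed

section \<open>Scalar closures\<close>

lemma commutes_rtr_pow:
  assumes "commutes (Suc n + l) (prim E k) M" "conserves wt M"
    and kh: "\<And>b c. E b c \<noteq> 0 \<Longrightarrow> k b * h b = k c * h c"
    and k0: "\<And>b. k b \<noteq> 0"
    and kl: "\<And>I J. length I = length J \<Longrightarrow> wsum wt I = wsum wt J
        \<Longrightarrow> wprod k I = wprod k J"
  shows "commutes (Suc n) (prim E k) ((rtr h ^^ l) M) \<and> conserves wt ((rtr h ^^ l) M)"
  using assms(1)
proof (induction l arbitrary: n)
  case (Suc l)
  have IH: "commutes (Suc (Suc n)) (prim E k) ((rtr h ^^ l) M) \<and> conserves wt ((rtr h ^^ l) M)"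
    using Suc.prems by (intro Suc.IH) simp
  show ?case
    using commutes_rtr[OF IH[THEN conjunct1] IH[THEN conjunct2] kh k0 kl] conserves_rtr[OF IH[THEN conjunct2]]
    by (simp only: funpow.simps o_apply simp_thms)
qed (simp add: assms(2))

text \<open>Closing all strands but the first leaves a one-strand operator that conserves weight and
  commutes with \<open>E\<close>. As weights separate the basis vectors it is diagonal, and a
  nonzero entry of \<open>E\<close> equates the two eigenvalues that it joins.\<close>

lemma closure_scalar:
  fixes M :: "('b::finite) mat"
  assumes "commutes (Suc m) (prim E k) M" "conserves wt M"
    and "\<And>b c. E b c \<noteq> 0 \<Longrightarrow> k b * h b = k c * h c" "\<And>b. k b \<noteq> 0"
    and "\<And>I J. length I = length J \<Longrightarrow> wsum wt I = wsum wt J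
        \<Longrightarrow> wprod k I = wprod k J"
    and inj: "inj wt" and E: "E b c \<noteq> 0"
  shows "(rtr h ^^ m) M [b] [b] = (rtr h ^^ m) M [c] [c]"
proof -
  let ?O = "(rtr h ^^ m) M"
  have "commutes (Suc 0 + m) (prim E k) M" using assms(1) by simp
  from commutes_rtr_pow[OF this assms(2-5)]
  have O: "commutes (Suc 0) (prim E k) ?O" "conserves wt ?O" by blast+
  have off: "?O [x] [y] = 0" if "x \<noteq> y" for x y
    using O(2)[unfolded conserves_def, rule_format, of "[x]" "[y]"] that injD[OF inj, of x y] by auto
  have "mm (Suc 0) ?O (prim E k) [b] [c] = (\<Sum>x\<in>UNIV. if x = b then ?O [b] [b] * E b c else 0)"
    unfolding mm_def sum_words_Suc by (intro sum.cong) (auto simp: off)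
  moreover have "mm (Suc 0) (prim E k) ?O [b] [c] = (\<Sum>x\<in>UNIV. if x = c then E b c * ?O [c] [c] else 0)"
    unfolding mm_def sum_words_Suc by (intro sum.cong) (auto simp: off)
  moreover have "mm (Suc 0) ?O (prim E k) [b] [c] = mm (Suc 0) (prim E k) ?O [b] [c]"
    using O(1) by (rule commutesD) auto
  ultimately show ?thesis using E by simp
qed

lemma conserves_braid:
  assumes "\<beta> \<in> braid_words n" "\<And>a b c d. r (a, b) (c, d) \<noteq> 0 \<Longrightarrow> wt a + wt b = wt c + wt d"
  shows "conserves wt (braid_mat n r (kinv t0 t1 r) \<beta>)"
  by (rule braid_mat_closed[OF assms(1)])
     (auto intro: conserves_idm conserves_gen conserves_mm conserves_madd conserves_mscale assms(2))

lemma commutes_braid: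
  assumes "\<beta> \<in> braid_words n" "kmul r (prim_kernel E k) = kmul (prim_kernel E k) r"
    "\<And>a b c d. r (a, b) (c, d) \<noteq> 0 \<Longrightarrow> k a * k b = k c * k d"
  shows "commutes n (prim E k) (braid_mat n r (kinv t0 t1 r) \<beta>)"
  by (rule braid_mat_closed[OF assms(1)])
     (auto intro: commutes_idm commutes_gen[OF assms(2,3)] commutes_mm commutes_madd commutes_mscale)

lemma inj_ado_wt: "inj ado_wt"
proof (rule injI)
  fix a b show "ado_wt a = ado_wt b \<Longrightarrow> a = b" by (cases a; cases b) auto
qed

lemma inj_lg_wt: "inj lg_wt"
proof (rule injI)
  fix a b show "lg_wt a = lg_wt b \<Longrightarrow> a = b" by (cases a; cases b) auto
qed

lemma ado_operator_scalar:
  assumes "t \<noteq> 0" "\<beta> \<in> braid_words (Suc m)"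
  shows "braid_operator (Suc m) (ado_R t) (ado_h t) \<beta> = scalar_op
    (\<Sum>K\<in>words m. wprod (ado_h t) K * ado_braid (Suc m) t \<beta> (v0 # K) (v0 # K))"
proof (intro ext)
  fix a b
  let ?M = "ado_braid (Suc m) t \<beta>"
  let ?O = "(rtr (ado_h t) ^^ m) ?M"
  have M: "?M \<in> ado_class t (Suc m)" by (rule ado_class_braid[OF assms])
  have op: "braid_operator (Suc m) (ado_R t) (ado_h t) \<beta> a b = ?O [a] [b]"
    using braid_operator_mat[OF kmul_kinv[OF cubic_ado[OF assms(1)]] ado_ker_def[symmetric] assms(2)]
    by (simp add: rtr_pow)
  have cons: "conserves ado_wt ?M" using M by (simp add: ado_class_def)
  have step: "?O [b] [b] = ?O [c] [c]" if "ado_E b c \<noteq> 0" for b c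
  proof (rule closure_scalar[where E = ado_E and k = "ado_k t" and wt = ado_wt])
    show "commutes (Suc m) (prim ado_E (ado_k t)) ?M" using M by (simp add: ado_class_def)
    show "wprod (ado_k t) I = wprod (ado_k t) J"
      if "length I = length J" "wsum ado_wt I = wsum ado_wt J" for I J
      using that by (simp add: prod_ado_k)
  qed (use cons assms that in \<open>auto simp: ado_h_k ado_k_nz inj_ado_wt\<close>)
  have "?O [a] [a] = ?O [v0] [v0]" using step[of v1 v0] step[of v2 v1] by (cases a) auto
  moreover have "?O [a] [b] = 0" if "a \<noteq> b"
  proof (rule ccontr)
    assume "?O [a] [b] \<noteq> 0"
    then obtain K where "?M (a # K) (b # K) \<noteq> 0"
      unfolding rtr_pow by (metis (no_types, lifting) append_Cons append_Nil mult_zero_right sum.neutral)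
    then have "ado_wt a = ado_wt b" using cons by (force simp: conserves_def)
    then show False using that inj_ado_wt by (auto simp: inj_def)
  qed
  ultimately show "braid_operator (Suc m) (ado_R t) (ado_h t) \<beta> a b = scalar_op
    (\<Sum>K\<in>words m. wprod (ado_h t) K * ?M (v0 # K) (v0 # K)) a b"
    by (auto simp: op scalar_op_def rtr_pow)
qed

lemma lg_polynomial_closure_scalar:
  assumes r: "r0 \<noteq> 0" "r1 \<noteq> 0" and \<beta>: "\<beta> \<in> braid_words (Suc m)"
  defines "M \<equiv> braid_mat (Suc m) (lg_ker r0 r1 (r0^2 - 1) (1 - r1^2)) (lg_inv r0 r1 (r0^2 - 1) (1 - r1^2)) \<beta>"
  shows "(\<Sum>K\<in>words m. wprod (lg_h (r0^2) (r1^2)) K * M (a # K) (a # K))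
       = (\<Sum>K\<in>words m. wprod (lg_h (r0^2) (r1^2)) K * M (e0 # K) (e0 # K))"
proof -
  let ?O = "(rtr (lg_h (r0^2) (r1^2)) ^^ m) M"
  have cons: "conserves lg_wt M"
    unfolding M_def by (rule conserves_braid[OF \<beta> lg_ker_wt])
  \<comment> \<open>The grouplike maps are expressed through the weights, so that words of equal
    length and weight have equal products.\<close>
  have odd_k: "lg_odd_k r0 r1 x = 1 / r0 * (- r0 * r1) ^ fst (lg_wt x) * (- 1) ^ snd (lg_wt x)" for x
    using r by (cases x) auto
  have odd_prod: "wprod (lg_odd_k r0 r1) I
      = (1 / r0) ^ length I * (- r0 * r1) ^ fst (wsum lg_wt I) * (- 1) ^ snd (wsum lg_wt I)" for I
    by (induction I) (simp_all add: odd_k power_add)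
  have even_k: "lg_even_k r0 r1 x = (1 / (r0 * r1)) ^ fst (lg_wt x) * (r0 * r1) ^ snd (lg_wt x)" for x
    using r by (cases x) auto
  have even_prod: "wprod (lg_even_k r0 r1) I
      = (1 / (r0 * r1)) ^ fst (wsum lg_wt I) * (r0 * r1) ^ snd (wsum lg_wt I)" for I
    by (induction I) (simp_all add: even_k power_add)
  have odd: "?O [b] [b] = ?O [c] [c]" if "lg_odd r0 b c \<noteq> 0" for b c
  proof (rule closure_scalar[where E = "lg_odd r0" and k = "lg_odd_k r0 r1" and wt = lg_wt])
    show "commutes (Suc m) (prim (lg_odd r0) (lg_odd_k r0 r1)) M"
      unfolding M_def
      by (rule commutes_braid[OF \<beta> lg_odd_commutes[OF r(1)]], rule lg_ker_mult) (use r in auto)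
    show "wprod (lg_odd_k r0 r1) I = wprod (lg_odd_k r0 r1) J"
      if "length I = length J" "wsum lg_wt I = wsum lg_wt J" for I J
      using that by (simp add: odd_prod)
    show "lg_odd_k r0 r1 b * lg_h (r0^2) (r1^2) b = lg_odd_k r0 r1 c * lg_h (r0^2) (r1^2) c"
      if "lg_odd r0 b c \<noteq> 0" for b c
      using that r by (cases b; cases c) auto
    show "lg_odd_k r0 r1 b \<noteq> 0" for b using r by (cases b) auto
  qed (use cons that in \<open>auto simp: inj_lg_wt\<close>)
  have even: "?O [b] [b] = ?O [c] [c]" if "lg_even b c \<noteq> 0" for b c
  proof (rule closure_scalar[where E = lg_even and k = "lg_even_k r0 r1" and wt = lg_wt])
    show "commutes (Suc m) (prim lg_even (lg_even_k r0 r1)) M"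
      unfolding M_def
      by (rule commutes_braid[OF \<beta> lg_even_commutes[OF r]], rule lg_ker_mult) (use r in auto)
    show "wprod (lg_even_k r0 r1) I = wprod (lg_even_k r0 r1) J"
      if "length I = length J" "wsum lg_wt I = wsum lg_wt J" for I J
      using that by (simp add: even_prod)
    show "lg_even_k r0 r1 b * lg_h (r0^2) (r1^2) b = lg_even_k r0 r1 c * lg_h (r0^2) (r1^2) c"
      if "lg_even b c \<noteq> 0" for b c
      using that r by (cases b; cases c) (auto simp: power2_eq_square field_simps)
    show "lg_even_k r0 r1 b \<noteq> 0" for b using r by (cases b) auto
  qed (use cons that in \<open>auto simp: inj_lg_wt\<close>)
  have "?O [a] [a] = ?O [e0] [e0]"
    using odd[of e2 e0] odd[of e3 e1] even[of e2 e1] r by (cases a) auto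
  then show ?thesis by (simp add: rtr_pow)
qed

lemma lg_operator:
  assumes \<beta>: "\<beta> \<in> braid_words (Suc m)"
  obtains p where
    "\<And>r0 r1 A B. lg_params r0 r1 A B \<Longrightarrow> (\<Sum>K\<in>words m. wprod (lg_h (r0^2) (r1^2)) K
       * lg_braid (Suc m) r0 r1 A B \<beta> (e0 # K) (e0 # K)) = laurent2_eval p (r0^2) (r1^2)"
    "\<And>r0 r1 Y. lg_params r0 r1 Y Y \<Longrightarrow>
       braid_operator (Suc m) (lg_R r0 r1 Y) (lg_h (r0^2) (r1^2)) \<beta> = scalar_op (laurent2_eval p (r0^2) (r1^2))"
proof -
  define c where "c r0 r1 A B a b = (\<Sum>K\<in>words m. wprod (lg_h (r0^2) (r1^2)) K
       * lg_braid (Suc m) r0 r1 A B \<beta> (a # K) (b # K))" for r0 r1 A B a b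
  have "\<forall>a. \<exists>p. \<forall>r0 r1 A B. lg_params r0 r1 A B \<longrightarrow> c r0 r1 A B a a = laurent2_eval p (r0^2) (r1^2)"
    using lg_closure_laurent[OF \<beta>] unfolding c_def by blast
  then obtain q where q: "\<And>a r0 r1 A B. lg_params r0 r1 A B \<Longrightarrow> c r0 r1 A B a a = laurent2_eval (q a) (r0^2) (r1^2)"
    by metis
  have diag: "c r0 r1 A B a a = laurent2_eval (q e0) (r0^2) (r1^2)" if "lg_params r0 r1 A B" for r0 r1 A B a
  proof -
    have r: "r0 \<noteq> 0" "r1 \<noteq> 0" using that by (auto simp: lg_params_def)
    \<comment> \<open>In this scaling the closures at \<open>a\<close> and at \<open>e0\<close> are
      known to agree; since the polynomials \<open>q a\<close> and \<open>q e0\<close> hold in every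
      scaling, the equality transfers.\<close>
    let ?A = "r0^2 - 1" and ?B = "1 - r1^2"
    have p: "lg_params r0 r1 ?A ?B" using r by (simp add: lg_params_def)
    have "c r0 r1 A B a a = c r0 r1 ?A ?B a a" using q[OF that] q[OF p] by simp
    also have "\<dots> = c r0 r1 ?A ?B e0 e0"
      unfolding c_def by (rule lg_polynomial_closure_scalar[OF r \<beta>])
    finally show ?thesis using q[OF p] by simp
  qed
  have off: "c r0 r1 A B a b = 0" if "a \<noteq> b" for r0 r1 A B a b
    unfolding c_def
  proof (intro sum.neutral ballI)
    fix K :: "lg_basis list"
    have "conserves lg_wt (lg_braid (Suc m) r0 r1 A B \<beta>)"
      by (rule conserves_braid[OF \<beta> lg_ker_wt])
    moreover have "lg_wt a \<noteq> lg_wt b" using that inj_lg_wt by (auto simp: inj_def)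
    ultimately have "lg_braid (Suc m) r0 r1 A B \<beta> (a # K) (b # K) = 0"
      unfolding conserves_def by fastforce
    then show "wprod (lg_h (r0^2) (r1^2)) K
       * lg_braid (Suc m) r0 r1 A B \<beta> (a # K) (b # K) = 0" by simp
  qed
  show ?thesis
  proof (rule that[of "q e0"])
    show "braid_operator (Suc m) (lg_R r0 r1 Y) (lg_h (r0^2) (r1^2)) \<beta> = scalar_op (laurent2_eval (q e0) (r0^2) (r1^2))"
      if p: "lg_params r0 r1 Y Y" for r0 r1 Y
    proof (intro ext)
      fix a b
      have cub: "cubic (r0^2) (r1^2) (lg_ker r0 r1 Y Y)"
        using p by (intro cubic_lg) (auto simp: lg_params_def)
      have "braid_operator (Suc m) (lg_R r0 r1 Y) (lg_h (r0^2) (r1^2)) \<beta> a b = c r0 r1 Y Y a b"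
        using braid_operator_mat[OF kmul_kinv[OF cub] ker_of_lg \<beta>] by (simp add: c_def)
      then show "braid_operator (Suc m) (lg_R r0 r1 Y) (lg_h (r0^2) (r1^2)) \<beta> a b
          = scalar_op (laurent2_eval (q e0) (r0^2) (r1^2)) a b"
        using diag[OF p] off by (auto simp: scalar_op_def)
    qed
  qed (use diag in \<open>auto simp: c_def\<close>)
qed

section \<open>Continuity in the parameter\<close>

lemma isCont_ado_ker: "t \<noteq> 0 \<Longrightarrow> isCont (\<lambda>t. ado_ker t p q) t"
  by (cases q; cases "fst q"; cases "snd q") (auto simp: ado_ker_table intro!: continuous_intros)

lemma isCont_ado_inv: "t \<noteq> 0 \<Longrightarrow> isCont (\<lambda>t. ado_inv t p q) t"
  unfolding kinv_def kmul_def by (intro continuous_intros isCont_ado_ker) auto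

lemma isCont_if_zero: "isCont f t \<Longrightarrow> isCont (\<lambda>t. if c then f t else 0) t"
  by (cases c) auto

lemma isCont_gm: "(\<And>p q. isCont (\<lambda>t. r t p q) t) \<Longrightarrow> isCont (\<lambda>t. gm (r t) i I J) (t :: complex)"
proof (induction i arbitrary: I J)
  case 0
  then show ?case
    by (cases "(r t, 0::nat, I, J)" rule: gm.cases) (auto intro: isCont_if_zero)
next
  case (Suc i)
  then show ?case
    by (cases "(r t, Suc i, I, J)" rule: gm.cases) (auto intro: isCont_if_zero)
qed

lemma isCont_braid_ado:
  assumes "t \<noteq> 0" shows "isCont (\<lambda>t. ado_braid n t \<beta> I J) t"
proof (induction \<beta> arbitrary: I)
  case (Cons l \<beta>)
  have "isCont (\<lambda>t. letter_mat n (ado_ker t) (ado_inv t) l I J) t" for I J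
    using isCont_gm[OF isCont_ado_ker[OF assms]] isCont_gm[OF isCont_ado_inv[OF assms]]
    by (cases l; cases "length I = n") (auto simp: gen_mat_def)
  then show ?case using Cons.IH unfolding braid_mat.simps mm_def by (intro continuous_intros)
qed simp

lemma isCont_eq_off_finite:
  fixes f g :: "complex \<Rightarrow> complex"
  assumes "isCont f t" "isCont g t" "finite S" "\<And>s. s \<notin> S \<Longrightarrow> f s = g s"
  shows "f t = g t"
proof -
  have "eventually (\<lambda>s. s \<notin> S) (at t)"
  proof -
    have "open (- (S - {t}))" by (intro open_Compl finite_imp_closed finite_Diff assms(3))
    then show ?thesis unfolding eventually_at_topological by (intro exI[of _ "- (S - {t})"]) auto
  qed
  then have "eventually (\<lambda>s. f s = g s) (at t)" by (rule eventually_mono) (rule assms(4))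
  from tendsto_cong[OF this] have "(g \<longlongrightarrow> f t) (at t)" using assms(1) by (simp add: isCont_def)
  moreover have "(g \<longlongrightarrow> g t) (at t)" using assms(2) by (simp add: isCont_def)
  ultimately show ?thesis by (rule tendsto_unique[OF at_neq_bot])
qed

lemma isCont_laurent_eval: "t \<noteq> 0 \<Longrightarrow> isCont (laurent_eval p) t"
  unfolding laurent_eval_def[abs_def] by (intro continuous_intros) auto

section \<open>The substitution\<close>

lemma Z_omega_closed:
  "of_int a \<in> Z_omega" "x \<in> Z_omega \<Longrightarrow> y \<in> Z_omega \<Longrightarrow> x + y \<in> Z_omega"
  "x \<in> Z_omega \<Longrightarrow> y \<in> Z_omega \<Longrightarrow> x * y \<in> Z_omega" "x \<in> Z_omega \<Longrightarrow> x ^ k \<in> Z_omega"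
proof -
  have int: "of_int a \<in> Z_omega" for a
    unfolding Z_omega_def by (rule CollectI, rule exI[of _ a], rule exI[of _ 0]) simp
  show "of_int a \<in> Z_omega" by (rule int)
  show "x + y \<in> Z_omega" if xy: "x \<in> Z_omega" "y \<in> Z_omega"
  proof -
    obtain a b c d where "x = of_int a + of_int b * omega" "y = of_int c + of_int d * omega"
      using xy unfolding Z_omega_def by blast
    then have "x + y = of_int (a + c) + of_int (b + d) * omega" by (simp add: algebra_simps)
    then show ?thesis unfolding Z_omega_def by blast
  qed
  have mult: "x * y \<in> Z_omega" if xy: "x \<in> Z_omega" "y \<in> Z_omega" for x y
  proof -
    obtain a b c d where "x = of_int a + of_int b * omega" "y = of_int c + of_int d * omega"
      using xy unfolding Z_omega_def by blast
    then have "x * y = of_int (a * c - b * d) + of_int (a * d + b * c + b * d) * omega"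
      by (simp add: algebra_simps omega_mult omega_mult_left)
    then show ?thesis unfolding Z_omega_def by blast
  qed
  show "x \<in> Z_omega \<Longrightarrow> y \<in> Z_omega \<Longrightarrow> x * y \<in> Z_omega" by (rule mult)
  show "x \<in> Z_omega \<Longrightarrow> x ^ k \<in> Z_omega"
    using int[of 1] by (induction k) (auto intro: mult)
qed

lemma omega_powi_Z_omega: "(omega ^ 2) powi k \<in> Z_omega"
proof -
  have omega: "omega \<in> Z_omega"
    unfolding Z_omega_def by (rule CollectI, rule exI[of _ 0], rule exI[of _ 1]) simp
  \<comment> \<open>Negative powers stay in the ring because \<open>omega\<close> has order
    six.\<close>
  have "inverse (omega^2) = omega^4"
    using omega_powers(3) by (intro inverse_unique) (simp flip: power_add)
  then show ?thesis
    using omega unfolding power_int_def by (auto intro!: Z_omega_closed)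
qed

lemma lookup_subst_Z_omega: "Poly_Mapping.lookup (subst_t2_omega p) k \<in> Z_omega"
proof -
  have sum: "(\<Sum>x\<in>S. f x) \<in> Z_omega" if "finite S" "\<And>x. x \<in> S \<Longrightarrow> f x \<in> Z_omega" for S :: "(int \<times> int) set" and f
    using that Z_omega_closed(1)[of 0] by (induction S rule: finite_induct) (auto intro: Z_omega_closed)
  then show ?thesis
    using Z_omega_closed(1)[of 0]
    unfolding subst_t2_omega_def lookup_sum case_prod_unfold lookup_single when_def
    by (intro sum) (auto intro!: Z_omega_closed omega_powi_Z_omega)
qed

lemma laurent_eval_add: "laurent_eval (p + q) t = laurent_eval p t + laurent_eval q t"
proof -
  let ?S = "Poly_Mapping.keys p \<union> Poly_Mapping.keys q"
  show ?thesis
    using keys_add[of p q] laurent_eval_superset[of ?S]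
    by (simp add: lookup_add sum.distrib algebra_simps)
qed

lemma laurent_eval_sum: "finite S \<Longrightarrow> laurent_eval (\<Sum>s\<in>S. f s) t = (\<Sum>s\<in>S. laurent_eval (f s) t)"
  by (induction S rule: finite_induct) (auto simp: laurent_eval_add laurent_eval_def[of 0])

lemma laurent_eval_single: "laurent_eval (Poly_Mapping.single k c) t = c * t powi k"
  by (simp add: laurent_eval_def)

lemma laurent_eval_subst:
  assumes "t \<noteq> 0" shows "laurent_eval (subst_t2_omega p) t = laurent2_eval p (t^2) (omega^2 / t^2)"
proof -
  have "t powi (2 * j - 2 * k) * (omega^2) powi k = (t^2) powi j * (omega^2 / t^2) powi k" for j k
  proof -
    have "t powi (2 * j - 2 * k) = t powi (2 * j) / t powi (2 * k)"
      using assms by (simp add: power_int_diff)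
    moreover have "t powi (2 * i) = (t^2) powi i" for i
      by (simp add: power_int_mult)
    ultimately show ?thesis by (simp add: power_int_divide_distrib)
  qed
  then show ?thesis
    by (simp add: subst_t2_omega_def laurent_eval_sum laurent2_eval_def case_prod_unfold laurent_eval_single
        ac_simps)
qed

lemma scalar_op_inject: "(scalar_op c :: 'b \<Rightarrow> _) = scalar_op d \<Longrightarrow> c = d"
proof -
  assume "(scalar_op c :: 'b \<Rightarrow> _) = scalar_op d"
  then have "scalar_op c (undefined :: 'b) undefined = scalar_op d (undefined :: 'b) undefined" by (simp only:)
  then show "c = d" by (simp add: scalar_op_def)
qed

theorem theorem1p1:
  fixes \<beta> :: braid_word
  assumes "\<beta> \<in> braid_words 5"
  shows "ADO3 5 \<beta> = subst_t2_omega (LG 5 \<beta>)"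
proof -
  have 5: "5 = Suc 4" by simp
  obtain p where p: "\<And>r0 r1 A B. lg_params r0 r1 A B \<Longrightarrow> (\<Sum>K\<in>words 4. wprod (lg_h (r0^2) (r1^2)) K
       * lg_braid 5 r0 r1 A B \<beta> (e0 # K) (e0 # K)) = laurent2_eval p (r0^2) (r1^2)"
    and lg: "\<And>r0 r1 Y. lg_params r0 r1 Y Y \<Longrightarrow>
       braid_operator 5 (lg_R r0 r1 Y) (lg_h (r0^2) (r1^2)) \<beta> = scalar_op (laurent2_eval p (r0^2) (r1^2))"
    using lg_operator[of \<beta> 4] assms unfolding 5 by blast
  have LG: "LG 5 \<beta> = p"
    unfolding LG_def
  proof (rule the_equality, goal_cases)
    case 1
    show ?case using lg by (auto simp: lg_params_def power2_eq_square)
  next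
    case (2 q)
    show "q = p"
    proof (rule laurent2_eval_inject)
      fix t0 t1 :: complex assume t: "t0 \<noteq> 0" "t1 \<noteq> 0"
      \<comment> \<open>Roots exist for every pair of nonzero \<open>t0\<close> and
        \<open>t1\<close>, so the defining property pins down the polynomial at all of them.\<close>
      let ?r0 = "csqrt t0" and ?r1 = "csqrt t1" and ?Y = "csqrt ((t0 - 1) * (1 - t1))"
      have "lg_params ?r0 ?r1 ?Y ?Y" using t by (simp add: lg_params_def flip: power2_eq_square)
      from lg[OF this] 2[rule_format, of t0 t1 ?r0 ?r1 ?Y] t
      have "(scalar_op (laurent2_eval q t0 t1) :: lg_basis \<Rightarrow> _) = scalar_op (laurent2_eval p t0 t1)" by simp
      then show "laurent2_eval q t0 t1 = laurent2_eval p t0 t1"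
        by (rule scalar_op_inject)
    qed
  qed
  define c where "c t = (\<Sum>K\<in>words 4. wprod (ado_h t) K
      * ado_braid 5 t \<beta> (v0 # K) (v0 # K))" for t
  have generic: "c t = laurent_eval (subst_t2_omega p) t" if t: "t \<noteq> 0" "t^2 \<noteq> 1" "t^2 \<noteq> omega^2" for t
  proof -
    let ?N = "braid_mat 5 (lg_special t) (kinv (t^2) (omega^2 / t^2) (lg_special t)) \<beta>"
    \<comment> \<open>The property of \<open>p\<close> covers this scaling too, since only the
      product of \<open>A\<close> and \<open>B\<close> is prescribed.\<close>
    have par: "lg_params t (- omega / t) (- (t - inverse t)) (- (t + inverse omega * inverse t))"
      using lg_special_AB[OF t(1)] t by (simp add: lg_params_def)
    have sq: "(- omega / t)^2 = omega^2 / t^2" by (simp add: power_divide)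
    have "c t = (\<Sum>K\<in>words 4. wprod (lg_h (t^2) (omega^2 / t^2)) K * ?N (e0 # K) (e0 # K))"
      unfolding c_def ado_right_left[OF t assms]
      using collapsed_trace[OF t(1), of 4] collapses_braid[OF t(1) assms] by simp
    also have "\<dots> = laurent2_eval p (t^2) (omega^2 / t^2)"
      using p[OF par] unfolding sq lg_special_def by simp
    finally show ?thesis using laurent_eval_subst[OF t(1)] by simp
  qed
  \<comment> \<open>The exceptional set consists of zero and the solutions of \<open>t^2 = 1\<close>
    and \<open>t^2 = omega^2\<close>; both sides are continuous at every nonzero
    \<open>t\<close>.\<close>
  have c: "c t = laurent_eval (subst_t2_omega p) t" if "t \<noteq> 0" for t
  proof (rule isCont_eq_off_finite[where f = c and S = "{0, 1, - 1, omega, - omega}"])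
    have "isCont (\<lambda>t. ado_h t a) t" for a by (cases a) (auto intro!: continuous_intros)
    then have "isCont (\<lambda>t. wprod (ado_h t) K) t" for K
      by (induction K) (auto intro!: continuous_intros)
    then show "isCont c t"
      unfolding c_def using isCont_braid_ado[OF that] by (intro continuous_intros)
    show "finite {0, 1, - 1, omega, - omega}" by simp
    show "c s = laurent_eval (subst_t2_omega p) s" if "s \<notin> {0, 1, - 1, omega, - omega}" for s
      using that by (intro generic) (auto simp: power2_eq_1_iff power2_eq_iff)
  qed (rule isCont_laurent_eval[OF that])
  have ado: "braid_operator 5 (ado_R t) (ado_h t) \<beta> = scalar_op (laurent_eval (subst_t2_omega p) t)" if "t \<noteq> 0" for t
    using ado_operator_scalar[OF that, of \<beta> 4] assms c[OF that] by (simp add: c_def)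
  have "ADO3 5 \<beta> = subst_t2_omega p"
    unfolding ADO3_def
  proof (rule the_equality, goal_cases)
    case 1
    show ?case using ado lookup_subst_Z_omega by blast
  next
    case (2 q)
    show "q = subst_t2_omega p"
    proof (rule laurent_eval_inject)
      fix t :: complex assume t: "t \<noteq> 0"
      then have "(scalar_op (laurent_eval q t) :: ado_basis \<Rightarrow> _) = scalar_op (laurent_eval (subst_t2_omega p) t)"
        using 2 ado by metis
      then show "laurent_eval q t = laurent_eval (subst_t2_omega p) t"
        by (rule scalar_op_inject)
    qed
  qed
  then show ?thesis by (simp add: LG)
qed

end
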